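(* Let $G$ be a finite soluble group. Then there exists a finite supersoluble group $H$ such that: (1) $\pi(H)=\pi(G)$; (2) $P_G(k)\ge P_H(k)$ for all $k\in\mathbb N$; (3) $d_p(G)\ge d_p(H)$ for all $p\in\pi(G)$; (4) $\pi(G/G')\subseteq\pi(H/H')$.
   Context: $\pi(X)$ denotes the set of primes dividing $|X|$; $P_G(k)$ is the probability that $k$ independent uniformly random elements of $G$ generate $G$; $d_p(G)$ is the minimal number of generators of a Sylow $p$-subgroup of $G$; $G'$ is the derived subgroup. *)

theory Defs
  imports "HOL-Algebra.Algebra" "HOL-Library.FuncSet" "HOL-Computational_Algebra.Primes"
begin

definition prime_divs :: "nat \<Rightarrow> nat set" where
  "prime_divs n = {p. Factorial_Ring.prime p \<and> p dvd n}"

definition supersolvable :: "('a, 'b) monoid_scheme \<Rightarrow> bool" where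
  "supersolvable G \<longleftrightarrow> group G \<and> (\<exists>(N :: nat \<Rightarrow> 'a set) n.
      N 0 = {\<one>\<^bsub>G\<^esub>} \<and> N n = carrier G \<and>
      (\<forall>i\<le>n. N i \<lhd> G) \<and>
      (\<forall>i<n. N i \<subseteq> N (Suc i) \<and>
              cyclic_group ((G\<lparr>carrier := N (Suc i)\<rparr>) Mod (N i))))"

definition gen_prob :: "('a, 'b) monoid_scheme \<Rightarrow> nat \<Rightarrow> real" where
  "gen_prob G k =
     real (card {f \<in> {..<k} \<rightarrow>\<^sub>E carrier G. generate G (f ` {..<k}) = carrier G})
     / real (card (carrier G)) ^ k"

definition sylow_subgroup :: "('a, 'b) monoid_scheme \<Rightarrow> nat \<Rightarrow> 'a set \<Rightarrow> bool" where
  "sylow_subgroup G p P \<longleftrightarrow> subgroup P G \<and> card P = p ^ multiplicity p (order G)"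

definition d_p :: "('a, 'b) monoid_scheme \<Rightarrow> nat \<Rightarrow> nat" where
  "d_p G p = (LEAST n. \<exists>P S. sylow_subgroup G p P \<and> S \<subseteq> P \<and> finite S \<and> card S = n
                            \<and> generate G S = P)"

abbreviation abelianization :: "('a, 'b) monoid_scheme \<Rightarrow> 'a set monoid" where
  "abelianization G \<equiv> G Mod (derived G (carrier G))"

end

theory Submission
  imports Defs "HOL-Number_Theory.Residue_Primitive_Roots"
begin

text \<open>
  Let \<open>a = |G/G'|\<close> and \<open>d\<^sub>p = d\<^sub>p(G)\<close>. Call a prime \<open>p\<close> dividing \<open>|G|\<close> twisted (\<open>\<epsilon> p = 1\<close>) if
  \<open>p\<close> does not divide \<open>a\<close> but some prime \<open>r p\<close> divides both \<open>a\<close> and \<open>p - 1\<close>. The group \<open>H\<close> is the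
  semidirect product of the abelian group \<open>T = \<Prod> C\<^sub>p\<^bsup>d\<^sub>p\<^esup>\<close> over the untwisted primes, acting on
  \<open>V = \<Prod> C\<^sub>p\<^bsup>d\<^sub>p\<^esup>\<close> over the twisted ones, where a factor \<open>C\<^bsub>r p\<^esub>\<close> of \<open>T\<close> acts on the
  \<open>p\<close>-part of \<open>V\<close> by scalars of order \<open>r p\<close>. Then
  \<open>P\<^sub>H(k) = \<Prod>\<^sub>p \<Prod>\<^bsub>j < d\<^sub>p\<^esub> (1 - p\<^bsup>j + \<epsilon> p\<^esup> / p\<^bsup>k\<^esup>)\<close> as soon as \<open>k \<ge> d\<^sub>p + \<epsilon> p\<close> for all \<open>p\<close>, and
  \<open>P\<^sub>H(k) = 0\<close> otherwise.

  For \<open>G\<close>, Gaschuetz's formula gives \<open>P\<^sub>G(k) = P\<^bsub>G/A\<^esub>(k) (1 - c / |A|\<^bsup>k\<^esup>)\<close> for a minimal normal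
  subgroup \<open>A\<close> with \<open>c\<close> complements. Choosing \<open>A \<subseteq> G'\<close> unless \<open>G\<close> is abelian keeps \<open>a\<close>
  unchanged. A complemented \<open>A\<close> of order \<open>p\<^bsup>n\<^esup>\<close> uses up one of the \<open>d\<^sub>p\<close> factors at \<open>p\<close>,
  because a complement produces a homomorphism from a Sylow subgroup \<open>P\<close> to \<open>\<int>/p\<close> that is not trivial
  on \<open>A\<close>, and \<open>P\<close> has at most \<open>p\<^bsup>d\<^sub>p\<^esup>\<close> homomorphisms to \<open>\<int>/p\<close>. It remains to bound
  \<open>c\<close>, the number of crossed homomorphisms \<open>G/A \<rightarrow> A\<close>: every chief factor of \<open>G/A\<close> isomorphic to
  \<open>A\<close> that contributes does so by a factor at most \<open>|C\<^sub>A(P)|\<close> and again accounts for a new homomorphism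
  \<open>P \<rightarrow> \<int>/p\<close>, while the crossed homomorphisms trivial on \<open>C\<^sub>G(A)\<close> are at most \<open>|A|\<close> in number.
\<close>

section \<open>Characters of finite p-groups\<close>

text \<open>The quantity carried through the induction is the number of homomorphisms from a Sylow
  p-subgroup P to Z/p, not d_p itself: it is at most p^(d_p), it passes to quotients, and it loses
  explicit factors p. The obstacle is an untwisted p when G is not abelian. A noncentral A of order
  p^n leaves up to |A| cocycles at the end of the descent, so after x descents c is at most
  |C_A(P)|^x |A|, and with only p^x bounded by p^(d_p - 1) this misses the target by one factor p.
  The factor is regained in one of three ways. If P moves A, then |C_A(P)| is at most |A|/p. If P
  centralises A and n is at least 2, splitting off A costs two characters at once. If n = 1, then
  G/C_G(A) is abelian of exponent dividing p - 1 and a quotient of G/G', so p - 1 and a cannot be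
  coprime; hence p divides a, and P has a character trivial on its intersection with G'. A twisted p
  needs no such saving: in H the column of \<lambda>_p - 1 costs exactly that factor. For H only the
  upper bound on the probability is proved, by counting tuples whose coordinate columns are
  independent.\<close>

lemma (in group) p_group_fixed_points:
  assumes ord: "order G = p ^ n" and p: "Factorial_Ring.prime p" and fin: "finite E"
    and closed: "\<And>g x. g \<in> carrier G \<Longrightarrow> x \<in> E \<Longrightarrow> act g x \<in> E"
    and one: "\<And>x. x \<in> E \<Longrightarrow> act \<one> x = x"
    and mult: "\<And>g h x. g \<in> carrier G \<Longrightarrow> h \<in> carrier G \<Longrightarrow> x \<in> E \<Longrightarrow> act (g \<otimes> h) x = act g (act h x)"
    and dvd: "p dvd card E"
  shows "p dvd card {x \<in> E. \<forall>g\<in>carrier G. act g x = x}"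
proof -
  define \<phi> where "\<phi> = (\<lambda>g. \<lambda>x\<in>E. act g x)"
  have ap: "\<phi> g x = act g x" if "x \<in> E" for g x using that by (simp add: \<phi>_def)
  have inv_act: "act (inv g) (act g x) = x" "act g (act (inv g) x) = x"
    if "g \<in> carrier G" "x \<in> E" for g x
    using that mult[of "inv g" g x] mult[of g "inv g" x] one by simp_all
  have bij: "\<phi> g \<in> Bij E" if "g \<in> carrier G" for g
  proof -
    have "bij_betw (\<phi> g) E E"
      by (rule bij_betw_byWitness[where f'="\<phi> (inv g)"]) (use that closed inv_act in \<open>auto simp: ap\<close>)
    thus ?thesis by (simp add: Bij_def \<phi>_def)
  qed
  have hom: "\<phi> \<in> hom G (BijGroup E)"
  proof (rule homI)
    fix g h assume gh: "g \<in> carrier G" "h \<in> carrier G"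
    have "\<phi> (g \<otimes> h) = compose E (\<phi> g) (\<phi> h)"
      using gh by (auto simp: fun_eq_iff compose_def \<phi>_def mult closed)
    thus "\<phi> (g \<otimes> h) = \<phi> g \<otimes>\<^bsub>BijGroup E\<^esub> \<phi> h"
      using gh bij by (simp add: BijGroup_def)
  qed (simp add: bij BijGroup_def)
  interpret ga: group_action G E \<phi>
    unfolding group_action_def group_hom_def group_hom_axioms_def
    using hom group_BijGroup is_group by blast
  define Fix where "Fix = {x \<in> E. \<forall>g\<in>carrier G. act g x = x}"
  let ?O = "orbits G E \<phi>"
  have fO: "finite ?O" unfolding orbits_def using fin by auto
  \<comment> \<open>Orbit lengths divide a power of p, so modulo p only the orbits of length 1
    count; these are the fixed points.\<close>
  have p_dvd: "p dvd card Z" if Z: "Z \<in> ?O" "card Z \<noteq> 1" for Z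
  proof -
    obtain x where x: "x \<in> E" "Z = orbit G \<phi> x" using Z by (auto simp: orbits_def)
    have "card Z dvd p ^ n"
      using ga.orbit_stabilizer_theorem[OF x(1)] x(2) ord by (metis dvd_triv_left)
    then obtain i where "card Z = p ^ i" using p divides_primepow_nat by blast
    with Z(2) show ?thesis by (cases i) auto
  qed
  have cardE: "card E = (\<Sum>Z\<in>?O. card Z)"
    using ga.disjoint_sum[OF fin, of "\<lambda>_. 1::nat"] fin by simp
  have split: "(\<Sum>Z\<in>?O. card Z) = (\<Sum>Z\<in>{Z\<in>?O. card Z = 1}. card Z) + (\<Sum>Z\<in>{Z\<in>?O. card Z \<noteq> 1}. card Z)"
    by (subst sum.union_disjoint[symmetric]) (auto intro!: sum.cong simp: fO)
  have "p dvd (\<Sum>Z\<in>{Z\<in>?O. card Z \<noteq> 1}. card Z)" by (rule dvd_sum) (use p_dvd in auto)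
  hence "p dvd (\<Sum>Z\<in>{Z\<in>?O. card Z = 1}. card Z)"
    using dvd unfolding cardE split by (simp only: dvd_add_left_iff)
  hence 1: "p dvd card {Z\<in>?O. card Z = 1}" by simp
  have mem: "x \<in> orbit G \<phi> x" if "x \<in> E" for x using ga.orbit_refl that .
  have "bij_betw (\<lambda>x. {x}) Fix {Z\<in>?O. card Z = 1}"
    unfolding bij_betw_def
  proof
    show "(\<lambda>x. {x}) ` Fix = {Z\<in>?O. card Z = 1}"
    proof (intro equalityI subsetI)
      fix Z assume "Z \<in> (\<lambda>x. {x}) ` Fix"
      then obtain x where x: "x \<in> Fix" "Z = {x}" by auto
      hence "orbit G \<phi> x = {x}" using mem[of x] by (auto simp: orbit_def Fix_def ap)
      thus "Z \<in> {Z\<in>?O. card Z = 1}" using x by (auto simp: orbits_def Fix_def)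
    next
      fix Z assume Z: "Z \<in> {Z\<in>?O. card Z = 1}"
      then obtain x where x: "x \<in> E" "Z = orbit G \<phi> x" by (auto simp: orbits_def)
      obtain y where "Z = {y}" using Z by (auto simp: card_1_singleton_iff)
      hence "x \<in> {y}" "orbit G \<phi> x = {y}" using x mem[of x] by simp_all
      hence Zx: "orbit G \<phi> x = {x}" by simp
      have "act g x = x" if "g \<in> carrier G" for g
      proof -
        have "\<phi> g x \<in> orbit G \<phi> x" using that by (auto simp: orbit_def)
        with Zx x show ?thesis by (simp add: ap)
      qed
      thus "Z \<in> (\<lambda>x. {x}) ` Fix" using x Zx by (auto simp: Fix_def)
    qed
  qed (auto simp: inj_on_def)
  hence "card Fix = card {Z\<in>?O. card Z = 1}" by (rule bij_betw_same_card)
  thus ?thesis using 1 by (simp add: Fix_def)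
qed

text \<open>\<open>M\<close> acts on its right cosets by right translation. Their number is
  divisible by p and \<open>M\<close> itself is fixed, so a second coset \<open>M #> x\<close> is
  fixed. Then \<open>x\<close> normalises \<open>M\<close>, and by maximality the normaliser is the
  whole group.\<close>

lemma (in group) maximal_subgroup_of_p_group_normal:
  assumes ord: "order G = p ^ n" and p: "Factorial_Ring.prime p"
    and M: "subgroup M G" "M \<noteq> carrier G"
    and max: "\<And>K. subgroup K G \<Longrightarrow> M \<subseteq> K \<Longrightarrow> K = M \<or> K = carrier G"
  shows "M \<lhd> G"
proof -
  interpret M: subgroup M G by fact
  have fin: "finite (carrier G)" using ord p order_gt_0_iff_finite by (metis prime_gt_0_nat zero_less_power)
  interpret MG: group "G\<lparr>carrier := M\<rparr>" using M.subgroup_is_group is_group .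
  define E where "E = rcosets M"
  have finE: "finite E" unfolding E_def RCOSETS_def using fin by simp
  have lag: "card E * card M = p ^ n" using lagrange[OF M(1)] ord by (simp add: E_def)
  have "card E dvd p ^ n" using lag by (metis dvd_triv_left)
  then obtain i where i: "card E = p ^ i" using p divides_primepow_nat by blast
  have "card E \<noteq> 1"
  proof
    assume "card E = 1"
    hence "card M = card (carrier G)" using lag ord by (simp add: order_def)
    thus False using card_subset_eq[OF fin M.subset] M(2) by simp
  qed
  hence pE: "p dvd card E" using i by (cases i) auto
  have "card M dvd p ^ n" using lag by (metis dvd_triv_right)
  then obtain m where m: "card M = p ^ m" using p divides_primepow_nat by blast
  define N where "N = {x \<in> carrier G. \<forall>y\<in>M. x \<otimes> y \<otimes> inv x \<in> M}"
  have Ecar: "U \<subseteq> carrier G" if "U \<in> E" for U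
    using that M.subset by (auto simp: E_def RCOSETS_def r_coset_def)
  have "p dvd card {U \<in> E. \<forall>g\<in>carrier (G\<lparr>carrier := M\<rparr>). U #> inv g = U}"
  proof (rule MG.p_group_fixed_points[OF _ p finE])
    show "order (G\<lparr>carrier := M\<rparr>) = p ^ m" by (simp add: order_def m)
    show "U #> inv g \<in> E" if g: "g \<in> carrier (G\<lparr>carrier := M\<rparr>)" and U: "U \<in> E" for g U
    proof -
      obtain x where x: "x \<in> carrier G" "U = M #> x" using U by (auto simp: E_def RCOSETS_def)
      have "U #> inv g = M #> (x \<otimes> inv g)"
        using x g M.subset by (simp add: coset_mult_assoc subset_iff)
      thus ?thesis using x g M.subset by (auto simp: E_def intro!: rcosetsI)
    qed
    show "U #> inv \<one>\<^bsub>G\<lparr>carrier := M\<rparr>\<^esub> = U" if "U \<in> E" for U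
      using Ecar[OF that] by simp
    show "U #> inv (g \<otimes>\<^bsub>G\<lparr>carrier := M\<rparr>\<^esub> h) = U #> inv h #> inv g"
      if "g \<in> carrier (G\<lparr>carrier := M\<rparr>)" "h \<in> carrier (G\<lparr>carrier := M\<rparr>)" "U \<in> E" for g h U
      using that Ecar[OF that(3)] M.subset by (simp add: coset_mult_assoc subset_iff inv_mult_group)
  qed (use pE in auto)
  then have pF: "p dvd card {U \<in> E. \<forall>g\<in>M. U #> inv g = U}" by simp
  have ME: "M \<in> {U \<in> E. \<forall>g\<in>M. U #> inv g = U}"
    using M.subgroup_in_rcosets[OF is_group] coset_join2[OF _ M(1)] M.subset by (auto simp: E_def subset_iff)
  have "card {U \<in> E. \<forall>g\<in>M. U #> inv g = U} \<noteq> 1"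
    using pF p by (metis not_prime_unit)
  moreover have "card {U \<in> E. \<forall>g\<in>M. U #> inv g = U} \<noteq> 0"
    using ME finE by (auto simp: card_eq_0_iff)
  ultimately have "\<not> {U \<in> E. \<forall>g\<in>M. U #> inv g = U} \<subseteq> {M}"
    by (metis (no_types, lifting) card.empty is_singletonI is_singleton_altdef subset_singletonD)
  then obtain U where U: "U \<in> E" "U \<noteq> M" "\<And>g. g \<in> M \<Longrightarrow> U #> inv g = U" by auto
  then obtain x where x: "x \<in> carrier G" "U = M #> x" by (auto simp: E_def RCOSETS_def)
  have xM: "x \<notin> M" using U(2) x coset_join2 M(1) by blast
  have xN: "x \<otimes> y \<otimes> inv x \<in> M" if y: "y \<in> M" for y
  proof -
    have "M #> x #> y = M #> x" using U(3)[of "inv y"] y x M.subset by auto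
    hence "M #> (x \<otimes> y) = M #> x" using x y M.subset by (simp add: coset_mult_assoc subset_iff)
    hence "x \<otimes> y \<in> M #> x" using rcos_self[OF _ M(1)] x y M.subset by (metis m_closed subset_iff)
    then obtain z where z: "z \<in> M" "x \<otimes> y = z \<otimes> x" by (auto simp: r_coset_def)
    have "x \<otimes> y \<otimes> inv x = z" using z x y M.subset by (simp add: m_assoc subset_iff)
    thus ?thesis using z by simp
  qed
  have Nsub: "subgroup N G"
  proof (rule subgroup.intro)
    show "N \<subseteq> carrier G" by (auto simp: N_def)
    show "\<one> \<in> N" by (auto simp: N_def)
    show "u \<otimes> v \<in> N" if "u \<in> N" "v \<in> N" for u v
    proof -
      have "(u \<otimes> v) \<otimes> y \<otimes> inv (u \<otimes> v) = u \<otimes> (v \<otimes> y \<otimes> inv v) \<otimes> inv u" if "y \<in> M" for y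
        using that \<open>u \<in> N\<close> \<open>v \<in> N\<close> by (simp add: N_def inv_mult_group m_assoc)
      thus ?thesis using that by (auto simp: N_def)
    qed
    \<comment> \<open>\<open>N\<close> only demands an inclusion, so inverses need finiteness:
      conjugation by \<open>u\<close> is an injective self-map of \<open>M\<close>, hence
      onto.\<close>
    show "inv u \<in> N" if u: "u \<in> N" for u
    proof -
      have uc: "u \<in> carrier G" using u by (simp add: N_def)
      let ?c = "\<lambda>y. u \<otimes> y \<otimes> inv u"
      have "?c ` M \<subseteq> M" using u by (auto simp: N_def)
      moreover have "inj_on ?c M" using uc M.subset by (auto simp: inj_on_def subset_iff)
      ultimately have surj: "?c ` M = M"
        using fin M.subset by (meson endo_inj_surj finite_subset)
      have "inv u \<otimes> y \<otimes> inv (inv u) \<in> M" if y: "y \<in> M" for y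
      proof -
        obtain z where z: "z \<in> M" "y = u \<otimes> z \<otimes> inv u" using surj y by blast
        have "inv u \<otimes> y \<otimes> inv (inv u) = z"
          using z uc by (simp add: m_assoc) (simp add: m_assoc[symmetric])
        thus ?thesis using z by simp
      qed
      thus ?thesis using uc by (auto simp: N_def)
    qed
  qed
  have "M \<subseteq> N" using M.subset M.m_closed M.m_inv_closed by (auto simp: N_def)
  moreover have "x \<in> N" using x xN by (simp add: N_def)
  ultimately have "N = carrier G" using max[OF Nsub] xM by auto
  thus ?thesis using M(1) by (auto simp: normal_inv_iff N_def)
qed

text \<open>Homomorphisms to Z/p with residues as values, made extensional so that they can be
  counted; \<open>U\<close> need not lie in \<open>P\<close>. For prime p they form a vector space
  over the field with p elements, and for a p-group \<open>P\<close> and empty \<open>U\<close> its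
  dimension is the minimal number of generators of \<open>P\<close> (Burnside's basis
  theorem).\<close>

definition zp_chars :: "('a, 'b) monoid_scheme \<Rightarrow> nat \<Rightarrow> 'a set \<Rightarrow> 'a set \<Rightarrow> ('a \<Rightarrow> nat) set" where
  "zp_chars G p P U = {\<chi> \<in> P \<rightarrow>\<^sub>E {..<p}.
     (\<forall>x\<in>P. \<forall>y\<in>P. \<chi> (x \<otimes>\<^bsub>G\<^esub> y) = (\<chi> x + \<chi> y) mod p) \<and> (\<forall>x\<in>P \<inter> U. \<chi> x = 0)}"

lemma finite_zp_chars: "finite P \<Longrightarrow> finite (zp_chars G p P U)"
  by (rule finite_subset[of _ "P \<rightarrow>\<^sub>E {..<p}"]) (auto simp: zp_chars_def intro!: finite_PiE)

lemma zp_chars_antimono: "U \<subseteq> Y \<Longrightarrow> zp_chars G p P Y \<subseteq> zp_chars G p P U"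
  by (auto simp: zp_chars_def)

text \<open>A maximal subgroup \<open>M\<close> above \<open>S\<close> is normal. For
  \<open>x\<close> outside \<open>M\<close>, every element is therefore an element of
  \<open>M\<close> times a power of \<open>x\<close>, and the exponent modulo p is the
  character.\<close>

lemma (in group) p_group_character:
  assumes ord: "order G = p ^ n" and p: "Factorial_Ring.prime p"
    and S: "subgroup S G" "S \<noteq> carrier G"
  shows "\<exists>\<chi>\<in>zp_chars G p (carrier G) S. \<exists>x\<in>carrier G. \<chi> x \<noteq> 0"
proof -
  have fin: "finite (carrier G)" using ord p order_gt_0_iff_finite by (metis prime_gt_0_nat zero_less_power)
  define \<M> where "\<M> = {M. subgroup M G \<and> S \<subseteq> M \<and> M \<noteq> carrier G}"
  have "finite \<M>" by (rule finite_subset[of _ "Pow (carrier G)"]) (auto simp: \<M>_def fin dest: subgroup.subset)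
  moreover have "S \<in> \<M>" using S by (simp add: \<M>_def)
  ultimately obtain M where M: "M \<in> \<M>" and Mmax: "\<And>K. K \<in> \<M> \<Longrightarrow> M \<subseteq> K \<Longrightarrow> M = K"
    using finite_has_maximal[of \<M>] by blast
  have sM: "subgroup M G" "S \<subseteq> M" "M \<noteq> carrier G" using M by (auto simp: \<M>_def)
  have max: "K = M \<or> K = carrier G" if "subgroup K G" "M \<subseteq> K" for K
    using Mmax[of K] that sM by (auto simp: \<M>_def)
  interpret M: normal M G by (rule maximal_subgroup_of_p_group_normal[OF ord p sM(1,3) max])
  obtain x where x: "x \<in> carrier G" "x \<notin> M" using sM(3) M.subset by blast
  define T where "T = {m \<otimes> x [^] (i::int) | m i. m \<in> M}"
  have conj: "x [^] (i::int) \<otimes> m \<otimes> inv (x [^] i) \<in> M" if "m \<in> M" for m i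
    using M.inv_op_closed2 that x by simp
  have prod: "(m \<otimes> x [^] i) \<otimes> (m' \<otimes> x [^] j) = (m \<otimes> (x [^] i \<otimes> m' \<otimes> inv (x [^] i))) \<otimes> x [^] (i + j)"
    if "m \<in> M" "m' \<in> M" for m m' and i j :: int
  proof -
    have "inv (x [^] i) \<otimes> x [^] (i + j) = x [^] j"
      using x by (simp add: int_pow_mult m_assoc[symmetric])
    hence "(x [^] i \<otimes> m' \<otimes> inv (x [^] i)) \<otimes> x [^] (i + j) = x [^] i \<otimes> m' \<otimes> x [^] j"
      using that x M.subset by (simp add: subset_iff m_assoc)
    thus ?thesis using that x M.subset by (simp add: m_assoc subset_iff)
  qed
  have "subgroup T G"
  proof (rule subgroupI)
    show "T \<subseteq> carrier G" using x M.subset by (auto simp: T_def)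
    show "T \<noteq> {}"
    proof -
      have "\<one> \<otimes> x [^] (0::int) \<in> T" unfolding T_def using M.one_closed by blast
    thus ?thesis by blast
    qed
    fix u assume "u \<in> T"
    then obtain m i where u: "u = m \<otimes> x [^] (i::int)" "m \<in> M" by (auto simp: T_def)
    have "inv u = inv (x [^] i) \<otimes> inv m" using u x M.subset by (simp add: inv_mult_group subset_iff)
    also have "\<dots> = (x [^] (-i) \<otimes> inv m \<otimes> inv (x [^] (-i))) \<otimes> x [^] (-i)"
      using u x M.subset by (simp add: m_assoc subset_iff int_pow_neg)
    finally show "inv u \<in> T" using conj[of "inv m" "-i"] u by (auto simp: T_def)
  next
    fix u v assume "u \<in> T" "v \<in> T"
    then obtain m i m' j where "u = m \<otimes> x [^] (i::int)" "m \<in> M" "v = m' \<otimes> x [^] (j::int)" "m' \<in> M"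
      by (auto simp: T_def)
    thus "u \<otimes> v \<in> T" using prod[of m m' i j] conj[of m' i] by (auto simp: T_def)
  qed
  moreover have "M \<subseteq> T"
  proof
    fix m assume "m \<in> M"
    moreover have "m = m \<otimes> x [^] (0::int)" using \<open>m \<in> M\<close> by simp
    ultimately show "m \<in> T" unfolding T_def by blast
  qed
  moreover have "x \<in> T"
  proof -
    have "x = \<one> \<otimes> x [^] (1::int)" using x by simp
    thus ?thesis unfolding T_def using M.one_closed by blast
  qed
  ultimately have T: "T = carrier G" using max x by blast
  \<comment> \<open>This makes the exponent well defined modulo p: if \<open>i\<close> were prime to
    p, Bezout with the group order would express \<open>x\<close> as a power of
    \<open>x [^] i\<close>, an element of \<open>M\<close>.\<close>
  have pdvd: "int p dvd i" if "x [^] (i::int) \<in> M" for i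
  proof (rule ccontr)
    assume "\<not> int p dvd i"
    hence "coprime i (int (p ^ n))"
      using p by (metis coprime_commute coprime_power_right_iff of_nat_power prime_imp_coprime prime_nat_int_transfer)
    then obtain u v where uv: "u * i + v * int (p ^ n) = 1"
      by (metis bezout_int coprime_imp_gcd_eq_1)
    have "x [^] int (p ^ n) = \<one>"
      using pow_order_eq_1[OF x(1)] ord int_pow_int by metis
    hence "x [^] (int (p ^ n) * v) = \<one>" using x by (simp flip: int_pow_pow)
    hence "x [^] (i * u + int (p ^ n) * v) = (x [^] i) [^] u"
      using x by (simp only: int_pow_mult int_pow_pow r_one int_pow_closed)
    hence "x = (x [^] i) [^] u" using uv x by (simp add: mult.commute)
    also have "\<dots> \<in> M" using that sM(1) subgroup_int_pow_closed by blast
    finally show False using x by simp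
  qed
  define ind where "ind g = (SOME i::int. \<exists>m\<in>M. g = m \<otimes> x [^] i)" for g
  have ind: "\<exists>m\<in>M. g = m \<otimes> x [^] ind g" if "g \<in> carrier G" for g
    proof -
    have "g \<in> T" using that T by simp
    then obtain m i where "m \<in> M" "g = m \<otimes> x [^] (i::int)" by (auto simp: T_def)
    hence "\<exists>i::int. \<exists>m\<in>M. g = m \<otimes> x [^] i" by blast
    thus ?thesis unfolding ind_def by (rule someI_ex)
  qed
  have uniq: "[i = j] (mod int p)"
    if "m \<otimes> x [^] i = m' \<otimes> x [^] j" "m \<in> M" "m' \<in> M" for m m' i j
  proof -
    have c: "m \<in> carrier G" "m' \<in> carrier G" "x \<in> carrier G" using that x M.subset by auto
    have "inv m' \<otimes> (m \<otimes> x [^] i) = x [^] j" unfolding that(1) using c by (simp add: m_assoc[symmetric])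
    hence "inv m' \<otimes> m \<otimes> x [^] i = x [^] j" using c by (simp add: m_assoc)
    hence "inv m' \<otimes> m = x [^] j \<otimes> inv (x [^] i)" using c inv_solve_right[of "inv m' \<otimes> m" "x [^] j" "x [^] i"] by simp
    also have "\<dots> = x [^] (j - i)" using c by (simp add: int_pow_diff)
    finally have "x [^] (j - i) \<in> M" using that(2,3) by (metis M.m_closed M.m_inv_closed)
    from pdvd[OF this] show ?thesis by (simp add: cong_iff_dvd_diff dvd_diff_commute)
  qed
  define \<chi> where "\<chi> = (\<lambda>g\<in>carrier G. nat (ind g mod int p))"
  have p0: "int p > 0" using p prime_gt_0_nat by simp
  have chiI: "\<chi> g = nat (i mod int p)" if "g = m \<otimes> x [^] i" "m \<in> M" for g m i
  proof -
    have g: "g \<in> carrier G" using that x M.subset by auto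
    obtain m' where m': "m' \<in> M" "g = m' \<otimes> x [^] ind g" using ind[OF g] by blast
    have "[ind g = i] (mod int p)"
      by (rule uniq[OF trans[OF m'(2)[symmetric] that(1)] m'(1) that(2)])
    thus ?thesis using g by (simp add: \<chi>_def cong_def)
  qed
  have "\<chi> \<in> zp_chars G p (carrier G) S"
    unfolding zp_chars_def
  proof (intro CollectI conjI ballI)
    show "\<chi> \<in> carrier G \<rightarrow>\<^sub>E {..<p}" using p0 by (auto simp: \<chi>_def nat_less_iff)
    show "\<chi> s = 0" if "s \<in> carrier G \<inter> S" for s
      using chiI[of s s 0] that sM by auto
    fix g h assume gh: "g \<in> carrier G" "h \<in> carrier G"
    obtain m m' where m: "m \<in> M" "g = m \<otimes> x [^] ind g" "m' \<in> M" "h = m' \<otimes> x [^] ind h"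
      using ind gh by meson
    have "\<chi> (g \<otimes> h) = nat ((ind g + ind h) mod int p)"
    proof (rule chiI)
      show "g \<otimes> h = (m \<otimes> (x [^] ind g \<otimes> m' \<otimes> inv (x [^] ind g))) \<otimes> x [^] (ind g + ind h)"
        using prod[OF m(1,3), of "ind g" "ind h"] unfolding m(2)[symmetric] m(4)[symmetric] .
      show "m \<otimes> (x [^] ind g \<otimes> m' \<otimes> inv (x [^] ind g)) \<in> M"
        using conj[OF m(3)] m(1) by (rule M.m_closed[rotated])
    qed
    moreover have "int (\<chi> g) = ind g mod int p" "int (\<chi> h) = ind h mod int p"
      using gh p0 by (simp_all add: \<chi>_def)
    ultimately have "int (\<chi> (g \<otimes> h)) = int ((\<chi> g + \<chi> h) mod p)"
      using p0 by (simp add: zmod_int mod_simps)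
    thus "\<chi> (g \<otimes> h) = (\<chi> g + \<chi> h) mod p" by (simp only: of_nat_eq_iff)
  qed
  moreover have "\<chi> x \<noteq> 0"
  proof -
    have "\<chi> x = nat (1 mod int p)" using chiI[of x \<one> 1] x by simp
    thus ?thesis using prime_gt_1_nat[OF p] by simp
  qed
  ultimately show ?thesis using x by blast
qed

text \<open>The characters trivial on \<open>Y\<close> form a subspace that misses
  \<open>\<chi>\<close>. The sums \<open>i * \<chi> + \<psi>\<close> are distinct: at a point of
  \<open>Y\<close> where \<open>\<chi>\<close> is nonzero, hence invertible modulo p, the value
  determines \<open>i\<close>.\<close>

lemma (in group) card_zp_chars_less:
  assumes p: "Factorial_Ring.prime p" and fin: "finite P" and P: "subgroup P G"
    and sub: "U \<subseteq> Y" and \<chi>: "\<chi> \<in> zp_chars G p P U" "\<chi> \<notin> zp_chars G p P Y"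
  shows "p * card (zp_chars G p P Y) \<le> card (zp_chars G p P U)"
proof -
  define F where "F = (\<lambda>(i, \<psi>). \<lambda>x\<in>P. (i * \<chi> x + \<psi> x) mod p)"
  obtain y where y: "y \<in> P" "y \<in> Y" "\<chi> y \<noteq> 0" using \<chi> by (auto simp: zp_chars_def)
  have "\<chi> y < p" using \<chi>(1) y by (auto simp: zp_chars_def PiE_iff)
  hence cop: "coprime (\<chi> y) p" using p y by (metis coprime_commute dvd_imp_le gr0I leD prime_imp_coprime)
  have "inj_on F ({..<p} \<times> zp_chars G p P Y)"
  proof (rule inj_onI, clarify)
    fix i \<psi> j \<psi>' assume i: "i < p" "j < p" and \<psi>: "\<psi> \<in> zp_chars G p P Y" "\<psi>' \<in> zp_chars G p P Y"
      and eq: "F (i, \<psi>) = F (j, \<psi>')"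
    have e: "(i * \<chi> x + \<psi> x) mod p = (j * \<chi> x + \<psi>' x) mod p" if "x \<in> P" for x
      using fun_cong[OF eq, of x] that by (simp add: F_def)
    have "\<psi> y = 0" "\<psi>' y = 0" using \<psi> y by (auto simp: zp_chars_def)
    hence "[i * \<chi> y = j * \<chi> y] (mod p)" using e[OF y(1)] by (simp add: cong_def)
    hence "[i = j] (mod p)" using cop cong_mult_rcancel_nat by blast
    hence ij: "i = j" using i by (simp add: cong_def)
    have "\<psi> x = \<psi>' x" for x
    proof (cases "x \<in> P")
      case True
      have "[\<psi> x = \<psi>' x] (mod p)" using e[OF True] ij by (metis cong_add_lcancel_nat cong_def)
      moreover have "\<psi> x < p" "\<psi>' x < p" using \<psi> True by (auto simp: zp_chars_def PiE_iff)
      ultimately show ?thesis by (simp add: cong_def)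
    next
      case False
      thus ?thesis using \<psi> by (auto simp: zp_chars_def PiE_iff extensional_def)
    qed
    thus "i = j \<and> \<psi> = \<psi>'" using ij by auto
  qed
  moreover have "F ` ({..<p} \<times> zp_chars G p P Y) \<subseteq> zp_chars G p P U"
  proof clarify
    fix i \<psi> assume \<psi>: "\<psi> \<in> zp_chars G p P Y"
    have "F (i, \<psi>) (x \<otimes> y) = (F (i, \<psi>) x + F (i, \<psi>) y) mod p"
      if "x \<in> P" "y \<in> P" for x y
    proof -
      have "\<chi> (x \<otimes> y) = (\<chi> x + \<chi> y) mod p" "\<psi> (x \<otimes> y) = (\<psi> x + \<psi> y) mod p"
        using \<chi>(1) \<psi> that by (auto simp: zp_chars_def)
      moreover have "(i * ((\<chi> x + \<chi> y) mod p) + (\<psi> x + \<psi> y) mod p) mod p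
          = ((i * \<chi> x + \<psi> x) mod p + (i * \<chi> y + \<psi> y) mod p) mod p"
      proof -
        have "[i * ((\<chi> x + \<chi> y) mod p) + (\<psi> x + \<psi> y) mod p = i * (\<chi> x + \<chi> y) + (\<psi> x + \<psi> y)] (mod p)"
          by (intro cong_add cong_mult) (simp_all add: cong_def)
        moreover have "[(i * \<chi> x + \<psi> x) mod p + (i * \<chi> y + \<psi> y) mod p = (i * \<chi> x + \<psi> x) + (i * \<chi> y + \<psi> y)] (mod p)"
          by (intro cong_add) (simp_all add: cong_def)
        ultimately show ?thesis by (simp add: cong_def algebra_simps)
      qed
      ultimately show ?thesis using that subgroup.m_closed[OF P] by (simp add: F_def)
    qed
    thus "F (i, \<psi>) \<in> zp_chars G p P U"
      using \<chi>(1) \<psi> sub p prime_gt_0_nat[OF p] by (auto simp: zp_chars_def F_def)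
  qed
  ultimately have "card ({..<p} \<times> zp_chars G p P Y) \<le> card (zp_chars G p P U)"
    using card_inj_on_le finite_zp_chars[OF fin] by blast
  thus ?thesis by (simp add: card_cartesian_product)
qed

section \<open>Sylow subgroups and normal subgroups\<close>

lemma (in group) mult_inv_cancel [simp]:
  assumes "x \<in> carrier G" "y \<in> carrier G"
  shows "x \<otimes> (inv x \<otimes> y) = y" "inv x \<otimes> (x \<otimes> y) = y"
  using assms by (simp_all add: m_assoc[symmetric])

text \<open>Each fibre of the multiplication map on \<open>H \<times> K\<close> is a copy of
  \<open>H \<inter> K\<close>, which acts on it by
  \<open>(h \<otimes> z, inv z \<otimes> k)\<close>.\<close>

lemma (in group) card_set_mult_subgroups:
  assumes "finite (carrier G)" and H: "subgroup H G" and K: "subgroup K G"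
  shows "card (H <#> K) * card (H \<inter> K) = card H * card K"
proof -
  interpret H: subgroup H G by fact
  interpret K: subgroup K G by fact
  have fin: "finite H" "finite K" using assms H.subset K.subset finite_subset by blast+
  let ?F = "\<lambda>x. {(h, k) \<in> H \<times> K. h \<otimes> k = x}"
  have fib: "card (?F x) = card (H \<inter> K)" if x: "x \<in> H <#> K" for x
  proof -
    obtain h k where hk: "h \<in> H" "k \<in> K" "x = h \<otimes> k" using x by (auto simp: set_mult_def)
    have c: "h \<in> carrier G" "k \<in> carrier G" using hk H.subset K.subset by auto
    have "bij_betw (\<lambda>z. (h \<otimes> z, inv z \<otimes> k)) (H \<inter> K) (?F x)"
    proof (rule bij_betw_byWitness[where f'="\<lambda>(u, v). inv h \<otimes> u"])
      show "\<forall>z\<in>H \<inter> K. (case (h \<otimes> z, inv z \<otimes> k) of (u, v) \<Rightarrow> inv h \<otimes> u) = z"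
        using c H.subset by (auto simp: m_assoc[symmetric] subset_iff)
      show "(\<lambda>z. (h \<otimes> z, inv z \<otimes> k)) ` (H \<inter> K) \<subseteq> ?F x"
        using hk c H.subset by (auto simp: m_assoc subset_iff)
      have *: "inv h \<otimes> u = k \<otimes> inv v" if uv: "u \<in> H" "v \<in> K" "u \<otimes> v = x" for u v
      proof -
        have cu: "u \<in> carrier G" "v \<in> carrier G" using uv H.subset K.subset by auto
        have "inv h \<otimes> u \<otimes> v = inv h \<otimes> x" using c cu uv(3) by (simp add: m_assoc)
        also have "\<dots> = k" using c hk by (simp add: m_assoc[symmetric])
        finally show ?thesis using c cu inv_solve_right[of "inv h \<otimes> u" k v] by simp
      qed
      show "\<forall>q\<in>?F x. (\<lambda>z. (h \<otimes> z, inv z \<otimes> k)) (case q of (u, v) \<Rightarrow> inv h \<otimes> u) = q"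
      proof
        fix q assume "q \<in> ?F x"
        then obtain u v where uv: "u \<in> H" "v \<in> K" "x = u \<otimes> v" and q: "q = (u, v)" by auto
        have cu: "u \<in> carrier G" "v \<in> carrier G" using uv H.subset K.subset by auto
        have "inv (inv h \<otimes> u) \<otimes> k = inv (k \<otimes> inv v) \<otimes> k" using *[OF uv(1,2) uv(3)[symmetric]] by simp
        also have "\<dots> = v \<otimes> (inv k \<otimes> k)" using c cu by (simp add: inv_mult_group m_assoc del: l_inv)
        finally show "(\<lambda>z. (h \<otimes> z, inv z \<otimes> k)) (case q of (u, v) \<Rightarrow> inv h \<otimes> u) = q"
          using c cu q by simp
      qed
      show "(\<lambda>(u, v). inv h \<otimes> u) ` ?F x \<subseteq> H \<inter> K"
      proof
        fix w assume "w \<in> (\<lambda>(u, v). inv h \<otimes> u) ` ?F x"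
        then obtain u v where uv: "u \<in> H" "v \<in> K" "x = u \<otimes> v" and w: "w = inv h \<otimes> u" by auto
        have "inv h \<otimes> u = k \<otimes> inv v" using *[OF uv(1,2) uv(3)[symmetric]] .
        thus "w \<in> H \<inter> K" using uv hk w by (metis H.m_closed H.m_inv_closed IntI K.m_closed K.m_inv_closed)
      qed
    qed
    thus ?thesis by (simp add: bij_betw_same_card)
  qed
  have HK: "(\<Union>x\<in>H <#> K. ?F x) = H \<times> K" by (auto simp: set_mult_def)
  have finHK: "finite (H <#> K)" unfolding set_mult_def using fin by auto
  have finF: "finite (?F x)" for x by (rule finite_subset[of _ "H \<times> K"]) (use fin in auto)
  have "card (\<Union>x\<in>H <#> K. ?F x) = (\<Sum>x\<in>H <#> K. card (?F x))"
    by (rule card_UN_disjoint[OF finHK]) (use finF in auto)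
  hence "card (H \<times> K) = (\<Sum>x\<in>H <#> K. card (?F x))" unfolding HK .
  also have "\<dots> = card (H <#> K) * card (H \<inter> K)" using fib by simp
  finally show ?thesis by (simp add: card_cartesian_product)
qed

lemma (in group) card_subgroup_dvd:
  assumes "subgroup H G" "subgroup K G" "H \<subseteq> K"
  shows "card H dvd card K"
proof -
  interpret K: group "G\<lparr>carrier := K\<rparr>" using assms(2) subgroup.subgroup_is_group is_group by blast
  have "subgroup H (G\<lparr>carrier := K\<rparr>)" using assms subgroup_incl by blast
  hence "card (rcosets\<^bsub>G\<lparr>carrier := K\<rparr>\<^esub> H) * card H = card K"
    using K.lagrange by (simp add: order_def)
  thus ?thesis by (metis dvd_triv_right)
qed

lemma sylow_subgroup_exists:
  assumes "group G" "finite (carrier G)" "Factorial_Ring.prime p"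
  shows "\<exists>P. sylow_subgroup G p P"
proof -
  interpret group G by fact
  have "order G \<noteq> 0" using assms order_gt_0_iff_finite by simp
  then obtain m where "order G = p ^ multiplicity p (order G) * m"
    using multiplicity_dvd[of p "order G"] by (auto simp: dvd_def)
  from sylow_thm[OF assms(3,1) this assms(2)] show ?thesis by (auto simp: sylow_subgroup_def)
qed

lemma (in group) sylow_index_not_dvd:
  assumes "finite (carrier G)" "Factorial_Ring.prime p" "sylow_subgroup G p P" "order G = card P * m"
  shows "\<not> p dvd m"
proof
  assume "p dvd m"
  hence "p ^ Suc (multiplicity p (order G)) dvd order G"
    using assms(3,4) by (metis mult_dvd_mono dvd_refl power_Suc2 sylow_subgroup_def)
  moreover have "order G \<noteq> 0" using assms order_gt_0_iff_finite by simp
  ultimately show False using assms(2) by (metis multiplicity_geI not_prime_unit Suc_n_not_le_n)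
qed

text \<open>By the product formula the index of KP in DP is a power of p, and it is prime to p
  because KP contains the Sylow subgroup P. So KP = DP. In this form a Sylow subgroup is seen to
  cover every normal section that is a p-group.\<close>

lemma (in group) normal_subset_mult_sylow:
  assumes fin: "finite (carrier G)" and p: "Factorial_Ring.prime p" and P: "sylow_subgroup G p P"
    and K: "K \<lhd> G" and D: "D \<lhd> G" and KD: "K \<subseteq> D" and card: "card D = card K * p ^ m"
    and d: "d \<in> D"
  shows "\<exists>k\<in>K. \<exists>y\<in>P \<inter> D. d = k \<otimes> y"
proof -
  interpret K: normal K G by fact
  interpret D: normal D G by fact
  have sP: "subgroup P G" and cP: "card P = p ^ multiplicity p (order G)"
    using P by (auto simp: sylow_subgroup_def)
  interpret P: subgroup P G by fact
  have DP: "subgroup (D <#> P) G" using mult_norm_subgroup[OF D sP] commut_normal[OF sP D] by simp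
  have KP: "subgroup (K <#> P) G" using mult_norm_subgroup[OF K sP] commut_normal[OF sP K] by simp
  have sub: "K <#> P \<subseteq> D <#> P" "P \<subseteq> K <#> P" "D \<subseteq> D <#> P"
  proof -
    show "K <#> P \<subseteq> D <#> P" using KD mono_set_mult by blast
    show "P \<subseteq> K <#> P"
    proof
      fix x assume "x \<in> P"
      hence "x = \<one> \<otimes> x" using P.subset by auto
      thus "x \<in> K <#> P" using \<open>x \<in> P\<close> K.one_closed unfolding set_mult_def by blast
    qed
    show "D \<subseteq> D <#> P"
    proof
      fix x assume "x \<in> D"
      hence "x = x \<otimes> \<one>" using D.subset by auto
      thus "x \<in> D <#> P" using \<open>x \<in> D\<close> P.one_closed unfolding set_mult_def by blast
    qed
  qed
  obtain r where r: "card (D <#> P) = card (K <#> P) * r"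
    using card_subgroup_dvd[OF KP DP sub(1)] by (auto simp: dvd_def)
  obtain s where s: "card (K <#> P) = card P * s"
    using card_subgroup_dvd[OF sP KP sub(2)] by (auto simp: dvd_def)
  obtain t where t: "order G = card (D <#> P) * t"
    using lagrange[OF DP] by (metis mult.commute)
  have "order G = card P * (s * r * t)" using r s t by simp
  from sylow_index_not_dvd[OF fin p P this] have pr: "\<not> p dvd r" by auto
  have pos: "card K > 0" "card P > 0" "card (K <#> P) > 0"
    using subgroup.finite_imp_card_positive[OF _ fin] K.subgroup_axioms sP KP by blast+
  have 1: "card (D <#> P) * card (D \<inter> P) = card D * card P"
    and 2: "card (K <#> P) * card (K \<inter> P) = card K * card P"
    using card_set_mult_subgroups[OF fin] K.subgroup_axioms D.subgroup_axioms sP by blast+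
  have "card (K <#> P) * (r * card (D \<inter> P)) = card (K <#> P) * (p ^ m * card (K \<inter> P))"
    using 1 2 r card by (simp add: algebra_simps)
  hence 3: "r * card (D \<inter> P) = p ^ m * card (K \<inter> P)" using pos by simp
  have "card (K \<inter> P) dvd card P"
    by (rule card_subgroup_dvd[OF _ sP]) (auto intro: subgroups_Inter_pair K.subgroup_axioms sP)
  then obtain i where "card (K \<inter> P) = p ^ i" using cP p divides_primepow_nat by metis
  hence "r dvd p ^ (m + i)" using 3 by (metis dvd_triv_left power_add)
  then obtain l where "r = p ^ l" using p divides_primepow_nat by blast
  with pr have "r = 1" by (cases l) auto
  hence "card (K <#> P) = card (D <#> P)" using r by simp
  hence "K <#> P = D <#> P"
    using card_subset_eq[OF _ sub(1)] subgroup.subset[OF DP] fin finite_subset by metis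
  hence "d \<in> K <#> P" using d sub(3) by blast
  then obtain k y where ky: "k \<in> K" "y \<in> P" "d = k \<otimes> y" by (auto simp: set_mult_def)
  have "y = inv k \<otimes> d" using ky K.subset P.subset by (auto simp: m_assoc[symmetric])
  hence "y \<in> D" using ky KD d D.m_closed D.m_inv_closed by (metis subsetD)
  thus ?thesis using ky by blast
qed

section \<open>Crossed homomorphisms into a minimal normal subgroup\<close>

lemma card_le_fibres:
  assumes "finite S" "finite T" "g ` S \<subseteq> T" "\<And>y. y \<in> T \<Longrightarrow> card {x \<in> S. g x = y} \<le> k"
  shows "card S \<le> card T * k"
proof -
  have "card S = (\<Sum>y\<in>T. card {x \<in> S. g x = y})"
    using sum.group[OF assms(1-3), of "\<lambda>_. 1::nat"] by simp
  also have "\<dots> \<le> (\<Sum>y\<in>T. k)" by (rule sum_mono) (rule assms(4))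
  finally show ?thesis by simp
qed

lemma card_eq_fibres:
  assumes "finite S" "finite T" "g ` S \<subseteq> T" "\<And>y. y \<in> T \<Longrightarrow> card {x \<in> S. g x = y} = k"
  shows "card S = card T * k"
  using sum.group[OF assms(1-3), of "\<lambda>_. 1::nat"] assms(4) by simp

lemma (in group) pow_coprime_eq_one:
  assumes "x \<in> carrier G" "x [^] (m::nat) = \<one>" "x [^] (k::nat) = \<one>" "coprime m k"
  shows "x = \<one>"
proof -
  have "ord x dvd m" "ord x dvd k" using assms pow_eq_id by auto
  hence "ord x = 1" using assms(4) by (metis coprime_common_divisor_nat)
  thus ?thesis using assms(1) ord_eq_1 by simp
qed

lemma (in group) mult_inv_eq_one:
  "x \<in> carrier G \<Longrightarrow> y \<in> carrier G \<Longrightarrow> x \<otimes> inv y = \<one> \<Longrightarrow> x = y"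
  using inv_equality[of x "inv y"] by simp

text \<open>Solubility enters only through its consequence that \<open>A\<close> is elementary
  abelian; \<open>solvable_min_normal\<close> supplies the instances.\<close>

locale min_normal = group G for G (structure) +
  fixes A :: "'a set" and p n :: nat
  assumes fin: "finite (carrier G)"
    and A_normal: "A \<lhd> G"
    and p: "Factorial_Ring.prime p"
    and card_A: "card A = p ^ n"
    and A_nontriv: "A \<noteq> {\<one>}"
    and A_comm: "a \<in> A \<Longrightarrow> b \<in> A \<Longrightarrow> a \<otimes> b = b \<otimes> a"
    and A_exp: "a \<in> A \<Longrightarrow> a [^] p = \<one>"
    and A_min: "N \<lhd> G \<Longrightarrow> N \<subseteq> A \<Longrightarrow> N = {\<one>} \<or> N = A"
begin

abbreviation cj :: "'a \<Rightarrow> 'a \<Rightarrow> 'a" where "cj x a \<equiv> x \<otimes> a \<otimes> inv x"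

definition C :: "'a set" where "C = {g \<in> carrier G. \<forall>a\<in>A. cj g a = a}"

text \<open>Crossed homomorphisms (1-cocycles) \<open>G \<rightarrow> A\<close> for the conjugation action, trivial on \<open>N\<close>.\<close>

definition Z :: "'a set \<Rightarrow> ('a \<Rightarrow> 'a) set" where
  "Z N = {f \<in> carrier G \<rightarrow>\<^sub>E A. (\<forall>x\<in>carrier G. \<forall>y\<in>carrier G. f (x \<otimes> y) = f x \<otimes> cj x (f y))
      \<and> (\<forall>x\<in>carrier G \<inter> N. f x = \<one>)}"

sublocale A: normal A G by (rule A_normal)

lemma A_carrier: "a \<in> A \<Longrightarrow> a \<in> carrier G" using A.subset by auto

lemma finite_A: "finite A" using fin A.subset finite_subset by blast

lemma n_pos: "n > 0"
proof (rule ccontr)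
  assume "\<not> n > 0"
  hence "card A = 1" using card_A by simp
  then obtain y where "A = {y}" by (auto simp: card_1_singleton_iff)
  thus False using A.one_closed A_nontriv by auto
qed

lemma A_lcomm: "a \<in> A \<Longrightarrow> b \<in> A \<Longrightarrow> c \<in> A \<Longrightarrow> a \<otimes> (b \<otimes> c) = b \<otimes> (a \<otimes> c)"
  using A_comm[of a b] by (simp add: A_carrier m_assoc[symmetric])

lemma cj_closed: "x \<in> carrier G \<Longrightarrow> a \<in> A \<Longrightarrow> cj x a \<in> A" by (rule A.inv_op_closed2)

lemma cj_mult:
  "x \<in> carrier G \<Longrightarrow> a \<in> carrier G \<Longrightarrow> b \<in> carrier G \<Longrightarrow> cj x (a \<otimes> b) = cj x a \<otimes> cj x b"
  by (simp add: m_assoc)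

lemma cj_cj: "x \<in> carrier G \<Longrightarrow> y \<in> carrier G \<Longrightarrow> a \<in> carrier G \<Longrightarrow> cj x (cj y a) = cj (x \<otimes> y) a"
  by (simp add: m_assoc inv_mult_group)

lemma cj_inv: "x \<in> carrier G \<Longrightarrow> a \<in> carrier G \<Longrightarrow> cj x (inv a) = inv (cj x a)"
  by (simp add: m_assoc inv_mult_group)

lemma cj_eq_one: "x \<in> carrier G \<Longrightarrow> a \<in> carrier G \<Longrightarrow> cj x a = \<one> \<longleftrightarrow> a = \<one>"
proof
  assume "x \<in> carrier G" "a \<in> carrier G" "cj x a = \<one>"
  thus "a = \<one>" by (metis inv_closed inv_equality inv_inv l_cancel_one' m_assoc m_closed r_inv)
qed simp

text \<open>Used together with \<open>A_min\<close>: a normal subgroup that moves some element of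
  \<open>A\<close> fixes only the identity in \<open>A\<close>.\<close>

lemma centralizer_normal:
  assumes B: "B \<lhd> G"
  shows "{a \<in> A. \<forall>b\<in>B. cj b a = a} \<lhd> G"
proof -
  interpret B: normal B G by fact
  let ?S = "{a \<in> A. \<forall>b\<in>B. cj b a = a}"
  have "subgroup ?S G"
  proof (rule subgroupI)
    show "?S \<subseteq> carrier G" using A.subset by auto
    show "?S \<noteq> {}" using A.one_closed B.subset by (auto simp: subset_iff intro!: exI[of _ \<one>])
    show "inv a \<in> ?S" if "a \<in> ?S" for a
      using that B.subset cj_inv by (auto simp: A_carrier subset_iff)
    show "a \<otimes> b \<in> ?S" if "a \<in> ?S" "b \<in> ?S" for a b
      using that B.subset cj_mult by (auto simp: A_carrier subset_iff)
  qed
  moreover have "cj x a \<in> ?S" if x: "x \<in> carrier G" and a: "a \<in> ?S" for x a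
  proof -
    have "cj b (cj x a) = cj x a" if b: "b \<in> B" for b
    proof -
      have b': "inv x \<otimes> b \<otimes> x \<in> B" using B.inv_op_closed1 x b by blast
      have bc: "b \<in> carrier G" using b B.subset by auto
      have ac: "a \<in> carrier G" using a A_carrier by auto
      have "cj b (cj x a) = cj x (cj (inv x \<otimes> b \<otimes> x) a)"
        using x bc ac by (simp add: m_assoc inv_mult_group)
      also have "cj (inv x \<otimes> b \<otimes> x) a = a" using a b' by blast
      finally show ?thesis .
    qed
    thus ?thesis using a x cj_closed by auto
  qed
  ultimately show ?thesis by (auto simp: normal_inv_iff)
qed

lemma C_normal: "C \<lhd> G"
proof -
  have "subgroup C G"
  proof (rule subgroupI)
    show "C \<subseteq> carrier G" by (auto simp: C_def)
    show "C \<noteq> {}" by (auto simp: C_def A_carrier intro!: exI[of _ \<one>])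
    show "x \<otimes> y \<in> C" if "x \<in> C" "y \<in> C" for x y
      using that by (auto simp: C_def cj_cj[symmetric] A_carrier)
    show "inv x \<in> C" if x: "x \<in> C" for x
    proof -
      have "cj (inv x) a = a" if a: "a \<in> A" for a
      proof -
        have "cj (inv x) a = cj (inv x) (cj x a)" using x a by (simp add: C_def)
        also have "\<dots> = a" using x a by (simp add: C_def A_carrier m_assoc inv_mult_group)
        finally show ?thesis .
      qed
      thus ?thesis using x by (simp add: C_def)
    qed
  qed
  moreover have "cj x c \<in> C" if x: "x \<in> carrier G" and c: "c \<in> C" for x c
  proof -
    have cc: "c \<in> carrier G" using c by (simp add: C_def)
    have "cj (cj x c) a = a" if a: "a \<in> A" for a
    proof -
      have ia: "cj (inv x) a \<in> A" using a x cj_closed by blast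
      have "cj (cj x c) a = cj x (cj c (cj (inv x) a))"
        using x cc a by (simp add: A_carrier m_assoc inv_mult_group)
      also have "cj c (cj (inv x) a) = cj (inv x) a" using c ia by (simp add: C_def)
      also have "cj x (cj (inv x) a) = a" using x a by (simp add: A_carrier m_assoc inv_mult_group)
      finally show ?thesis .
    qed
    thus ?thesis using x cc by (simp add: C_def)
  qed
  ultimately show ?thesis by (auto simp: normal_inv_iff)
qed

lemma C_carrier: "x \<in> C \<Longrightarrow> x \<in> carrier G" by (simp add: C_def)

lemma A_subset_C: "A \<subseteq> C"
proof
  fix x assume x: "x \<in> A"
  have "cj x a = a" if a: "a \<in> A" for a
  proof -
    have "cj x a = a \<otimes> x \<otimes> inv x" using A_comm[OF x a] by simp
    thus ?thesis using x a by (simp add: A_carrier m_assoc)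
  qed
  thus "x \<in> C" using x by (simp add: C_def A_carrier)
qed

lemma finite_Z: "finite (Z N)"
  by (rule finite_subset[of _ "carrier G \<rightarrow>\<^sub>E A"]) (auto simp: Z_def fin finite_A intro!: finite_PiE)

lemma Z_closed: "f \<in> Z N \<Longrightarrow> x \<in> carrier G \<Longrightarrow> f x \<in> A" by (auto simp: Z_def)

lemma Z_mult: "f \<in> Z N \<Longrightarrow> x \<in> carrier G \<Longrightarrow> y \<in> carrier G \<Longrightarrow> f (x \<otimes> y) = f x \<otimes> cj x (f y)"
  by (auto simp: Z_def)

lemma Z_mult_C: "f \<in> Z N \<Longrightarrow> x \<in> C \<Longrightarrow> y \<in> carrier G \<Longrightarrow> f (x \<otimes> y) = f x \<otimes> f y"
  using Z_mult[of f N x y] Z_closed[of f N y] by (simp add: C_def)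

lemma Z_one: "f \<in> Z N \<Longrightarrow> f \<one> = \<one>"
proof -
  assume f: "f \<in> Z N"
  have "f \<one> = f \<one> \<otimes> f \<one>" using Z_mult[OF f, of \<one> \<one>] Z_closed[OF f, of \<one>] by (simp add: A_carrier)
  thus ?thesis using Z_closed[OF f, of \<one>] by (simp add: A_carrier)
qed

lemma Z_inv_C: "f \<in> Z N \<Longrightarrow> x \<in> C \<Longrightarrow> f (inv x) = inv (f x)"
proof -
  assume f: "f \<in> Z N" and x: "x \<in> C"
  have xc: "x \<in> carrier G" using x C_carrier by blast
  have ix: "inv x \<in> C" by (rule subgroup.m_inv_closed[OF normal_imp_subgroup[OF C_normal] x])
  have "f (inv x) \<otimes> f x = \<one>" using Z_mult_C[OF f ix xc] Z_one[OF f] xc by simp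
  thus ?thesis using Z_closed[OF f, of x] Z_closed[OF f, of "inv x"] xc by (simp add: inv_equality A_carrier)
qed

text \<open>The value of \<open>f\<close> at \<open>g \<otimes> x = cj g x \<otimes> g\<close> is
  expanded in both ways. On \<open>C\<close> the cocycle is multiplicative, and \<open>f g\<close>
  cancels because \<open>A\<close> is abelian.\<close>

lemma Z_equivariant:
  assumes f: "f \<in> Z N" and x: "x \<in> C" and g: "g \<in> carrier G"
  shows "f (cj g x) = cj g (f x)"
proof -
  have xc: "x \<in> carrier G" using x C_carrier by blast
  have c: "cj g x \<in> C" by (rule normal.inv_op_closed2[OF C_normal g x])
  have "f g \<otimes> cj g (f x) = f (g \<otimes> x)" using Z_mult[OF f g xc] by simp
  also have "g \<otimes> x = cj g x \<otimes> g" using g xc by (simp add: m_assoc)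
  also have "f \<dots> = f (cj g x) \<otimes> f g" by (rule Z_mult_C[OF f c g])
  also have "\<dots> = f g \<otimes> f (cj g x)" using Z_closed[OF f] g xc by (simp add: A_comm)
  finally show ?thesis using Z_closed[OF f] g xc by (simp add: A_carrier)
qed

lemma Z_kernel_subgroup:
  assumes f: "f \<in> Z N" and S: "subgroup S G"
  shows "subgroup {x \<in> S. f x = \<one>} G"
proof -
  interpret S: subgroup S G by fact
  show ?thesis
  proof (rule subgroupI)
    show "{x \<in> S. f x = \<one>} \<noteq> {}" using Z_one[OF f] S.one_closed by blast
    show "x \<otimes> y \<in> {x \<in> S. f x = \<one>}" if "x \<in> {x \<in> S. f x = \<one>}" "y \<in> {x \<in> S. f x = \<one>}" for x y
      using that S.subset Z_mult[OF f] by (auto simp: subset_iff)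
    show "inv x \<in> {x \<in> S. f x = \<one>}" if x: "x \<in> {x \<in> S. f x = \<one>}" for x
    proof -
      have xc: "x \<in> carrier G" using x S.subset by auto
      have fx: "f x = \<one>" using x by simp
      have ix: "f (inv x) \<in> carrier G" using Z_closed[OF f, of "inv x"] xc by (simp add: A_carrier)
      have "\<one> = f x \<otimes> cj x (f (inv x))" using Z_mult[OF f xc, of "inv x"] Z_one[OF f] xc by simp
      hence "cj x (f (inv x)) = \<one>" unfolding fx using xc ix by simp
      hence "f (inv x) = \<one>" using cj_eq_one[OF xc ix] by simp
      thus ?thesis using x by simp
    qed
  qed auto
qed

lemma Z_kernel_normal:
  assumes f: "f \<in> Z N" and D: "D \<lhd> G" "D \<subseteq> C"
  shows "{x \<in> D. f x = \<one>} \<lhd> G"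
proof -
  interpret D: normal D G by fact
  show ?thesis
    unfolding normal_inv_iff
    using Z_kernel_subgroup[OF f D.subgroup_axioms] Z_equivariant[OF f] D D.inv_op_closed2 by auto
qed

text \<open>Inside \<open>C\<close> a cocycle is an equivariant homomorphism, so the image of a
  normal subgroup is normal in G and minimality of \<open>A\<close> decides.\<close>

lemma Z_image:
  assumes f: "f \<in> Z N" and D: "D \<lhd> G" "D \<subseteq> C"
  shows "f ` D = {\<one>} \<or> f ` D = A"
proof (rule A_min)
  interpret D: normal D G by fact
  have c: "x \<in> carrier G" if "x \<in> D" for x using that D.subset by auto
  show sub: "f ` D \<subseteq> A" using Z_closed[OF f] c by auto
  have "subgroup (f ` D) G"
  proof (rule subgroupI)
    show "f ` D \<subseteq> carrier G" using sub A.subset by auto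
    show "f ` D \<noteq> {}" using D.one_closed by blast
    show "inv a \<in> f ` D" if a: "a \<in> f ` D" for a
    proof -
      obtain x where "x \<in> D" "a = f x" using a by auto
      hence "inv a = f (inv x)" "inv x \<in> D" using Z_inv_C[OF f, of x] D(2) by auto
      thus ?thesis by blast
    qed
    show "a \<otimes> b \<in> f ` D" if ab: "a \<in> f ` D" "b \<in> f ` D" for a b
    proof -
      obtain x where x: "x \<in> D" "a = f x" using ab(1) by blast
      obtain y where y: "y \<in> D" "b = f y" using ab(2) by blast
      have "x \<in> C" "y \<in> carrier G" using x y D(2) c by blast+
      hence "a \<otimes> b = f (x \<otimes> y)" using Z_mult_C[OF f, of x y] x y by simp
      moreover have "x \<otimes> y \<in> D" using x(1) y(1) by (rule D.m_closed)
      ultimately show ?thesis by simp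
    qed
  qed
  moreover have "cj g a \<in> f ` D" if g: "g \<in> carrier G" and a: "a \<in> f ` D" for g a
  proof -
    obtain x where x: "x \<in> D" "a = f x" using a by auto
    have "x \<in> C" using x D(2) by blast
    hence "cj g a = f (cj g x)" using Z_equivariant[OF f _ g, of x] x(2) by simp
    thus ?thesis using D.inv_op_closed2[OF g x(1)] by simp
  qed
  ultimately show "f ` D \<lhd> G" by (auto simp: normal_inv_iff)
qed

text \<open>Since \<open>A\<close> is abelian, cocycles form a group under pointwise multiplication;
  division turns agreement on \<open>N\<close> into triviality on \<open>N\<close>.\<close>

lemma Z_divide:
  assumes f: "f \<in> Z M" and g: "g \<in> Z M'" and eq: "\<And>x. x \<in> carrier G \<Longrightarrow> x \<in> N \<Longrightarrow> f x = g x"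
  shows "(\<lambda>x\<in>carrier G. f x \<otimes> inv (g x)) \<in> Z N"
proof -
  have "f (x \<otimes> y) \<otimes> inv (g (x \<otimes> y)) = f x \<otimes> inv (g x) \<otimes> cj x (f y \<otimes> inv (g y))"
    if xy: "x \<in> carrier G" "y \<in> carrier G" for x y
  proof -
    have A: "f x \<in> A" "f y \<in> A" "g x \<in> A" "g y \<in> A" using Z_closed f g xy by auto
    have B: "cj x (f y) \<in> A" "cj x (g y) \<in> A" using A cj_closed xy by auto
    have "f (x \<otimes> y) \<otimes> inv (g (x \<otimes> y)) = f x \<otimes> (cj x (f y) \<otimes> (inv (cj x (g y)) \<otimes> inv (g x)))"
      using Z_mult[OF f xy] Z_mult[OF g xy] A B by (simp add: A_carrier m_assoc inv_mult_group[of "g x"] del: inv_mult_group)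
    also have "\<dots> = f x \<otimes> (inv (g x) \<otimes> (cj x (f y) \<otimes> inv (cj x (g y))))"
      using A B A_comm[of "inv (cj x (g y))" "inv (g x)"] A_lcomm[of "cj x (f y)" "inv (g x)" "inv (cj x (g y))"] by simp
    also have "cj x (f y) \<otimes> inv (cj x (g y)) = cj x (f y \<otimes> inv (g y))"
      using A xy by (simp add: A_carrier cj_mult cj_inv)
    finally show ?thesis using A xy by (simp add: A_carrier m_assoc)
  qed
  moreover have "f x \<otimes> inv (g x) \<in> A" if "x \<in> carrier G" for x using Z_closed f g that by auto
  moreover have "f x \<otimes> inv (g x) = \<one>" if "x \<in> carrier G" "x \<in> N" for x
    using eq[OF that] Z_closed[OF g that(1)] by (simp add: A_carrier)
  ultimately show ?thesis unfolding Z_def by auto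
qed

lemma Z_divide_inj:
  assumes "f \<in> Z M" "f' \<in> Z M'" "g \<in> Z N"
    and "(\<lambda>x\<in>carrier G. f x \<otimes> inv (g x)) = (\<lambda>x\<in>carrier G. f' x \<otimes> inv (g x))"
  shows "f = f'"
proof
  fix x show "f x = f' x"
  proof (cases "x \<in> carrier G")
    case True
    thus ?thesis using fun_cong[OF assms(4), of x] Z_closed assms(1-3)
      by (simp add: A_carrier)
  next
    case False
    thus ?thesis using assms by (auto simp: Z_def PiE_iff extensional_def)
  qed
qed

lemma card_Z_fibre:
  assumes T: "T \<subseteq> Z M" and eq: "\<And>f g x. f \<in> T \<Longrightarrow> g \<in> T \<Longrightarrow> x \<in> carrier G \<Longrightarrow> x \<in> N \<Longrightarrow> f x = g x"
  shows "card T \<le> card (Z N)"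
proof (cases "T = {}")
  case False
  then obtain g where g: "g \<in> T" by auto
  show ?thesis
  proof (rule card_inj_on_le[OF _ _ finite_Z])
    show "inj_on (\<lambda>f. \<lambda>x\<in>carrier G. f x \<otimes> inv (g x)) T"
      using Z_divide_inj T g by (meson inj_onI subsetD)
    show "(\<lambda>f. \<lambda>x\<in>carrier G. f x \<otimes> inv (g x)) ` T \<subseteq> Z N"
      using Z_divide[of _ M g M N] T g eq by blast
  qed
qed simp

section \<open>Fixed points of a Sylow subgroup on A, and a single descent\<close>

definition fixA :: "'a set \<Rightarrow> 'a set" where "fixA P = {a \<in> A. \<forall>y\<in>P. cj y a = a}"

lemma fixA_nontriv:
  assumes P: "subgroup P G" "card P = p ^ m"
  shows "\<exists>a\<in>fixA P. a \<noteq> \<one>"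
proof -
  interpret P: subgroup P G by fact
  interpret PG: group "G\<lparr>carrier := P\<rparr>" using P.subgroup_is_group is_group .
  have "p dvd card {a \<in> A. \<forall>g\<in>carrier (G\<lparr>carrier := P\<rparr>). cj g a = a}"
  proof (rule PG.p_group_fixed_points[OF _ p finite_A])
    show "order (G\<lparr>carrier := P\<rparr>) = p ^ m" using P by (simp add: order_def)
    show "p dvd card A" using card_A n_pos by simp
  qed (use P.subset in \<open>auto simp: A_carrier cj_cj subset_iff cj_closed\<close>)
  hence "p dvd card (fixA P)" by (simp add: fixA_def)
  moreover have "\<one> \<in> fixA P" using P.subset by (auto simp: fixA_def)
  moreover have "\<not> p dvd 1" using p not_prime_unit by blast
  ultimately have "fixA P \<noteq> {\<one>}" by auto
  with \<open>\<one> \<in> fixA P\<close> show ?thesis by blast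
qed

lemma card_kernel:
  assumes f: "f \<in> Z N" and D: "D \<lhd> G" "D \<subseteq> C" and onto: "f ` D = A"
  shows "card D = card {x \<in> D. f x = \<one>} * p ^ n"
proof -
  interpret D: normal D G by fact
  have c: "x \<in> carrier G" if "x \<in> D" for x using that D.subset by auto
  have "card D = card A * card {x \<in> D. f x = \<one>}"
  proof (rule card_eq_fibres[of _ _ f])
    fix a assume "a \<in> A"
    then obtain d where d: "d \<in> D" "f d = a" using onto by auto
    have "bij_betw (\<lambda>x. d \<otimes> x) {x \<in> D. f x = \<one>} {x \<in> D. f x = a}"
    proof (rule bij_betw_byWitness[where f'="\<lambda>x. inv d \<otimes> x"])
      show "(\<lambda>x. d \<otimes> x) ` {x \<in> D. f x = \<one>} \<subseteq> {x \<in> D. f x = a}"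
      proof (rule image_subsetI)
        fix x assume "x \<in> {x \<in> D. f x = \<one>}"
        moreover have "d \<in> C" "f d \<in> A" using d(1) D(2) Z_closed[OF f c] by blast+
        ultimately show "d \<otimes> x \<in> {x \<in> D. f x = a}"
          using d Z_mult_C[OF f, of d x] c[of x] by (simp add: A_carrier)
      qed
      show "(\<lambda>x. inv d \<otimes> x) ` {x \<in> D. f x = a} \<subseteq> {x \<in> D. f x = \<one>}"
      proof (rule image_subsetI)
        fix x assume "x \<in> {x \<in> D. f x = a}"
        moreover have "d \<in> C" "inv d \<in> C" "f d \<in> A" using d(1) D(2) Z_closed[OF f c] D.m_inv_closed by blast+
        ultimately show "inv d \<otimes> x \<in> {x \<in> D. f x = \<one>}"
          using d Z_mult_C[OF f, of "inv d" x] Z_inv_C[OF f, of d] c[of x] by (simp add: A_carrier)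
      qed
    qed (use d c in auto)
    thus "card {x \<in> D. f x = a} = card {x \<in> D. f x = \<one>}" by (simp add: bij_betw_same_card)
  qed (use D.subset fin finite_subset finite_A onto in auto)
  thus ?thesis using card_A by simp
qed

text \<open>\<open>D\<close> modulo the kernel of \<open>f\<close> is a p-group, so \<open>f\<close>
  already maps \<open>P \<inter> D\<close> onto \<open>A\<close>. The elements of \<open>P\<close>
  killed by \<open>f\<close> thus form a proper subgroup \<open>S\<close>, even though
  \<open>f\<close> is only a crossed homomorphism on \<open>P\<close>. A nonzero character trivial
  on \<open>S\<close> is trivial on the kernel in \<open>D\<close> but not on
  \<open>D\<close>.\<close>

lemma zp_chars_drop:
  assumes P: "sylow_subgroup G p P" and f: "f \<in> Z N" and D: "D \<lhd> G" "D \<subseteq> C" and onto: "f ` D = A"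
  shows "p * card (zp_chars G p P D) \<le> card (zp_chars G p P {x \<in> D. f x = \<one>})"
proof -
  interpret D: normal D G by fact
  have sP: "subgroup P G" and cP: "card P = p ^ multiplicity p (order G)"
    using P by (auto simp: sylow_subgroup_def)
  interpret P: subgroup P G by fact
  interpret PG: group "G\<lparr>carrier := P\<rparr>" using P.subgroup_is_group is_group .
  define K where "K = {x \<in> D. f x = \<one>}"
  have K: "K \<lhd> G" "K \<subseteq> D" using Z_kernel_normal[OF f D] by (auto simp: K_def)
  have cK: "card D = card K * p ^ n" using card_kernel[OF f D onto] by (simp add: K_def)
  have onto': "\<exists>y\<in>P \<inter> D. f y = a" if a: "a \<in> A" for a
  proof -
    obtain d where d: "d \<in> D" "f d = a" using onto a by blast
    obtain k y where ky: "k \<in> K" "y \<in> P \<inter> D" "d = k \<otimes> y"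
      using normal_subset_mult_sylow[OF fin p P K(1) D(1) K(2) cK d(1)] by blast
    have "k \<in> C" "y \<in> carrier G" using ky K(2) D(2) P.subset by auto
    hence "f d = f k \<otimes> f y" using Z_mult_C[OF f, of k y] ky by simp
    hence "f y = a" using ky(1) d Z_closed[OF f \<open>y \<in> carrier G\<close>] by (simp add: K_def A_carrier)
    thus ?thesis using ky by auto
  qed
  define S where "S = {x \<in> P. f x = \<one>}"
  have sS: "subgroup S G" unfolding S_def by (rule Z_kernel_subgroup[OF f sP])
  obtain a where a: "a \<in> A" "a \<noteq> \<one>" using A_nontriv A.one_closed by blast
  have "S \<noteq> P" using onto'[OF a(1)] a(2) by (auto simp: S_def)
  moreover have "subgroup S (G\<lparr>carrier := P\<rparr>)" using subgroup_incl[OF sS sP] by (auto simp: S_def)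
  ultimately have "\<exists>\<chi>\<in>zp_chars (G\<lparr>carrier := P\<rparr>) p P S. \<exists>x\<in>P. \<chi> x \<noteq> 0"
    using PG.p_group_character[of p _ S] p cP by (auto simp: order_def)
  then obtain \<chi> x where \<chi>: "\<chi> \<in> zp_chars G p P S" and x: "x \<in> P" "\<chi> x \<noteq> 0"
    by (auto simp: zp_chars_def)
  have "f x \<in> A" using Z_closed[OF f] x P.subset by auto
  \<comment> \<open>A point where \<open>\<chi>\<close> is nonzero is moved into \<open>D\<close>:
    \<open>y\<close> differs from \<open>x\<close> by an element of \<open>S\<close>, so
    \<open>\<chi>\<close> takes the same value there.\<close>
  then obtain y where y: "y \<in> P" "y \<in> D" "f y = f x" using onto' by blast
  have cy: "y \<in> C" "y \<in> carrier G" "x \<in> carrier G" using y D(2) x P.subset by auto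
  have iy: "inv y \<in> C" using D.m_inv_closed y D(2) by blast
  have "f (inv y \<otimes> x) = \<one>"
    using Z_mult_C[OF f iy cy(3)] Z_inv_C[OF f cy(1)] y(3) \<open>f x \<in> A\<close> by (simp add: A_carrier)
  hence "inv y \<otimes> x \<in> S" using x y by (simp add: S_def)
  hence "\<chi> (y \<otimes> (inv y \<otimes> x)) = \<chi> y mod p" "inv y \<otimes> x \<in> P"
    using \<chi> y by (auto simp: zp_chars_def S_def)
  hence "\<chi> y \<noteq> 0" using x cy by (cases "\<chi> y = 0") auto
  hence "\<chi> \<notin> zp_chars G p P D" using y by (auto simp: zp_chars_def)
  moreover have "\<chi> \<in> zp_chars G p P K" using \<chi> by (auto simp: zp_chars_def S_def K_def)
  ultimately show ?thesis
    using card_zp_chars_less[OF p _ sP K(2)] fin P.subset finite_subset by (auto simp: K_def)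
qed

text \<open>A form of Schur's lemma. Let K be the kernel of \<open>f\<close> on \<open>D\<close>. On
  \<open>D\<close>, a cocycle trivial on K factors equivariantly through D/K, which \<open>f\<close>
  identifies with the irreducible \<open>A\<close>. It is therefore determined there by its value at
  one \<open>b\<close> with \<open>f b \<noteq> \<one>\<close>. Choosing \<open>f b\<close> fixed by
  \<open>P\<close> forces that value to be fixed by \<open>P\<close> too.\<close>

lemma card_Z_kernel_le:
  assumes P: "subgroup P G" "card P = p ^ m" and f: "f \<in> Z N" and D: "D \<lhd> G" "D \<subseteq> C" and onto: "f ` D = A"
  shows "card (Z {x \<in> D. f x = \<one>}) \<le> card (fixA P) * card (Z D)"
proof -
  interpret D: normal D G by fact
  interpret P: subgroup P G by fact
  define K where "K = {x \<in> D. f x = \<one>}"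
  have c: "x \<in> carrier G" if "x \<in> D" for x using that D.subset by auto
  obtain a where a: "a \<in> fixA P" "a \<noteq> \<one>" using fixA_nontriv[OF P] by blast
  then obtain b where b: "b \<in> D" "f b = a" using onto by (auto simp: fixA_def image_iff)
  have bC: "b \<in> C" "b \<in> carrier G" using b D(2) c by auto
  have "card (Z K) \<le> card (fixA P) * card (Z D)"
  proof (rule card_le_fibres[of _ _ "\<lambda>g. g b"])
    show "finite (fixA P)" using finite_A by (simp add: fixA_def)
    show "(\<lambda>g. g b) ` Z K \<subseteq> fixA P"
    proof clarify
      fix g assume g: "g \<in> Z K"
      have "cj y (g b) = g b" if y: "y \<in> P" for y
      proof -
        have yc: "y \<in> carrier G" using y P.subset by auto
        have yb: "cj y b \<in> D" using D.inv_op_closed2[OF yc b(1)] .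
        have "f (cj y b) = f b" using Z_equivariant[OF f bC(1) yc] a b y by (simp add: fixA_def)
        hence "f (cj y b \<otimes> inv b) = \<one>"
          using Z_mult_C[OF f, of "cj y b" "inv b"] Z_inv_C[OF f bC(1)] yb D(2) bC Z_closed[OF f bC(2)]
          by (auto simp: A_carrier)
        hence "cj y b \<otimes> inv b \<in> K" using yb b by (simp add: K_def)
        hence "g (cj y b \<otimes> inv b) = \<one>" using g c by (auto simp: Z_def K_def)
        hence "g (cj y b) \<otimes> inv (g b) = \<one>"
          using Z_mult_C[OF g, of "cj y b" "inv b"] Z_inv_C[OF g bC(1)] yb D(2) bC by auto
        moreover have "g (cj y b) \<in> carrier G" "g b \<in> carrier G"
          using A_carrier[OF Z_closed[OF g c[OF yb]]] A_carrier[OF Z_closed[OF g bC(2)]] .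
        ultimately have "g (cj y b) = g b" using mult_inv_eq_one by blast
        thus ?thesis using Z_equivariant[OF g bC(1) yc] by simp
      qed
      thus "g b \<in> fixA P" using Z_closed[OF g bC(2)] by (simp add: fixA_def)
    qed
    fix v assume "v \<in> fixA P"
    show "card {g \<in> Z K. g b = v} \<le> card (Z D)"
    proof (rule card_Z_fibre[of _ K])
      fix g g' x assume g: "g \<in> {g \<in> Z K. g b = v}" "g' \<in> {g \<in> Z K. g b = v}" and x: "x \<in> D"
      define h where "h = (\<lambda>x\<in>carrier G. g x \<otimes> inv (g' x))"
      have h: "h \<in> Z K" unfolding h_def
        by (rule Z_divide[of _ K _ K]) (use g in \<open>auto simp: Z_def\<close>)
      have hb: "h b = \<one>" using g Z_closed[of g' K b] bC by (auto simp: h_def A_carrier)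
      \<comment> \<open>The part of \<open>D\<close> on which \<open>g\<close> and \<open>g'\<close>
        agree. It is normal and contains \<open>b\<close>, so \<open>f\<close> maps it onto
        \<open>A\<close> by minimality; every element of \<open>D\<close> is then one of
        \<open>L\<close> times one of \<open>K\<close>, and \<open>h\<close> vanishes on
        both.\<close>
      define L where "L = {x \<in> D. h x = \<one>}"
      have L: "L \<lhd> G" unfolding L_def by (rule Z_kernel_normal[OF h D])
      have "f ` L = A"
        using Z_image[OF f L] D(2) a b hb by (auto simp: L_def)
      then obtain l where l: "l \<in> L" "f l = f x" using Z_closed[OF f c[OF x]] by (metis imageE)
      have lC: "l \<in> C" "l \<in> D" "inv l \<in> D" using l D(2) D.m_inv_closed by (auto simp: L_def)
      have "f (inv l \<otimes> x) = \<one>"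
        using Z_mult_C[OF f, of "inv l" x] Z_inv_C[OF f lC(1)] lC D(2) c x l Z_closed[OF f c[OF x]]
        by (auto simp: A_carrier)
      hence "inv l \<otimes> x \<in> K" using lC x by (simp add: K_def)
      hence "h (inv l \<otimes> x) = \<one>" using h c by (auto simp: Z_def K_def)
      hence "h (l \<otimes> (inv l \<otimes> x)) = \<one>" using Z_mult_C[OF h, of l "inv l \<otimes> x"] lC c x l by (auto simp: L_def)
      hence "h x = \<one>" using lC c x by simp
      hence "g x \<otimes> inv (g' x) = \<one>" using c x by (simp add: h_def)
      moreover have "g x \<in> carrier G" "g' x \<in> carrier G"
        using g Z_closed[OF _ c[OF x]] A_carrier by blast+
      ultimately show "g x = g' x" using mult_inv_eq_one by blast
    qed auto
  qed (rule finite_Z)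
  thus ?thesis by (simp add: K_def)
qed

text \<open>Descend from \<open>D\<close> to the kernel on \<open>D\<close> of some \<open>f \<in> Z N\<close> that is not trivial on \<open>D\<close>: each descent
  costs a factor \<open>|C\<^sub>A(P)|\<close> in the number of cocycles and gains a factor \<open>p\<close> in the number of characters.\<close>

lemma card_Z_chain:
  assumes P: "sylow_subgroup G p P" and D: "D \<lhd> G" "D \<subseteq> C" and N: "N \<subseteq> D"
  shows "\<exists>x. card (zp_chars G p P N) \<ge> p ^ x * card (zp_chars G p P D)
     \<and> card (Z N) \<le> card (fixA P) ^ x * card (Z D)"
  using D N
proof (induction "card D" arbitrary: D rule: less_induct)
  case less
  have sP: "subgroup P G" and cP: "card P = p ^ multiplicity p (order G)"
    using P by (auto simp: sylow_subgroup_def)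
  have fP: "finite P" using sP fin subgroup.subset finite_subset by blast
  show ?case
  proof (cases "Z N \<subseteq> Z D")
    case True
    hence "card (Z N) \<le> card (Z D)" by (simp add: card_mono finite_Z)
    moreover have "card (zp_chars G p P D) \<le> card (zp_chars G p P N)"
      by (rule card_mono[OF finite_zp_chars[OF fP] zp_chars_antimono[OF less.prems(3)]])
    ultimately show ?thesis by (intro exI[of _ 0]) simp
  next
    case False
    then obtain f where f: "f \<in> Z N" "f \<notin> Z D" by auto
    have Dc: "D \<subseteq> carrier G" using less.prems normal_imp_subgroup subgroup.subset by blast
    have "\<not> f ` D \<subseteq> {\<one>}" using f Dc by (auto simp: Z_def)
    hence onto: "f ` D = A" using Z_image[OF f(1) less.prems(1,2)] by auto
    define K where "K = {x \<in> D. f x = \<one>}"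
    have K: "K \<lhd> G" "K \<subseteq> C" "N \<subseteq> K"
      using Z_kernel_normal[OF f(1) less.prems(1,2)] less.prems f(1) Dc by (auto simp: K_def Z_def)
    have "K \<subset> D" using \<open>\<not> f ` D \<subseteq> {\<one>}\<close> by (auto simp: K_def)
    hence "card K < card D" using Dc fin by (meson finite_subset psubset_card_mono)
    from less.hyps[OF this K] obtain x where
      x: "p ^ x * card (zp_chars G p P K) \<le> card (zp_chars G p P N)"
         "card (Z N) \<le> card (fixA P) ^ x * card (Z K)" by blast
    have 1: "p * card (zp_chars G p P D) \<le> card (zp_chars G p P K)"
      unfolding K_def by (rule zp_chars_drop[OF P f(1) less.prems(1,2) onto])
    have 2: "card (Z K) \<le> card (fixA P) * card (Z D)"
      unfolding K_def by (rule card_Z_kernel_le[OF sP cP f(1) less.prems(1,2) onto])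
    have "p ^ Suc x * card (zp_chars G p P D) \<le> p ^ x * card (zp_chars G p P K)"
      using mult_le_mono2[OF 1, of "p ^ x"] by (simp add: algebra_simps)
    moreover have "card (fixA P) ^ x * card (Z K) \<le> card (fixA P) ^ Suc x * card (Z D)"
      using mult_le_mono2[OF 2, of "card (fixA P) ^ x"] by (simp add: algebra_simps)
    ultimately show ?thesis using x by (intro exI[of _ "Suc x"] conjI) linarith+
  qed
qed

end

section \<open>Minimal normal subgroups and chief factors of soluble groups\<close>

lemma (in group) exists_elem_prime_order:
  assumes fin: "finite (carrier G)" and H: "subgroup H G" and q: "Factorial_Ring.prime q" "q dvd card H"
  shows "\<exists>x\<in>H. x \<noteq> \<one> \<and> x [^] q = \<one>"
proof -
  interpret H: subgroup H G by fact
  interpret HG: group "G\<lparr>carrier := H\<rparr>" using H.subgroup_is_group is_group .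
  obtain m where m: "card H = q ^ 1 * m" using q(2) by (auto simp: dvd_def)
  have finH: "finite H" using fin H.subset finite_subset by blast
  obtain U where U: "subgroup U (G\<lparr>carrier := H\<rparr>)" "card U = q ^ 1"
    using sylow_thm[OF q(1) HG.is_group, of 1 m] m finH by (auto simp: order_def)
  have UG: "subgroup U G" "U \<subseteq> H" using U(1) incl_subgroup[OF H] subgroup.subset[OF U(1)] by auto
  interpret U: subgroup U G by fact
  interpret UG: group "G\<lparr>carrier := U\<rparr>" using U.subgroup_is_group is_group .
  have "U \<noteq> {\<one>}" using U(2) q(1) prime_gt_1_nat by auto
  then obtain x where x: "x \<in> U" "x \<noteq> \<one>" using U.one_closed by blast
  have "x [^]\<^bsub>G\<lparr>carrier := U\<rparr>\<^esub> order (G\<lparr>carrier := U\<rparr>) = \<one>" using UG.pow_order_eq_1[of x] x by simp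
  hence "x [^] q = \<one>" using U(2) by (simp add: order_def nat_pow_consistent[symmetric])
  thus ?thesis using x UG(2) by blast
qed

text \<open>Take a minimal nontrivial normal subgroup inside \<open>T\<close>. Its derived subgroup
  is normal in G and, by solubility, smaller, hence trivial. For a prime q dividing its order, the
  elements with q-th power 1 form a nontrivial normal subgroup, hence everything; two different
  primes would contradict each other.\<close>

lemma (in group) solvable_min_normal:
  assumes fin: "finite (carrier G)" and sol: "solvable G" and T: "T \<lhd> G" "T \<noteq> {\<one>}"
  shows "\<exists>A p n. A \<subseteq> T \<and> min_normal G A p n"
proof -
  define \<N> where "\<N> = {N. N \<lhd> G \<and> N \<subseteq> T \<and> N \<noteq> {\<one>}}"
  have sub: "N \<subseteq> carrier G" if "N \<lhd> G" for N using that normal_imp_subgroup subgroup.subset by blast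
  have "finite \<N>" by (rule finite_subset[of _ "Pow (carrier G)"]) (auto simp: \<N>_def fin dest: sub)
  moreover have "T \<in> \<N>" using T by (simp add: \<N>_def)
  ultimately obtain A where A: "A \<in> \<N>" and Amin: "\<And>N. N \<in> \<N> \<Longrightarrow> N \<subseteq> A \<Longrightarrow> A = N"
    using finite_has_minimal[of \<N>] by blast
  have An: "A \<lhd> G" "A \<subseteq> T" "A \<noteq> {\<one>}" using A by (auto simp: \<N>_def)
  have min: "N = {\<one>} \<or> N = A" if "N \<lhd> G" "N \<subseteq> A" for N
    using Amin[of N] that An by (auto simp: \<N>_def)
  interpret A: normal A G by fact
  have der: "derived G A = {\<one>}"
  proof (rule ccontr)
    assume "derived G A \<noteq> {\<one>}"
    hence *: "derived G A = A"
      using min[OF derived_is_normal[OF An(1)] derived_incl[OF order_refl A.subgroup_axioms]] by blast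
    have "(derived G ^^ i) A = A" for i by (induction i) (auto simp: *)
    moreover obtain i where "(derived G ^^ i) A = {\<one>}"
      using solvable_imp_trivial_derived_seq[OF solvable_subgroup[OF A.subgroup_axioms sol]] by blast
    ultimately show False using An(3) by simp
  qed
  have comm: "a \<otimes> b = b \<otimes> a" if ab: "a \<in> A" "b \<in> A" for a b
  proof -
    have c: "a \<in> carrier G" "b \<in> carrier G" using ab A.subset by auto
    have "a \<otimes> b \<otimes> inv a \<otimes> inv b \<in> derived G A"
      unfolding derived_def by (rule generate.incl) (use ab in blast)
    hence "a \<otimes> b \<otimes> inv a \<otimes> inv b = \<one>" using der by simp
    hence "a \<otimes> b \<otimes> inv (b \<otimes> a) = \<one>" using c by (simp add: m_assoc inv_mult_group)
    thus ?thesis using mult_inv_eq_one[of "a \<otimes> b" "b \<otimes> a"] c by simp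
  qed
  have expo: "\<forall>a\<in>A. a [^] q = \<one>" if q: "Factorial_Ring.prime q" "q dvd card A" for q
  proof -
    let ?B = "{a \<in> A. a [^] q = \<one>}"
    have "subgroup ?B G"
    proof (rule subgroupI)
      show "?B \<subseteq> carrier G" using A.subset by auto
      show "?B \<noteq> {}" using A.one_closed nat_pow_one by blast
      show "inv a \<in> ?B" if "a \<in> ?B" for a using that A.subset by (auto simp: nat_pow_inv)
      show "a \<otimes> b \<in> ?B" if "a \<in> ?B" "b \<in> ?B" for a b
      proof -
        have "(a \<otimes> b) [^] q = a [^] q \<otimes> b [^] q"
          using pow_mult_distrib[of a b q] comm[of a b] that A.subset by auto
        thus ?thesis using that by simp
      qed
    qed
    moreover have "x \<otimes> a \<otimes> inv x \<in> ?B" if x: "x \<in> carrier G" and a: "a \<in> ?B" for x a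
    proof -
      have ac: "a \<in> carrier G" using a A.subset by auto
      have "(x \<otimes> a \<otimes> inv x) [^] i = x \<otimes> a [^] i \<otimes> inv x" for i :: nat
        by (induction i) (use x ac in \<open>simp_all add: m_assoc\<close>)
      thus ?thesis using a x A.inv_op_closed2[OF x, of a] by simp
    qed
    ultimately have "?B \<lhd> G" by (auto simp: normal_inv_iff)
    moreover obtain x where "x \<in> A" "x \<noteq> \<one>" "x [^] q = \<one>"
      using exists_elem_prime_order[OF fin A.subgroup_axioms q] by blast
    ultimately have "?B = A" using min[of ?B] by blast
    thus ?thesis by blast
  qed
  have "card A \<noteq> 1"
  proof
    assume "card A = 1"
    then obtain y where "A = {y}" by (auto simp: card_1_singleton_iff)
    thus False using A.one_closed An(3) by auto
  qed
  then obtain p where p: "Factorial_Ring.prime p" "p dvd card A" using prime_factor_nat by blast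
  have uniq: "q = p" if q: "Factorial_Ring.prime q" "q dvd card A" for q
  proof (rule ccontr)
    assume "q \<noteq> p"
    hence "coprime q p" using p q primes_coprime by blast
    moreover obtain x where "x \<in> A" "x \<noteq> \<one>" using An(3) A.one_closed by blast
    ultimately show False
      using pow_coprime_eq_one[of x q p] expo[OF q] expo[OF p] A.subset by blast
  qed
  have pos: "card A \<noteq> 0" using A.finite_imp_card_positive[OF fin] by simp
  obtain m where m: "card A = p ^ multiplicity p (card A) * m" "\<not> p dvd m"
    using multiplicity_decompose'[of "card A" p] pos p(1) not_prime_unit by metis
  have "m = 1"
  proof (rule ccontr)
    assume "m \<noteq> 1"
    then obtain q where "Factorial_Ring.prime q" "q dvd m" using prime_factor_nat by blast
    thus False using uniq[of q] m by (metis dvd_mult)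
  qed
  hence "card A = p ^ multiplicity p (card A)" using m by simp
  hence "min_normal G A p (multiplicity p (card A))"
    using fin An p comm expo[OF p] min by unfold_locales auto
  thus ?thesis using An by blast
qed

text \<open>Pull back a minimal normal subgroup of \<open>G Mod N\<close>; its order is a prime
  power because the quotient is soluble.\<close>

lemma (in group) exists_normal_above:
  assumes fin: "finite (carrier G)" and sol: "solvable G" and N: "N \<lhd> G" "N \<noteq> carrier G"
  shows "\<exists>B r m. B \<lhd> G \<and> N \<subseteq> B \<and> B \<noteq> N \<and> Factorial_Ring.prime r \<and> card B = card N * r ^ m"
proof -
  interpret N: normal N G by fact
  interpret Q: group "G Mod N" by (rule N.factorgroup_is_group)
  have finQ: "finite (carrier (G Mod N))" using fin by (simp add: carrier_FactGroup)
  interpret pr: group_hom G "G Mod N" "(#>) N"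
    by unfold_locales (rule N.r_coset_hom_Mod)
  have "solvable (G Mod N)"
    using pr.solvable_imp_solvable_img[of "carrier G"] sol by (simp add: solvable_def carrier_FactGroup)
  moreover have "carrier (G Mod N) \<noteq> {\<one>\<^bsub>G Mod N\<^esub>}"
  proof
    assume "carrier (G Mod N) = {\<one>\<^bsub>G Mod N\<^esub>}"
    hence "rcosets N = {N}" by (simp add: FactGroup_def)
    hence "card N = order G" using lagrange[OF N.subgroup_axioms] by simp
    thus False using N(2) card_subset_eq[OF fin N.subset] by (simp add: order_def)
  qed
  ultimately obtain B' r m where B': "min_normal (G Mod N) B' r m"
    using Q.solvable_min_normal[OF finQ _ Q.normal_self] by blast
  interpret B': min_normal "G Mod N" B' r m by fact
  define B where "B = \<Union>B'"
  have B: "B \<lhd> G" unfolding B_def by (rule N.factgroup_subgroup_union_normal[OF B'.A_normal])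
  interpret B: normal B G by fact
  have NB: "N \<subseteq> B" using B'.A.one_closed by (auto simp: B_def)
  interpret BG: group "G\<lparr>carrier := B\<rparr>" using B.subgroup_is_group is_group .
  have "B' = rcosets\<^bsub>G\<lparr>carrier := B\<rparr>\<^esub> N"
    unfolding B_def by (rule N.factgroup_subgroup_union_factor) (rule B'.A.subgroup_axioms)
  moreover have "subgroup N (G\<lparr>carrier := B\<rparr>)" by (rule subgroup_incl[OF N.subgroup_axioms B.subgroup_axioms NB])
  ultimately have "card B' * card N = card B" using BG.lagrange by (simp add: order_def)
  hence card: "card B = card N * r ^ m" using B'.card_A by (simp add: mult.commute)
  have "card N > 0" using N.finite_imp_card_positive fin by blast
  moreover have "r ^ m > 1" using one_less_power[OF prime_gt_1_nat[OF B'.p] B'.n_pos] .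
  ultimately have "card B \<noteq> card N" unfolding card by (metis mult.right_neutral mult_cancel1 less_numeral_extra(3,4))
  thus ?thesis using B NB card B'.p by blast
qed

section \<open>Cocycles trivial on the centraliser of A\<close>

context min_normal
begin

lemma AA_comm_group: "comm_group (G\<lparr>carrier := A\<rparr>)"
proof -
  interpret AG: group "G\<lparr>carrier := A\<rparr>" using A.subgroup_is_group is_group .
  show ?thesis by (rule AG.group_comm_groupI) (simp add: A_comm)
qed

text \<open>When \<open>|R|\<close> is prime to \<open>p\<close>, this recovers \<open>f\<close> on \<open>R\<close> from the product of its values.\<close>

lemma Z_average:
  assumes f: "f \<in> Z N" and R: "subgroup R G" and y: "y \<in> R"
  shows "finprod (G\<lparr>carrier := A\<rparr>) f R
       = f y [^] card R \<otimes> cj y (finprod (G\<lparr>carrier := A\<rparr>) f R)"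
proof -
  interpret R: subgroup R G by fact
  interpret AA: comm_group "G\<lparr>carrier := A\<rparr>" by (rule AA_comm_group)
  have c: "x \<in> carrier G" if "x \<in> R" for x using that R.subset by auto
  have finR: "finite R" using fin R.subset finite_subset by blast
  have fA: "f x \<in> A" if "x \<in> R" for x by (rule Z_closed[OF f c[OF that]])
  have yc: "y \<in> carrier G" using y c by auto
  have cjA: "cj y (f x) \<in> A" if "x \<in> R" for x using cj_closed[OF yc fA[OF that]] .
  have hom: "cj y (finprod (G\<lparr>carrier := A\<rparr>) f S) = finprod (G\<lparr>carrier := A\<rparr>) (\<lambda>x. cj y (f x)) S"
    if "finite S" "S \<subseteq> R" for S
    using that
  proof (induction S rule: finite_induct)
    case empty
    show ?case using yc by simp
  next
    case (insert x S)
    have 1: "f \<in> S \<rightarrow> carrier (G\<lparr>carrier := A\<rparr>)" "f x \<in> carrier (G\<lparr>carrier := A\<rparr>)"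
      "(\<lambda>x. cj y (f x)) \<in> S \<rightarrow> carrier (G\<lparr>carrier := A\<rparr>)" "cj y (f x) \<in> carrier (G\<lparr>carrier := A\<rparr>)"
      using insert.prems fA cjA by auto
    have 2: "finprod (G\<lparr>carrier := A\<rparr>) f S \<in> A" using AA.finprod_closed[OF 1(1)] by simp
    show ?case
      using AA.finprod_insert[OF insert.hyps(1,2) 1(1,2)] AA.finprod_insert[OF insert.hyps(1,2) 1(3,4)]
        insert.IH insert.prems cj_mult[OF yc A_carrier[OF fA] A_carrier[OF 2], of x] by simp
  qed
  have im: "(\<lambda>x. y \<otimes> x) ` R = R"
  proof
    show "(\<lambda>x. y \<otimes> x) ` R \<subseteq> R" using y by auto
    show "R \<subseteq> (\<lambda>x. y \<otimes> x) ` R"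
    proof
      fix x assume x: "x \<in> R"
      hence "x = y \<otimes> (inv y \<otimes> x)" "inv y \<otimes> x \<in> R" using y c yc by auto
      thus "x \<in> (\<lambda>x. y \<otimes> x) ` R" by blast
    qed
  qed
  have inj: "inj_on (\<lambda>x. y \<otimes> x) R" using yc c by (auto intro!: inj_onI)
  have "finprod (G\<lparr>carrier := A\<rparr>) f R = finprod (G\<lparr>carrier := A\<rparr>) f ((\<lambda>x. y \<otimes> x) ` R)" using im by simp
  also have "\<dots> = finprod (G\<lparr>carrier := A\<rparr>) (\<lambda>x. f (y \<otimes> x)) R"
    by (rule AA.finprod_reindex[OF _ inj]) (use im fA in auto)
  also have "\<dots> = finprod (G\<lparr>carrier := A\<rparr>) (\<lambda>x. f y \<otimes>\<^bsub>G\<lparr>carrier := A\<rparr>\<^esub> cj y (f x)) R"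
    by (rule AA.finprod_cong') (use fA[OF y] cjA Z_mult[OF f yc c] in auto)
  also have "\<dots> = finprod (G\<lparr>carrier := A\<rparr>) (\<lambda>x. f y) R \<otimes>\<^bsub>G\<lparr>carrier := A\<rparr>\<^esub> finprod (G\<lparr>carrier := A\<rparr>) (\<lambda>x. cj y (f x)) R"
    by (rule AA.finprod_multf) (use fA[OF y] cjA in auto)
  also have "finprod (G\<lparr>carrier := A\<rparr>) (\<lambda>x. f y) R = f y [^] card R"
    using AA.finprod_const[of "f y" R] fA[OF y] by (simp add: nat_pow_consistent[symmetric])
  finally show ?thesis using hom[OF finR] by simp
qed

text \<open>These are the cocycles of G/C, which acts faithfully on \<open>A\<close>. The chief
  factor B/C has order prime to p and no fixed points on \<open>A\<close>, so averaging over it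
  leaves no more than the inner cocycles. In the proof, a cocycle is determined by the product of
  its values over \<open>R0\<close>, an element of \<open>A\<close>.\<close>

lemma card_Z_C_le:
  assumes B: "B \<lhd> G" "C \<subseteq> B" "B \<noteq> C" and r: "Factorial_Ring.prime r" and card: "card B = card C * r ^ m"
  shows "card (Z C) \<le> card A"
proof -
  interpret B: normal B G by (rule B(1))
  obtain R where R: "sylow_subgroup G r R" using sylow_subgroup_exists[OF is_group fin r] by blast
  have sR: "subgroup R G" and cR: "card R = r ^ multiplicity r (order G)"
    using R by (auto simp: sylow_subgroup_def)
  interpret R: subgroup R G by fact
  have dec: "\<exists>c\<in>C. \<exists>y\<in>R \<inter> B. b = c \<otimes> y" if "b \<in> B" for b
    by (rule normal_subset_mult_sylow[OF fin r R C_normal B(1,2) card that])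
  have fixB: "{a \<in> A. \<forall>b\<in>B. cj b a = a} = {\<one>}"
  proof -
    have "{a \<in> A. \<forall>b\<in>B. cj b a = a} \<noteq> A"
    proof
      assume "{a \<in> A. \<forall>b\<in>B. cj b a = a} = A"
      hence "B \<subseteq> C" using B.subset by (auto simp: C_def)
      thus False using B by blast
    qed
    thus ?thesis using A_min[OF centralizer_normal[OF B(1)]] by blast
  qed
  \<comment> \<open>Otherwise the p-group \<open>R\<close> would fix some nontrivial element of
    \<open>A\<close>; being fixed by \<open>C\<close> as well, that element would be fixed by all of
    \<open>B\<close>.\<close>
  have rp: "r \<noteq> p"
  proof
    assume "r = p"
    then obtain a where a: "a \<in> fixA R" "a \<noteq> \<one>" using fixA_nontriv[OF sR] cR by blast
    have aA: "a \<in> A" using a by (simp add: fixA_def)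
    have "cj b a = a" if b: "b \<in> B" for b
    proof -
      obtain c y where cy: "c \<in> C" "y \<in> R" "b = c \<otimes> y" using dec[OF b] by blast
      have "cj b a = cj c (cj y a)"
        using cj_cj[of c y a] cy C_carrier R.subset A_carrier[OF aA] by auto
      also have "cj y a = a" using a cy by (simp add: fixA_def)
      also have "cj c a = a" using cy aA by (simp add: C_def)
      finally show ?thesis .
    qed
    hence "a \<in> {a \<in> A. \<forall>b\<in>B. cj b a = a}" using aA by blast
    thus False using fixB a(2) by blast
  qed
  define R0 where "R0 = R \<inter> B"
  have sR0: "subgroup R0 G" unfolding R0_def by (rule subgroups_Inter_pair[OF sR B.subgroup_axioms])
  interpret R0: subgroup R0 G by fact
  have "card R0 dvd card R" by (rule card_subgroup_dvd[OF sR0 sR]) (simp add: R0_def)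
  then obtain i where i: "card R0 = r ^ i" using cR r divides_primepow_nat by metis
  have "coprime r p" using rp r p primes_coprime by blast
  hence cop: "coprime (card R0) (p ^ n)" using i by simp
  interpret AA: comm_group "G\<lparr>carrier := A\<rparr>" by (rule AA_comm_group)
  let ?s = "\<lambda>f. finprod (G\<lparr>carrier := A\<rparr>) f R0"
  have R0c: "x \<in> carrier G" if "x \<in> R0" for x using that R0.subset by auto
  have sA: "?s f \<in> A" if "f \<in> Z N" for f N
    using AA.finprod_closed[of f R0] Z_closed[OF that R0c] by auto
  \<comment> \<open>Triviality spreads in three stages: to \<open>R0\<close> by coprimality, to
    \<open>B\<close> because B = C R0, and to G because \<open>b \<otimes> x\<close> equals
    \<open>x\<close> times an element of \<open>B\<close>, which makes \<open>h x\<close> fixed by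
    \<open>B\<close>.\<close>
  have triv: "h = (\<lambda>x\<in>carrier G. \<one>)" if h: "h \<in> Z C" and s: "?s h = \<one>" for h
  proof -
    have 1: "h y = \<one>" if y: "y \<in> R0" for y
    proof -
      have hy: "h y \<in> carrier G" "h y \<in> A" using Z_closed[OF h R0c[OF y]] A_carrier by auto
      have "h y [^] card R0 = \<one>" using Z_average[OF h sR0 y] s R0c[OF y] hy by simp
      moreover have "h y [^]\<^bsub>G\<lparr>carrier := A\<rparr>\<^esub> card A = \<one>"
        using AA.pow_order_eq_1[of "h y"] hy by (simp add: order_def)
      hence "h y [^] (p ^ n) = \<one>" using card_A by (simp add: nat_pow_consistent[symmetric])
      ultimately show ?thesis using pow_coprime_eq_one[OF hy(1) _ _ cop] by blast
    qed
    have 2: "h b = \<one>" if b: "b \<in> B" for b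
    proof -
      obtain c y where cy: "c \<in> C" "y \<in> R0" "b = c \<otimes> y" using dec[OF b] by (auto simp: R0_def)
      have "h c = \<one>" using h cy(1) C_carrier by (auto simp: Z_def)
      thus ?thesis using Z_mult_C[OF h cy(1) R0c[OF cy(2)]] 1[OF cy(2)] cy(3) by simp
    qed
    have 3: "h x = \<one>" if x: "x \<in> carrier G" for x
    proof -
      have hx: "h x \<in> A" by (rule Z_closed[OF h x])
      have "cj b (h x) = h x" if b: "b \<in> B" for b
      proof -
        have bc: "b \<in> carrier G" using b B.subset by auto
        have b': "inv x \<otimes> b \<otimes> x \<in> B" by (rule B.inv_op_closed1[OF x b])
        have b'c: "inv x \<otimes> b \<otimes> x \<in> carrier G" using x bc by simp
        have "cj b (h x) = h (b \<otimes> x)" using Z_mult[OF h bc x] 2[OF b] bc x A_carrier[OF hx] by simp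
        also have "b \<otimes> x = x \<otimes> (inv x \<otimes> b \<otimes> x)" using x bc by (simp add: m_assoc)
        also have "h \<dots> = h x" using Z_mult[OF h x b'c] 2[OF b'] x A_carrier[OF hx] by simp
        finally show ?thesis .
      qed
      hence "h x \<in> {a \<in> A. \<forall>b\<in>B. cj b a = a}" using hx by blast
      thus ?thesis using fixB by blast
    qed
    show ?thesis using 3 h by (auto simp: Z_def PiE_iff extensional_def fun_eq_iff)
  qed
  have "inj_on ?s (Z C)"
  proof (rule inj_onI)
    fix f g assume f: "f \<in> Z C" and g: "g \<in> Z C" and eq: "?s f = ?s g"
    define h where "h = (\<lambda>x\<in>carrier G. f x \<otimes> inv (g x))"
    have h: "h \<in> Z C" unfolding h_def by (rule Z_divide[OF f g]) (use f g in \<open>auto simp: Z_def\<close>)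
    have fR: "f x \<in> A" "g x \<in> A" "h x \<in> A" if "x \<in> R0" for x
      using Z_closed[OF _ R0c[OF that]] f g h by blast+
    have "?s f = finprod (G\<lparr>carrier := A\<rparr>) (\<lambda>x. h x \<otimes>\<^bsub>G\<lparr>carrier := A\<rparr>\<^esub> g x) R0"
    proof (rule AA.finprod_cong')
      fix x assume x: "x \<in> R0"
      show "f x = h x \<otimes>\<^bsub>G\<lparr>carrier := A\<rparr>\<^esub> g x"
        using fR[OF x] R0c[OF x] by (simp add: h_def m_assoc A_carrier)
    qed (use fR in auto)
    also have "\<dots> = ?s h \<otimes>\<^bsub>G\<lparr>carrier := A\<rparr>\<^esub> ?s g"
      by (rule AA.finprod_multf) (use fR in auto)
    finally have "?s h \<otimes> ?s g = ?s g" using eq by simp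
    hence "?s h = \<one>" using sA[OF h] sA[OF g] by (simp add: A_carrier)
    from triv[OF h this] have h1: "h x = \<one>" if "x \<in> carrier G" for x using that by simp
    show "f = g"
    proof
      fix x show "f x = g x"
      proof (cases "x \<in> carrier G")
        case True
        have "f x \<otimes> inv (g x) = \<one>" using h1[OF True] True by (simp add: h_def)
        thus ?thesis using mult_inv_eq_one A_carrier Z_closed[OF f True] Z_closed[OF g True] by blast
      next
        case False
        thus ?thesis using f g by (auto simp: Z_def PiE_iff extensional_def)
      qed
    qed
  qed
  moreover have "?s ` Z C \<subseteq> A" using sA by blast
  ultimately show ?thesis using card_inj_on_le finite_A by blast
qed

end

section \<open>Complements of a minimal normal subgroup\<close>

lemma card_zp_chars_pos:
  assumes "finite P" "p > 0" "\<And>x y. x \<in> P \<Longrightarrow> y \<in> P \<Longrightarrow> x \<otimes>\<^bsub>G\<^esub> y \<in> P"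
  shows "card (zp_chars G p P U) > 0"
proof -
  have "(\<lambda>x\<in>P. 0) \<in> zp_chars G p P U" using assms by (auto simp: zp_chars_def)
  thus ?thesis using finite_zp_chars[OF assms(1)] by (auto simp: card_gt_0_iff)
qed

lemma (in group) exists_zp_char:
  assumes P: "subgroup P G" "card P = p ^ m" and p: "Factorial_Ring.prime p"
    and S: "subgroup S G" "S \<subseteq> P" "S \<noteq> P"
  shows "\<exists>\<chi>\<in>zp_chars G p P S. \<exists>x\<in>P. \<chi> x \<noteq> 0"
proof -
  interpret P: subgroup P G by fact
  interpret PG: group "G\<lparr>carrier := P\<rparr>" using P.subgroup_is_group is_group .
  have "subgroup S (G\<lparr>carrier := P\<rparr>)" using subgroup_incl[OF S(1) P(1) S(2)] .
  hence "\<exists>\<chi>\<in>zp_chars (G\<lparr>carrier := P\<rparr>) p P S. \<exists>x\<in>P. \<chi> x \<noteq> 0"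
    using PG.p_group_character[of p m S] p P(2) S(3) by (auto simp: order_def)
  thus ?thesis by (simp add: zp_chars_def)
qed

lemma (in group) card_zp_chars_ge:
  assumes fin: "finite (carrier G)"
    and P: "subgroup P G" "card P = p ^ m" and p: "Factorial_Ring.prime p"
    and S: "subgroup S G" "S \<subseteq> P" "S \<noteq> P"
  shows "p \<le> card (zp_chars G p P S)"
proof -
  obtain \<chi> x where \<chi>: "\<chi> \<in> zp_chars G p P S" "x \<in> P" "\<chi> x \<noteq> 0"
    using exists_zp_char[OF P p S] by blast
  have finP: "finite P" using fin P(1) subgroup.subset finite_subset by blast
  have "\<chi> \<notin> zp_chars G p P P" using \<chi> by (auto simp: zp_chars_def)
  hence "p * card (zp_chars G p P P) \<le> card (zp_chars G p P S)"
    using card_zp_chars_less[OF p finP P(1) S(2) \<chi>(1)] by blast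
  moreover have "card (zp_chars G p P P) > 0"
    by (rule card_zp_chars_pos[OF finP prime_gt_0_nat[OF p]]) (rule subgroup.m_closed[OF P(1)])
  hence "p * 1 \<le> p * card (zp_chars G p P P)" by (intro mult_le_mono2) simp
  ultimately show ?thesis by linarith
qed

context min_normal
begin

text \<open>The last clause is G = AK, phrased through the A-component of \<open>g\<close> that
  \<open>proj\<close> selects.\<close>

definition compl :: "'a set set" where
  "compl = {K. subgroup K G \<and> K \<inter> A = {\<one>} \<and> (\<forall>g\<in>carrier G. \<exists>a\<in>A. inv a \<otimes> g \<in> K)}"

definition proj :: "'a set \<Rightarrow> 'a \<Rightarrow> 'a" where
  "proj K = (\<lambda>g\<in>carrier G. SOME a. a \<in> A \<and> inv a \<otimes> g \<in> K)"

lemma finite_compl: "finite compl"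
  by (rule finite_subset[of _ "Pow (carrier G)"]) (auto simp: compl_def fin dest: subgroup.subset)

lemma proj_props:
  assumes "K \<in> compl" "g \<in> carrier G"
  shows "proj K g \<in> A" "inv (proj K g) \<otimes> g \<in> K"
proof -
  have "\<exists>a. a \<in> A \<and> inv a \<otimes> g \<in> K" using assms by (auto simp: compl_def)
  from someI_ex[OF this] show "proj K g \<in> A" "inv (proj K g) \<otimes> g \<in> K"
    using assms(2) by (auto simp: proj_def)
qed

lemma proj_eqI:
  assumes K: "K \<in> compl" and g: "g \<in> carrier G" and a: "a \<in> A" "inv a \<otimes> g \<in> K"
  shows "proj K g = a"
proof -
  have sK: "subgroup K G" and int: "K \<inter> A = {\<one>}" using K by (auto simp: compl_def)
  interpret K: subgroup K G by fact
  define b where "b = proj K g"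
  have b: "b \<in> A" "inv b \<otimes> g \<in> K" using proj_props[OF K g] by (auto simp: b_def)
  have c: "a \<in> carrier G" "b \<in> carrier G" using a b A_carrier by auto
  have "(inv b \<otimes> g) \<otimes> inv (inv a \<otimes> g) \<in> K" using a b by blast
  also have "(inv b \<otimes> g) \<otimes> inv (inv a \<otimes> g) = inv b \<otimes> a" using c g by (simp add: m_assoc inv_mult_group)
  finally have "inv b \<otimes> a \<in> K \<inter> A" using a b by blast
  hence "inv b \<otimes> a = \<one>" using int by blast
  hence "b = a" using c by (metis inv_equality inv_inv inv_closed)
  thus ?thesis by (simp add: b_def)
qed

lemma proj_on_A: "K \<in> compl \<Longrightarrow> a \<in> A \<Longrightarrow> proj K a = a"
  by (rule proj_eqI) (auto simp: A_carrier compl_def subgroup.one_closed)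

lemma proj_Z:
  assumes K: "K \<in> compl"
  shows "proj K \<in> Z {}"
proof -
  have sK: "subgroup K G" using K by (auto simp: compl_def)
  interpret K: subgroup K G by fact
  have "proj K (x \<otimes> y) = proj K x \<otimes> cj x (proj K y)" if xy: "x \<in> carrier G" "y \<in> carrier G" for x y
  proof (rule proj_eqI[OF K])
    let ?a = "proj K x" and ?b = "proj K y"
    have a: "?a \<in> A" "inv ?a \<otimes> x \<in> K" and b: "?b \<in> A" "inv ?b \<otimes> y \<in> K"
      using proj_props[OF K] xy by auto
    have c: "?a \<in> carrier G" "?b \<in> carrier G" using a b A_carrier by auto
    have xb: "cj x ?b \<in> A" by (rule cj_closed[OF xy(1) b(1)])
    show "?a \<otimes> cj x ?b \<in> A" using a xb by blast
    have "?a \<otimes> cj x ?b = cj x ?b \<otimes> ?a" by (rule A_comm[OF a(1) xb])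
    hence "inv (?a \<otimes> cj x ?b) \<otimes> (x \<otimes> y) = inv (cj x ?b \<otimes> ?a) \<otimes> (x \<otimes> y)" by simp
    also have "\<dots> = (inv ?a \<otimes> x) \<otimes> (inv ?b \<otimes> y)"
      using c xy by (simp add: m_assoc inv_mult_group)
    finally show "inv (?a \<otimes> cj x ?b) \<otimes> (x \<otimes> y) \<in> K" using a b by simp
  qed (use xy in simp)
  thus ?thesis using proj_props[OF K] unfolding Z_def by (auto simp: proj_def)
qed

text \<open>A complement is the kernel of its projection, so the projections are distinct. All of
  them are the identity on \<open>A\<close>, so any two differ by a cocycle trivial on
  \<open>A\<close>.\<close>

lemma card_compl_le: "card compl \<le> card (Z A)"
proof -
  have "inj_on proj compl"
  proof (rule inj_onI)
    have "K = {g \<in> carrier G. proj K g = \<one>}" if K: "K \<in> compl" for K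
    proof -
      have sK: "subgroup K G" using K by (auto simp: compl_def)
      interpret K: subgroup K G by fact
      show ?thesis
      proof (intro equalityI subsetI)
        fix g assume g: "g \<in> K"
        hence "g \<in> carrier G" using K.subset by blast
        thus "g \<in> {g \<in> carrier G. proj K g = \<one>}" using proj_eqI[OF K, of g \<one>] g by simp
      next
        fix g assume "g \<in> {g \<in> carrier G. proj K g = \<one>}"
        thus "g \<in> K" using proj_props(2)[OF K, of g] by simp
      qed
    qed
    thus "K = K'" if "K \<in> compl" "K' \<in> compl" "proj K = proj K'" for K K' using that by metis
  qed
  hence "card compl = card (proj ` compl)" by (simp add: card_image)
  also have "\<dots> \<le> card (Z A)"
  proof (rule card_Z_fibre)
    show "proj ` compl \<subseteq> Z {}" using proj_Z by blast
    show "f x = g x" if "f \<in> proj ` compl" "g \<in> proj ` compl" "x \<in> A" for f g x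
      using that proj_on_A by auto
  qed
  finally show ?thesis .
qed

lemma A_subset_sylow:
  assumes P: "sylow_subgroup G p P"
  shows "A \<subseteq> P"
proof
  fix a assume a: "a \<in> A"
  have "card A = card {\<one>} * p ^ n" using card_A by simp
  from normal_subset_mult_sylow[OF fin p P one_is_normal A_normal _ this a]
  obtain y where "y \<in> P \<inter> A" "a = \<one> \<otimes> y" by auto
  thus "a \<in> P" using A_carrier by auto
qed

lemma zp_chars_drop_compl:
  assumes P: "sylow_subgroup G p P" and K: "K \<in> compl"
  shows "p * card (zp_chars G p P A) \<le> card (zp_chars G p P {})"
proof -
  have "proj K ` A = A" using proj_on_A[OF K] by simp
  from zp_chars_drop[OF P proj_Z[OF K] A_normal A_subset_C this]
  have "p * card (zp_chars G p P A) \<le> card (zp_chars G p P {x \<in> A. proj K x = \<one>})" .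
  also have "\<dots> \<le> card (zp_chars G p P {})"
  proof (rule card_mono[OF finite_zp_chars zp_chars_antimono])
    show "finite P" using P fin subgroup.subset finite_subset unfolding sylow_subgroup_def by blast
  qed simp
  finally show ?thesis .
qed

text \<open>When \<open>P\<close> centralises \<open>A\<close>, the projection restricts to a
  homomorphism of \<open>P\<close> that is the identity on \<open>A\<close>, so characters found
  through it are visible on \<open>A\<close>. With rank at least 2 there are two independent ones,
  and passing from no condition to triviality at \<open>b\<close>, and then on all of
  \<open>A\<close>, loses a factor p each time.\<close>

lemma zp_chars_drop_compl_central:
  assumes P: "sylow_subgroup G p P" and K: "K \<in> compl" and PC: "P \<subseteq> C" and n: "n \<ge> 2"
  shows "p ^ 2 * card (zp_chars G p P A) \<le> card (zp_chars G p P {})"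
proof -
  have sP: "subgroup P G" and cP: "card P = p ^ multiplicity p (order G)"
    using P by (auto simp: sylow_subgroup_def)
  interpret P: subgroup P G by fact
  have AP: "A \<subseteq> P" by (rule A_subset_sylow[OF P])
  have finP: "finite P" using fin P.subset finite_subset by blast
  define f where "f = proj K"
  have f: "f \<in> Z {}" using proj_Z[OF K] by (simp add: f_def)
  have fA: "f a = a" if "a \<in> A" for a using proj_on_A[OF K that] by (simp add: f_def)
  have fcl: "f x \<in> A" if "x \<in> P" for x by (rule Z_closed[OF f P.mem_carrier[OF that]])
  have fm: "f (x \<otimes> y) = f x \<otimes> f y" if "x \<in> P" "y \<in> P" for x y
    using Z_mult_C[OF f subsetD[OF PC that(1)] P.mem_carrier[OF that(2)]] .
  have finv: "f (inv x) = inv (f x)" if "x \<in> P" for x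
    using Z_inv_C[OF f subsetD[OF PC that]] .
  have pre: "subgroup {x \<in> P. f x \<in> V} G" if V: "subgroup V G" for V
  proof (rule subgroupI)
    show "{x \<in> P. f x \<in> V} \<noteq> {}"
      using P.one_closed Z_one[OF f] subgroup.one_closed[OF V] by (auto intro!: exI[of _ \<one>])
  qed (use P.subset fm finv subgroup.m_closed[OF V] subgroup.m_inv_closed[OF V] in auto)
  \<comment> \<open>A character trivial on the preimage of \<open>V\<close> factors through
    \<open>f\<close>, so a point where it is nonzero may be replaced by its image in
    \<open>A\<close>.\<close>
  have shift: "\<chi> (f x) \<noteq> 0"
    if V: "subgroup V G" and \<chi>: "\<chi> \<in> zp_chars G p P {x \<in> P. f x \<in> V}" and x: "x \<in> P" "\<chi> x \<noteq> 0" for V \<chi> x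
  proof
    assume 0: "\<chi> (f x) = 0"
    have fx: "f x \<in> P" "f x \<in> A" using fcl[OF x(1)] AP by auto
    have xc: "x \<in> carrier G" using x(1) P.subset by auto
    have "f (inv (f x) \<otimes> x) = \<one>"
      using fm[of "inv (f x)" x] finv[OF fx(1)] fA[OF fx(2)] fx x(1) by (simp add: A_carrier)
    hence "inv (f x) \<otimes> x \<in> {x \<in> P. f x \<in> V}" using fx x(1) subgroup.one_closed[OF V] by simp
    hence "\<chi> (inv (f x) \<otimes> x) = 0" "inv (f x) \<otimes> x \<in> P" using \<chi> by (auto simp: zp_chars_def)
    hence "\<chi> (f x \<otimes> (inv (f x) \<otimes> x)) = 0" using \<chi> fx(1) 0 by (auto simp: zp_chars_def)
    thus False using x fx(1) xc by simp
  qed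
  obtain a where a: "a \<in> A" "a \<noteq> \<one>" using A_nontriv A.one_closed by blast
  have triv: "subgroup {\<one>} G" by (rule triv_subgroup)
  have "a \<in> P" "a \<notin> {x \<in> P. f x \<in> {\<one>}}" using a AP fA[OF a(1)] by auto
  hence "{x \<in> P. f x \<in> {\<one>}} \<noteq> P" by blast
  then obtain \<chi>1 x1 where \<chi>1: "\<chi>1 \<in> zp_chars G p P {x \<in> P. f x \<in> {\<one>}}" "x1 \<in> P" "\<chi>1 x1 \<noteq> 0"
    using exists_zp_char[OF sP cP p pre[OF triv]] by blast
  define b where "b = f x1"
  have b: "b \<in> A" "b \<in> P" "b \<in> carrier G" "\<chi>1 b \<noteq> 0"
    using fcl[OF \<chi>1(2)] AP A_carrier shift[OF triv \<chi>1] by (auto simp: b_def)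
  \<comment> \<open>The second character has to vanish at \<open>b\<close> without vanishing on
    \<open>A\<close>. It is taken trivial on the preimage of the cyclic group of \<open>b\<close>,
    whose order is at most p and hence too small to contain \<open>A\<close>.\<close>
  define V where "V = generate G {b}"
  have V: "subgroup V G" "b \<in> V" using b(3) generate_is_subgroup[of "{b}"] by (auto simp: V_def intro: generate.incl)
  have "ord b dvd p" using A_exp[OF b(1)] pow_eq_id[OF b(3)] by blast
  hence "card V \<le> p" using generate_pow_card[OF b(3)] p by (simp add: V_def dvd_imp_le prime_gt_0_nat)
  also have "p = p ^ 1" by simp
  also have "p ^ 1 < p ^ n" using n prime_gt_1_nat[OF p] by (intro power_strict_increasing) auto
  finally have "card V < card A" using card_A by simp
  moreover have "finite V" using V(1) fin subgroup.subset finite_subset by blast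
  ultimately have "\<not> A \<subseteq> V" using card_mono[of V A] by linarith
  then obtain v where "v \<in> A" "v \<notin> V" by blast
  hence "v \<in> P" "v \<notin> {x \<in> P. f x \<in> V}" using AP fA[of v] by auto
  hence "{x \<in> P. f x \<in> V} \<noteq> P" by blast
  then obtain \<chi>2 x2 where \<chi>2: "\<chi>2 \<in> zp_chars G p P {x \<in> P. f x \<in> V}" "x2 \<in> P" "\<chi>2 x2 \<noteq> 0"
    using exists_zp_char[OF sP cP p pre[OF V(1)]] by blast
  have "p * card (zp_chars G p P {b}) \<le> card (zp_chars G p P {})"
  proof (rule card_zp_chars_less[OF p finP sP])
    show "\<chi>1 \<in> zp_chars G p P {}" using \<chi>1 by (auto simp: zp_chars_def)
    show "\<chi>1 \<notin> zp_chars G p P {b}" using b by (auto simp: zp_chars_def)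
  qed simp
  moreover have "p * card (zp_chars G p P A) \<le> card (zp_chars G p P {b})"
  proof (rule card_zp_chars_less[OF p finP sP])
    show "\<chi>2 \<in> zp_chars G p P {b}" using \<chi>2 b V fA by (auto simp: zp_chars_def)
    show "\<chi>2 \<notin> zp_chars G p P A" using shift[OF V(1) \<chi>2] fcl[OF \<chi>2(2)] AP by (auto simp: zp_chars_def)
  qed (use b in simp)
  hence "p * (p * card (zp_chars G p P A)) \<le> p * card (zp_chars G p P {b})" by (rule mult_le_mono2)
  ultimately show ?thesis unfolding power2_eq_square mult.assoc by linarith
qed

text \<open>For central \<open>A\<close> the projection onto \<open>A\<close> along \<open>K\<close>
  would be a homomorphism to an abelian group. It would kill the derived subgroup, yet it is the
  identity on \<open>A\<close>.\<close>

lemma not_central: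
  assumes K: "K \<in> compl" and der: "A \<subseteq> derived G (carrier G)"
  shows "C \<noteq> carrier G"
proof
  assume C: "C = carrier G"
  define f where "f = proj K"
  have f: "f \<in> Z {}" using proj_Z[OF K] by (simp add: f_def)
  have ker: "subgroup {x \<in> carrier G. f x = \<one>} G" by (rule Z_kernel_subgroup[OF f subgroup_self])
  have "derived G (carrier G) \<subseteq> {x \<in> carrier G. f x = \<one>}"
    unfolding derived_def
  proof (rule generate_subgroup_incl[OF _ ker], clarify)
    fix x y assume xy: "x \<in> carrier G" "y \<in> carrier G"
    have fx: "f x \<in> A" "f y \<in> A" using Z_closed[OF f] xy by auto
    have m: "f (u \<otimes> v) = f u \<otimes> f v" if "u \<in> carrier G" "v \<in> carrier G" for u v
      using Z_mult_C[OF f] that C by simp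
    have i: "f (inv u) = inv (f u)" if "u \<in> carrier G" for u using Z_inv_C[OF f] that C by simp
    have "f (x \<otimes> y \<otimes> inv x \<otimes> inv y) = f x \<otimes> f y \<otimes> inv (f x) \<otimes> inv (f y)"
      using xy by (simp add: m i)
    also have "\<dots> = f y \<otimes> f x \<otimes> inv (f x) \<otimes> inv (f y)" using A_comm[OF fx] by simp
    also have "\<dots> = \<one>" using fx by (simp add: A_carrier m_assoc)
    finally show "x \<otimes> y \<otimes> inv x \<otimes> inv y \<in> carrier G \<and> f (x \<otimes> y \<otimes> inv x \<otimes> inv y) = \<one>" using xy by simp
  qed
  hence "a = \<one>" if "a \<in> A" for a using that der proj_on_A[OF K that] by (auto simp: f_def)
  thus False using A_nontriv A.one_closed by blast
qed

text \<open>For \<open>c\<close> in \<open>C\<close> the commutator of \<open>g\<close> and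
  \<open>c\<close> lies in both \<open>C\<close> and G', so a cocycle trivial there takes the same
  value at \<open>c\<close> and \<open>cj g c\<close>. By equivariance that value is fixed by G,
  hence trivial because \<open>A\<close> is not central. The cocycle is thus trivial on
  \<open>C\<close>, and \<open>card_Z_C_le\<close> applies.\<close>

lemma card_Z_C_derived_le:
  assumes sol: "solvable G" and C: "C \<noteq> carrier G"
  shows "card (Z (C \<inter> derived G (carrier G))) \<le> p ^ n"
proof -
  let ?D = "C \<inter> derived G (carrier G)"
  obtain B r m where B: "B \<lhd> G" "C \<subseteq> B" "B \<noteq> C" "Factorial_Ring.prime r" "card B = card C * r ^ m"
    using exists_normal_above[OF fin sol C_normal C] by blast
  have fixG: "{a \<in> A. \<forall>b\<in>carrier G. cj b a = a} = {\<one>}"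
  proof -
    have "{a \<in> A. \<forall>b\<in>carrier G. cj b a = a} \<noteq> A" using C by (auto simp: C_def)
    thus ?thesis using A_min[OF centralizer_normal[OF normal_self]] by blast
  qed
  have "Z ?D \<subseteq> Z C"
  proof
    fix f assume f: "f \<in> Z ?D"
    have "f c = \<one>" if c: "c \<in> C" for c
    proof -
      have cc: "c \<in> carrier G" using c C_carrier by blast
      have "cj g (f c) = f c" if g: "g \<in> carrier G" for g
      proof -
        have gc: "cj g c \<in> C" by (rule normal.inv_op_closed2[OF C_normal g c])
        have "cj g c \<otimes> inv c \<in> derived G (carrier G)"
          unfolding derived_def by (rule generate.incl) (use g cc in blast)
        moreover have "cj g c \<otimes> inv c \<in> C"
          using subgroup.m_closed[OF normal_imp_subgroup[OF C_normal] gc]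
            subgroup.m_inv_closed[OF normal_imp_subgroup[OF C_normal] c] by blast
        ultimately have "f (cj g c \<otimes> inv c) = \<one>" using f g cc by (auto simp: Z_def)
        hence "f (cj g c) \<otimes> inv (f c) = \<one>"
          using Z_mult_C[OF f gc, of "inv c"] Z_inv_C[OF f c] cc by simp
        hence "f (cj g c) = f c"
          using mult_inv_eq_one A_carrier Z_closed[OF f cc] Z_closed[OF f C_carrier[OF gc]] by blast
        thus ?thesis using Z_equivariant[OF f c g] by simp
      qed
      hence "f c \<in> {a \<in> A. \<forall>b\<in>carrier G. cj b a = a}" using Z_closed[OF f cc] by blast
      thus ?thesis using fixG by blast
    qed
    thus "f \<in> Z C" using f by (auto simp: Z_def)
  qed
  hence "card (Z ?D) \<le> card (Z C)" by (rule card_mono[OF finite_Z])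
  also have "\<dots> \<le> p ^ n" using card_Z_C_le[OF B] card_A by simp
  finally show ?thesis .
qed

end

section \<open>The bound on the number of complements\<close>

context min_normal
begin

text \<open>G acts on a group of order p by powers, so G/C is abelian and, by Fermat, of exponent
  dividing p - 1. As a quotient of G/G' its exponent also divides |G/G'|, and coprimality would make
  G/C trivial.\<close>

lemma prime_order_not_coprime:
  assumes n: "n = 1" and C: "C \<noteq> carrier G"
  shows "\<not> coprime (p - 1) (order (abelianization G))"
proof
  assume cop: "coprime (p - 1) (order (abelianization G))"
  let ?D = "derived G (carrier G)"
  obtain u where u: "u \<in> A" "u \<noteq> \<one>" using A_nontriv A.one_closed by blast
  have uc: "u \<in> carrier G" using u A_carrier by auto
  have "ord u dvd p" using A_exp[OF u(1)] pow_eq_id[OF uc] by blast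
  moreover have "ord u \<noteq> 1" using u uc ord_eq_1 by blast
  ultimately have ordu: "ord u = p" using p by (metis prime_nat_iff)
  have "generate G {u} \<subseteq> A" using generate_subgroup_incl[of "{u}" A] u A.subgroup_axioms by auto
  moreover have "card (generate G {u}) = card A" using generate_pow_card[OF uc] ordu card_A n by simp
  ultimately have gen: "generate G {u} = A" using card_subset_eq[OF finite_A] by blast
  have pw: "\<exists>i::nat. a = u [^] i" if a: "a \<in> A" for a
    using generate_pow_nat[OF uc] ordu p gen a by (auto simp: prime_gt_0_nat)
  have cjp: "cj g (u [^] i) = (cj g u) [^] i" if g: "g \<in> carrier G" for g and i :: nat
  proof (induction i)
    case (Suc i)
    have "cj g (u [^] Suc i) = cj g (u [^] i) \<otimes> cj g u" using cj_mult[OF g, of "u [^] i" u] uc by simp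
    thus ?case using Suc by simp
  qed (use g in simp)
  have cA: "cj g a = a" if g: "g \<in> carrier G" and gu: "cj g u = u" and a: "a \<in> A" for g a
  proof -
    obtain i :: nat where "a = u [^] i" using pw[OF a] by blast
    thus ?thesis using cjp[OF g, of i] gu by simp
  qed
  have commute: "cj (g \<otimes> h) a = cj (h \<otimes> g) a" if g: "g \<in> carrier G" and h: "h \<in> carrier G" and a: "a \<in> A" for g h a
  proof -
    obtain i :: nat where i: "cj g u = u [^] i" using pw[OF cj_closed[OF g u(1)]] by blast
    obtain j :: nat where j: "cj h u = u [^] j" using pw[OF cj_closed[OF h u(1)]] by blast
    obtain l :: nat where l: "a = u [^] l" using pw[OF a] by blast
    have gp: "cj g (u [^] m) = u [^] (i * m)" for m :: nat using cjp[OF g, of m] i uc by (simp add: nat_pow_pow)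
    have hp: "cj h (u [^] m) = u [^] (j * m)" for m :: nat using cjp[OF h, of m] j uc by (simp add: nat_pow_pow)
    have "cj (g \<otimes> h) a = u [^] (i * (j * l))" using cj_cj[OF g h, of a] l uc by (simp only: gp hp nat_pow_closed)
    moreover have "cj (h \<otimes> g) a = u [^] (j * (i * l))" using cj_cj[OF h g, of a] l uc by (simp only: gp hp nat_pow_closed)
    ultimately show ?thesis by (simp add: mult.left_commute)
  qed
  have DC: "?D \<subseteq> C"
    unfolding derived_def
  proof (rule generate_subgroup_incl[OF _ normal_imp_subgroup[OF C_normal]], clarify)
    fix g h assume gh: "g \<in> carrier G" "h \<in> carrier G"
    have "cj (g \<otimes> h \<otimes> inv g \<otimes> inv h) a = a" if a: "a \<in> A" for a
    proof -
      let ?b = "cj (inv (h \<otimes> g)) a"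
      have b: "?b \<in> A" using cj_closed[of "inv (h \<otimes> g)" a] gh a by simp
      have "g \<otimes> h \<otimes> inv g \<otimes> inv h = (g \<otimes> h) \<otimes> inv (h \<otimes> g)" using gh by (simp add: m_assoc inv_mult_group)
      hence "cj (g \<otimes> h \<otimes> inv g \<otimes> inv h) a = cj (g \<otimes> h) ?b" using cj_cj[of "g \<otimes> h" "inv (h \<otimes> g)" a] gh A_carrier[OF a] by simp
      also have "\<dots> = cj (h \<otimes> g) ?b" by (rule commute[OF gh b])
      also have "\<dots> = a" using cj_cj[of "h \<otimes> g" "inv (h \<otimes> g)" a] gh A_carrier[OF a] by simp
      finally show ?thesis .
    qed
    thus "g \<otimes> h \<otimes> inv g \<otimes> inv h \<in> C" using gh by (simp add: C_def)
  qed
  obtain g where g: "g \<in> carrier G" "g \<notin> C" using C C_carrier by blast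
  interpret D: normal ?D G by (rule derived_is_normal[OF normal_self])
  interpret CN: normal C G by (rule C_normal)
  interpret DQ: group "G Mod ?D" by (rule D.factorgroup_is_group)
  interpret CQ: group "G Mod C" by (rule CN.factorgroup_is_group)
  have "(?D #> g) [^]\<^bsub>G Mod ?D\<^esub> order (G Mod ?D) = \<one>\<^bsub>G Mod ?D\<^esub>"
    by (rule DQ.pow_order_eq_1) (use g in \<open>auto simp: carrier_FactGroup\<close>)
  hence "?D #> (g [^] order (G Mod ?D)) = ?D" using D.FactGroup_pow[OF g(1)] by simp
  hence "g [^] order (G Mod ?D) \<in> C" using DC rcos_self[OF _ D.subgroup_axioms, of "g [^] order (G Mod ?D)"] g(1) by auto
  hence 1: "(C #> g) [^]\<^bsub>G Mod C\<^esub> order (G Mod ?D) = \<one>\<^bsub>G Mod C\<^esub>"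
    using CN.FactGroup_pow[OF g(1)] coset_join2[OF _ CN.subgroup_axioms] g(1) by simp
  obtain i :: nat where i: "cj g u = u [^] i" using pw[OF cj_closed[OF g(1) u(1)]] by blast
  have gi: "cj (g [^] m) u = u [^] (i ^ m)" for m :: nat
  proof (induction m)
    case (Suc m)
    have "cj (g [^] Suc m) u = cj (g [^] m) (cj g u)" using g(1) uc by (simp add: m_assoc inv_mult_group)
    also have "\<dots> = (cj (g [^] m) u) [^] i" using i cjp[of "g [^] m" i] g(1) by simp
    finally show ?case using Suc uc by (simp add: nat_pow_pow mult.commute)
  qed (use uc in simp)
  have "\<not> p dvd i"
  proof
    assume "p dvd i"
    hence "u [^] i = \<one>" using pow_eq_id[OF uc] ordu by simp
    thus False using i cj_eq_one[OF g(1) uc] u(2) by simp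
  qed
  hence "[i ^ (p - 1) = 1] (mod p)" using fermat_theorem p by blast
  hence "int p dvd (1 - int (i ^ (p - 1)))"
    by (metis cong_iff_dvd_diff cong_int_iff cong_sym of_nat_1)
  hence "u [^] int (i ^ (p - 1)) = u [^] (1::int)" using int_pow_eq[OF uc] ordu by simp
  hence "u [^] (i ^ (p - 1)) = u" using uc by (simp only: int_pow_int int_pow_1)
  hence "cj (g [^] (p - 1)) u = u" using gi by simp
  moreover have gp: "g [^] (p - 1) \<in> carrier G" using g(1) by simp
  ultimately have "g [^] (p - 1) \<in> C" unfolding C_def using cA[OF gp] by blast
  hence 2: "(C #> g) [^]\<^bsub>G Mod C\<^esub> (p - 1) = \<one>\<^bsub>G Mod C\<^esub>"
    using CN.FactGroup_pow[OF g(1)] coset_join2[OF _ CN.subgroup_axioms] g(1) by simp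
  have "C #> g = \<one>\<^bsub>G Mod C\<^esub>"
    by (rule CQ.pow_coprime_eq_one[OF _ 2 1 cop]) (use g in \<open>auto simp: carrier_FactGroup\<close>)
  hence "g \<in> C" using rcos_self[OF g(1) CN.subgroup_axioms] by simp
  thus False using g by blast
qed

lemma card_fixA_le:
  assumes P: "subgroup P G" "\<not> P \<subseteq> C"
  shows "card (fixA P) \<le> p ^ (n - 1)"
proof -
  interpret P: subgroup P G by (rule P(1))
  have "subgroup (fixA P) G"
  proof (rule subgroupI)
    show "fixA P \<subseteq> carrier G" using A.subset by (auto simp: fixA_def)
    show "fixA P \<noteq> {}" using A.one_closed P.subset by (auto simp: fixA_def subset_iff intro!: exI[of _ \<one>])
    show "inv a \<in> fixA P" if "a \<in> fixA P" for a
      using that P.subset cj_inv by (auto simp: fixA_def A_carrier subset_iff)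
    show "a \<otimes> b \<in> fixA P" if "a \<in> fixA P" "b \<in> fixA P" for a b
      using that P.subset cj_mult by (auto simp: fixA_def A_carrier subset_iff)
  qed
  hence "card (fixA P) dvd p ^ n" using card_subgroup_dvd[OF _ A.subgroup_axioms] card_A by (auto simp: fixA_def)
  then obtain i where i: "i \<le> n" "card (fixA P) = p ^ i" using p divides_primepow_nat by blast
  have "fixA P \<noteq> A" using P(2) P.subset by (auto simp: fixA_def C_def)
  hence "card (fixA P) < card A" using finite_A by (intro psubset_card_mono) (auto simp: fixA_def)
  hence "i < n" using i card_A p prime_gt_1_nat by (metis nat_less_le order_less_irrefl)
  thus ?thesis using i prime_gt_0_nat[OF p] by (simp add: power_increasing)
qed

text \<open>The last claim is c / |A|^k \<le> p^(e - 1 + \<epsilon>) / p^k cleared of denominators,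
  which matches the factor with j = e - 1 in \<open>gen_bound\<close>. With c bounded by p^t it
  becomes the inequality of exponents in \<open>fin_step\<close>.\<close>

lemma card_compl_bound:
  assumes sol: "solvable G" and P: "sylow_subgroup G p P" and h: "card (zp_chars G p P {}) \<le> p ^ e"
    and K: "K \<in> compl" and k: "e + \<epsilon> \<le> k" and \<epsilon>1: "\<epsilon> \<le> 1"
    and \<epsilon>0: "\<epsilon> = 0 \<Longrightarrow> comm_group G \<or> p dvd order (abelianization G)
        \<or> coprime (p - 1) (order (abelianization G))"
    and der: "comm_group G \<or> A \<subseteq> derived G (carrier G)"
  shows "e \<ge> 1" "card (zp_chars G p P A) \<le> p ^ (e - 1)"
    "card compl * p ^ k \<le> (p ^ n) ^ k * p ^ (e - 1 + \<epsilon>)"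
proof -
  have sP: "subgroup P G" and cP: "card P = p ^ multiplicity p (order G)"
    using P by (auto simp: sylow_subgroup_def)
  have finP: "finite P" using sP fin subgroup.subset finite_subset by blast
  have p1: "p > 1" by (rule prime_gt_1_nat[OF p])
  have pos: "card (zp_chars G p P U) \<ge> 1" for U
    using card_zp_chars_pos[OF finP, of p G U] p1 subgroup.m_closed[OF sP] by force
  have drop: "p * card (zp_chars G p P A) \<le> p ^ e" using zp_chars_drop_compl[OF P K] h by linarith
  have le_exp: "s \<le> t" if "p ^ s \<le> p ^ t" for s t using that p1 by simp
  show e1: "e \<ge> 1"
  proof (rule le_exp)
    show "p ^ 1 \<le> p ^ e" using mult_le_mono2[OF pos[of A], of p] drop by (simp only: mult_1_right power_one_right)
  qed
  hence pe: "p ^ e = p * p ^ (e - 1)" by (cases e) auto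
  show hA: "card (zp_chars G p P A) \<le> p ^ (e - 1)" using drop p1 unfolding pe by simp
  have fixle: "card (fixA P) \<le> p ^ n" using card_mono[OF finite_A, of "fixA P"] card_A by (auto simp: fixA_def)
  have fin_step: "card compl * p ^ k \<le> (p ^ n) ^ k * p ^ (e - 1 + \<epsilon>)" if c: "card compl \<le> p ^ t" and t: "t + k \<le> n * k + (e - 1 + \<epsilon>)" for t
  proof -
    have "card compl * p ^ k \<le> p ^ t * p ^ k" using c by simp
    also have "\<dots> = p ^ (t + k)" by (simp add: power_add)
    also have "\<dots> \<le> p ^ (n * k + (e - 1 + \<epsilon>))" using t p1 by (intro power_increasing) auto
    also have "\<dots> = (p ^ n) ^ k * p ^ (e - 1 + \<epsilon>)" by (simp add: power_add power_mult)
    finally show "card compl * p ^ k \<le> (p ^ n) ^ k * p ^ (e - 1 + \<epsilon>)" .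
  qed
  have n1: "n \<ge> 1" using n_pos by simp
  show "card compl * p ^ k \<le> (p ^ n) ^ k * p ^ (e - 1 + \<epsilon>)"
  proof (cases "comm_group G")
    case True
    then interpret cG: comm_group G .
    have C: "C = carrier G"
    proof -
      have "cj g a = a" if "g \<in> carrier G" "a \<in> A" for g a
        using that A_carrier[of a] cG.m_comm[of g a] by (simp add: m_assoc)
      thus ?thesis by (auto simp: C_def)
    qed
    \<comment> \<open>In an abelian group the descent may start from G itself, where only the
      trivial cocycle is left.\<close>
    obtain x where x: "p ^ x * card (zp_chars G p P (carrier G)) \<le> card (zp_chars G p P A)"
        "card (Z A) \<le> card (fixA P) ^ x * card (Z (carrier G))"
      using card_Z_chain[OF P normal_self _ A.subset] C by blast
    have "Z (carrier G) \<subseteq> {\<lambda>x\<in>carrier G. \<one>}" by (auto simp: Z_def PiE_iff extensional_def fun_eq_iff)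
    hence "card (Z (carrier G)) \<le> 1" using card_mono[of "{\<lambda>x\<in>carrier G. \<one>}"] by fastforce
    hence "card (fixA P) ^ x * card (Z (carrier G)) \<le> (p ^ n) ^ x * 1" using fixle by (intro mult_le_mono power_mono) auto
    hence "card compl \<le> p ^ (n * x)" using card_compl_le x(2) unfolding power_mult by linarith
    moreover have "p ^ x * 1 \<le> p ^ (e - 1)"
      using mult_le_mono2[OF pos[of "carrier G"], of "p ^ x"] x(1) hA by linarith
    hence xe: "x \<le> e - 1" using le_exp[of x "e - 1"] by simp
    have "n * x + k \<le> n * k + (e - 1 + \<epsilon>)"
    proof -
      have "x \<le> k" using xe k e1 by linarith
      then obtain d where d: "k = x + d" using le_Suc_ex by blast
      have "d \<le> n * d" using n1 by simp
      moreover have "n * k = n * x + n * d" using d by (simp add: algebra_simps)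
      ultimately show ?thesis using d xe by linarith
    qed
    ultimately show ?thesis by (rule fin_step)
  next
    case False
    let ?D = "C \<inter> derived G (carrier G)"
    have Ad: "A \<subseteq> derived G (carrier G)" using der False by blast
    have C: "C \<noteq> carrier G" by (rule not_central[OF K Ad])
    have der_n: "derived G (carrier G) \<lhd> G" by (rule derived_is_normal[OF normal_self])
    have D: "?D \<lhd> G" by (rule normal_subgroup_intersect[OF C_normal der_n])
    \<comment> \<open>Here the descent starts at the intersection of \<open>C\<close> with G', where
      up to |A| cocycles are left; this contributes the additional summand \<open>n\<close> to the
      exponent.\<close>
    obtain x where x: "p ^ x * card (zp_chars G p P ?D) \<le> card (zp_chars G p P A)"
        "card (Z A) \<le> card (fixA P) ^ x * card (Z ?D)"
      using card_Z_chain[OF P D, of A] A_subset_C Ad by blast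
    have cle: "card compl \<le> card (fixA P) ^ x * p ^ n"
      using card_compl_le x(2) mult_le_mono2[OF card_Z_C_derived_le[OF sol C], of "card (fixA P) ^ x"] by linarith
    have cle': "card compl \<le> p ^ (n * x + n)"
    proof -
      have "card (fixA P) ^ x * p ^ n \<le> (p ^ n) ^ x * p ^ n" using fixle by (intro mult_le_mono power_mono) auto
      thus ?thesis using cle unfolding power_mult power_add by linarith
    qed
    have "p ^ x * 1 \<le> p ^ (e - 1)"
      using mult_le_mono2[OF pos[of ?D], of "p ^ x"] x(1) hA by linarith
    hence xe: "x \<le> e - 1" using le_exp[of x "e - 1"] by simp
    have arith: "n * x + n + k \<le> n * k + (e - 1 + \<epsilon>)" if "x + 1 \<le> e - 1 + \<epsilon>"
    proof -
      have "x + 1 \<le> k" using that k e1 by linarith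
      then obtain d where d: "k = x + 1 + d" using le_Suc_ex by blast
      have "d \<le> n * d" using n1 by simp
      moreover have "n * k = n * x + n + n * d" using d by (simp add: algebra_simps)
      ultimately show ?thesis using d that by linarith
    qed
    \<comment> \<open>One unit to spare absorbs that summand. For \<open>\<epsilon> = 1\<close> the
      weaker target provides it; for \<open>\<epsilon> = 0\<close> it has to come from the structure
      of \<open>P\<close> and \<open>A\<close>.\<close>
    have small: ?thesis if "x + 1 \<le> e - 1 + \<epsilon>" by (rule fin_step[OF cle' arith[OF that]])
    show ?thesis
    proof (cases "\<epsilon> = 1")
      case True
      thus ?thesis using small xe by simp
    next
      case False
      hence e0: "\<epsilon> = 0" using \<epsilon>1 by simp
      show ?thesis
      proof (cases "P \<subseteq> C")
        \<comment> \<open>\<open>P\<close> moves \<open>A\<close>, so each descent costs at most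
          p^(n - 1). Since \<open>A\<close> is a proper subgroup of \<open>P\<close>, a character
          trivial on \<open>A\<close> exists, which makes \<open>e\<close> at least 2.\<close>
        case False
        have AP: "A \<subseteq> P" by (rule A_subset_sylow[OF P])
        have "A \<noteq> P" using False A_subset_C by blast
        hence "p \<le> card (zp_chars G p P A)"
          using card_zp_chars_ge[OF fin sP cP p A.subgroup_axioms AP] by blast
        hence "p ^ 1 \<le> p ^ (e - 1)" using hA by simp
        hence e2: "e - 1 \<ge> 1" by (rule le_exp)
        have "card (fixA P) ^ x * p ^ n \<le> (p ^ (n - 1)) ^ x * p ^ n"
          using card_fixA_le[OF sP False] by (intro mult_le_mono power_mono) auto
        hence "card compl \<le> p ^ ((n - 1) * x + n)" using cle unfolding power_mult power_add by linarith
        moreover have "(n - 1) * x + n + k \<le> n * k + (e - 1 + \<epsilon>)"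
        proof -
          have "x + 1 \<le> k" using xe k e1 by linarith
          then obtain d where d: "k = x + 1 + d" using le_Suc_ex by blast
          obtain m where m: "n = Suc m" using n1 by (cases n) auto
          have "n * k = k + m * x + m + m * d" using d m by (simp add: algebra_simps)
          thus ?thesis using d m e2 by simp
        qed
        ultimately show ?thesis by (rule fin_step)
      next
        case True
        show ?thesis
        proof (cases "n \<ge> 2")
          \<comment> \<open>\<open>P\<close> centralises \<open>A\<close>, which has rank at least
            2: splitting off \<open>A\<close> costs two characters, so \<open>x\<close> is at most e
            - 2.\<close>
          case True
          have "p ^ 2 * p ^ x * 1 \<le> p ^ 2 * p ^ x * card (zp_chars G p P ?D)"
            by (intro mult_le_mono2 pos)
          also have "\<dots> \<le> p ^ 2 * card (zp_chars G p P A)" using mult_le_mono2[OF x(1), of "p ^ 2"] by (simp add: mult.assoc)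
          also have "\<dots> \<le> p ^ e" using zp_chars_drop_compl_central[OF P K \<open>P \<subseteq> C\<close> True] h by linarith
          finally have "p ^ (x + 2) \<le> p ^ e" by (simp add: power_add mult.commute power2_eq_square)
          hence "x + 2 \<le> e" by (rule le_exp)
          thus ?thesis by (intro small) simp
        next
          case False
          hence "n = 1" using n1 by simp
          \<comment> \<open>With \<open>A\<close> of order p and not central the coprime alternative
            is excluded. Then \<open>P\<close> is not contained in G', and a character trivial on
            its intersection with G' survives at the bottom of the chain.\<close>
          hence pa: "p dvd order (abelianization G)"
            using prime_order_not_coprime[OF _ C] \<epsilon>0[OF e0] \<open>\<not> comm_group G\<close> by blast
          let ?S = "P \<inter> derived G (carrier G)"
          have sD: "subgroup (derived G (carrier G)) G" using der_n normal_imp_subgroup by blast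
          have sS: "subgroup ?S G" by (rule subgroups_Inter_pair[OF sP sD])
          have "?S \<noteq> P"
          proof
            assume "?S = P"
            hence "P \<subseteq> derived G (carrier G)" by blast
            then obtain s where s: "card (derived G (carrier G)) = card P * s"
              using card_subgroup_dvd[OF sP sD] by (auto simp: dvd_def)
            have "order (abelianization G) * card (derived G (carrier G)) = order G"
              using lagrange[OF sD] by (simp add: order_def FactGroup_def)
            hence "order G = card P * (s * order (abelianization G))" using s by (simp add: algebra_simps)
            from sylow_index_not_dvd[OF fin p P this] show False using pa by simp
          qed
          hence "p \<le> card (zp_chars G p P ?S)"
            using card_zp_chars_ge[OF fin sP cP p sS] by blast
          also have "\<dots> \<le> card (zp_chars G p P ?D)"
          proof (rule card_mono[OF finite_zp_chars[OF finP]])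
            show "zp_chars G p P ?S \<subseteq> zp_chars G p P ?D" by (auto simp: zp_chars_def)
          qed
          finally have "p ^ x * p \<le> p ^ (e - 1)"
            using mult_le_mono2[of p "card (zp_chars G p P ?D)" "p ^ x"] x(1) hA by linarith
          hence "x + 1 \<le> e - 1" using le_exp[of "x + 1" "e - 1"] by (simp add: mult.commute)
          thus ?thesis by (intro small) simp
        qed
      qed
    qed
  qed
qed

text \<open>Let K be generated by \<open>S\<close>; then KA = G. The intersection of K and
  \<open>A\<close> is normalised by K because \<open>A\<close> is normal, and by \<open>A\<close>
  because \<open>A\<close> is abelian. So it is normal in G, and it cannot be \<open>A\<close> since
  K is proper.\<close>

lemma compl_of_nongenerating:
  assumes hom: "group_hom G G1 \<phi>" and surj: "\<phi> ` carrier G = carrier G1" and ker: "kernel G G1 \<phi> = A"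
    and S: "S \<subseteq> carrier G" "generate G1 (\<phi> ` S) = carrier G1" and ngen: "generate G S \<noteq> carrier G"
  shows "generate G S \<in> compl"
proof -
  interpret h: group_hom G G1 \<phi> by fact
  define K where "K = generate G S"
  have sK: "subgroup K G" unfolding K_def by (rule generate_is_subgroup[OF S(1)])
  interpret K: subgroup K G by fact
  have im: "\<phi> ` K = carrier G1" using h.generate_img[OF S(1)] S(2) by (simp add: K_def)
  have dec: "\<exists>a\<in>A. inv a \<otimes> g \<in> K" if g: "g \<in> carrier G" for g
  proof -
    have "\<phi> g \<in> \<phi> ` K" using im surj g by blast
    then obtain y where y: "y \<in> K" "\<phi> g = \<phi> y" by blast
    have yc: "y \<in> carrier G" using y(1) by (rule K.mem_carrier)
    have "g \<otimes> inv y \<in> A" using y g yc unfolding ker[symmetric] by (simp add: kernel_def)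
    moreover have "inv (g \<otimes> inv y) \<otimes> g = y" using g yc by (simp add: inv_mult_group m_assoc)
    ultimately show ?thesis using y(1) by metis
  qed
  have "K \<inter> A \<lhd> G"
    unfolding normal_inv_iff
  proof (intro conjI ballI)
    show "subgroup (K \<inter> A) G" by (rule subgroups_Inter_pair[OF sK A.subgroup_axioms])
    fix x z assume x: "x \<in> carrier G" and z: "z \<in> K \<inter> A"
    obtain a where a: "a \<in> A" "inv a \<otimes> x \<in> K" using dec[OF x] by blast
    define y where "y = inv a \<otimes> x"
    have y: "y \<in> K" "y \<in> carrier G" "x = a \<otimes> y" using a x by (auto simp: y_def A_carrier)
    have yz: "cj y z \<in> A" using cj_closed[OF y(2)] z by blast
    have "cj x z = cj a (cj y z)" using cj_cj[of a y z] a y z A_carrier by simp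
    also have "\<dots> = cj y z" using A_subset_C a(1) yz by (auto simp: C_def)
    finally show "cj x z \<in> K \<inter> A" using yz y z K.m_closed K.m_inv_closed by simp
  qed
  moreover have "K \<inter> A \<noteq> A"
  proof
    assume "K \<inter> A = A"
    hence "A \<subseteq> K" by blast
    have "carrier G \<subseteq> K"
    proof
      fix g assume g: "g \<in> carrier G"
      obtain a where a: "a \<in> A" "inv a \<otimes> g \<in> K" using dec[OF g] by blast
      hence "a \<otimes> (inv a \<otimes> g) \<in> K" using \<open>A \<subseteq> K\<close> by blast
      thus "g \<in> K" using a g by (simp add: A_carrier)
    qed
    thus False using ngen K.subset by (auto simp: K_def)
  qed
  ultimately have "K \<inter> A = {\<one>}" using A_min by blast
  thus ?thesis using sK dec by (simp add: compl_def K_def)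
qed

text \<open>Gaschuetz's argument: a generating tuple of \<open>G1\<close> has |A|^k lifts. A lift
  that fails to generate G generates a complement, and different failing lifts give different
  complements, because a complement meets each coset of \<open>A\<close> only once.\<close>

lemma gen_prob_step:
  assumes hom: "group_hom G G1 \<phi>" and surj: "\<phi> ` carrier G = carrier G1" and ker: "kernel G G1 \<phi> = A"
  shows "gen_prob G k \<ge> gen_prob G1 k * (1 - real (card compl) / real (card A) ^ k)"
proof -
  interpret h: group_hom G G1 \<phi> by fact
  define I where "I = {..<k}"
  define gens where "gens = {f \<in> I \<rightarrow>\<^sub>E carrier G. generate G (f ` I) = carrier G}"
  define gens1 where "gens1 = {f \<in> I \<rightarrow>\<^sub>E carrier G1. generate G1 (f ` I) = carrier G1}"
  define \<Phi> where "\<Phi> f = (\<lambda>i\<in>I. \<phi> (f i))" for f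
  have finI: "finite I" "card I = k" by (auto simp: I_def)
  have fin1: "finite (carrier G1)" using fin surj by (metis finite_imageI)
  have fin_PiE': "finite (I \<rightarrow>\<^sub>E carrier G)" "finite (I \<rightarrow>\<^sub>E carrier G1)" using finI fin fin1 by (auto intro: finite_PiE)
  have finite_gens: "finite gens" "finite gens1" using fin_PiE' by (auto simp: gens_def gens1_def)
  have im: "\<Phi> f ` I = \<phi> ` f ` I" for f by (auto simp: \<Phi>_def)
  have fib: "card {x \<in> carrier G. \<phi> x = y} = card A" if y: "y \<in> carrier G1" for y
  proof -
    obtain x0 where x0: "x0 \<in> carrier G" "\<phi> x0 = y" using surj y by (metis imageE)
    have "bij_betw (\<lambda>a. a \<otimes> x0) A {x \<in> carrier G. \<phi> x = y}"
    proof (rule bij_betw_byWitness[where f'="\<lambda>x. x \<otimes> inv x0"])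
      show "\<forall>a\<in>A. a \<otimes> x0 \<otimes> inv x0 = a" using x0 by (simp add: A_carrier m_assoc)
      show "\<forall>x\<in>{x \<in> carrier G. \<phi> x = y}. x \<otimes> inv x0 \<otimes> x0 = x" using x0 by (simp add: m_assoc)
      show "(\<lambda>a. a \<otimes> x0) ` A \<subseteq> {x \<in> carrier G. \<phi> x = y}"
        using x0 y unfolding ker[symmetric] by (auto simp: kernel_def)
      show "(\<lambda>x. x \<otimes> inv x0) ` {x \<in> carrier G. \<phi> x = y} \<subseteq> A"
        using x0 y unfolding ker[symmetric] by (auto simp: kernel_def)
    qed
    thus ?thesis by (simp add: bij_betw_same_card)
  qed
  have order: "card (carrier G) = card (carrier G1) * card A"
    by (rule card_eq_fibres[of _ _ \<phi>]) (use fin fin1 surj fib in auto)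
  have \<Phi>gens: "\<Phi> ` gens \<subseteq> gens1"
  proof (rule image_subsetI)
    fix f assume f: "f \<in> gens"
    have "f ` I \<subseteq> carrier G" using f by (auto simp: gens_def)
    hence "generate G1 (\<Phi> f ` I) = \<phi> ` generate G (f ` I)" unfolding im using h.generate_img by simp
    also have "\<dots> = carrier G1" using f surj by (simp add: gens_def)
    finally show "\<Phi> f \<in> gens1" using f by (auto simp: gens1_def gens_def \<Phi>_def PiE_iff)
  qed
  have low: "real (card {f \<in> gens. \<Phi> f = g}) \<ge> real (card A) ^ k - real (card compl)" if g: "g \<in> gens1" for g
  proof -
    let ?all = "{f \<in> I \<rightarrow>\<^sub>E carrier G. \<Phi> f = g}"
    let ?bad = "{f \<in> ?all. generate G (f ` I) \<noteq> carrier G}"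
    have gc: "g i \<in> carrier G1" if "i \<in> I" for i using g that by (auto simp: gens1_def)
    have ge: "g i = undefined" if "i \<notin> I" for i using g that by (auto simp: gens1_def PiE_iff extensional_def)
    have "?all = (\<Pi>\<^sub>E i\<in>I. {x \<in> carrier G. \<phi> x = g i})"
    proof (intro equalityI subsetI)
      fix f assume "f \<in> ?all"
      thus "f \<in> (\<Pi>\<^sub>E i\<in>I. {x \<in> carrier G. \<phi> x = g i})" by (auto simp: \<Phi>_def PiE_iff)
    next
      fix f assume f: "f \<in> (\<Pi>\<^sub>E i\<in>I. {x \<in> carrier G. \<phi> x = g i})"
      hence "\<Phi> f = g" using ge by (auto simp: \<Phi>_def fun_eq_iff PiE_iff)
      thus "f \<in> ?all" using f by (auto simp: PiE_iff)
    qed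
    hence call: "card ?all = card A ^ k" using finI fib gc by (simp add: card_PiE)
    have finall: "finite ?all" using fin_PiE' by simp
    have "card ?bad \<le> card compl"
    proof (rule card_inj_on_le[OF _ _ finite_compl])
      have bad: "generate G (f ` I) \<in> compl" if f: "f \<in> ?bad" for f
      proof (rule compl_of_nongenerating[OF hom surj ker])
        show "generate G1 (\<phi> ` f ` I) = carrier G1" using f g im[of f] by (auto simp: gens1_def)
      qed (use f in auto)
      thus "(\<lambda>f. generate G (f ` I)) ` ?bad \<subseteq> compl" by blast
      show "inj_on (\<lambda>f. generate G (f ` I)) ?bad"
      proof (rule inj_onI)
        fix f f' assume f: "f \<in> ?bad" and f': "f' \<in> ?bad" and eq: "generate G (f ` I) = generate G (f' ` I)"
        define K where "K = generate G (f ` I)"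
        have K: "K \<in> compl" using bad[OF f] by (simp add: K_def)
        hence sK: "subgroup K G" "K \<inter> A = {\<one>}" by (auto simp: compl_def)
        have "f i = f' i" for i
        proof (cases "i \<in> I")
          case True
          have c: "f i \<in> carrier G" "f' i \<in> carrier G" using f f' True by auto
          have "\<Phi> f i = \<Phi> f' i" using f f' by simp
          hence "\<phi> (f i) = \<phi> (f' i)" using True by (simp add: \<Phi>_def)
          hence "f i \<otimes> inv (f' i) \<in> A" using c unfolding ker[symmetric] by (simp add: kernel_def)
          moreover have "f i \<in> K" using True unfolding K_def by (intro generate.incl) blast
          moreover have "f' i \<in> K" using True unfolding K_def eq by (intro generate.incl) blast
          ultimately have "f i \<otimes> inv (f' i) \<in> K \<inter> A"
            using subgroup.m_closed[OF sK(1)] subgroup.m_inv_closed[OF sK(1)] by blast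
          thus ?thesis using sK(2) mult_inv_eq_one c by blast
        next
          case False
          thus ?thesis using f f' by (auto simp: PiE_iff extensional_def)
        qed
        thus "f = f'" by blast
      qed
    qed
    moreover have "card ?all = card {f \<in> gens. \<Phi> f = g} + card ?bad"
    proof -
      have "finite {f \<in> gens. \<Phi> f = g}" "finite ?bad" using finite_gens finite_subset[OF _ finall, of ?bad] by auto
      moreover have "{f \<in> gens. \<Phi> f = g} \<inter> ?bad = {}" by (auto simp: gens_def)
      ultimately have "card ({f \<in> gens. \<Phi> f = g} \<union> ?bad) = card {f \<in> gens. \<Phi> f = g} + card ?bad"
        by (rule card_Un_disjoint)
      moreover have "{f \<in> gens. \<Phi> f = g} \<union> ?bad = ?all" by (auto simp: gens_def)
      ultimately show ?thesis by (simp only:)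
    qed
    ultimately show ?thesis using call by (simp flip: of_nat_power)
  qed
  have "real (card gens) = (\<Sum>g\<in>gens1. real (card {f \<in> gens. \<Phi> f = g}))"
    using sum.group[OF finite_gens \<Phi>gens, of "\<lambda>_. 1::real"] by simp
  also have "\<dots> \<ge> (\<Sum>g\<in>gens1. real (card A) ^ k - real (card compl))"
    by (rule sum_mono) (rule low)
  finally have main: "real (card gens) \<ge> real (card gens1) * (real (card A) ^ k - real (card compl))" by simp
  have posA: "real (card A) ^ k > 0" using card_A prime_gt_0_nat[OF p] by simp
  have "gen_prob G1 k * (1 - real (card compl) / real (card A) ^ k)
      = real (card gens1) * (real (card A) ^ k - real (card compl)) / (real (card (carrier G1)) ^ k * real (card A) ^ k)"
  proof -
    have "x / y * (1 - c / a) = x * (a - c) / (y * a)" if "a > 0" for x y c a :: real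
      using that by (simp add: field_simps)
    from this[OF posA] show ?thesis by (simp add: gen_prob_def gens1_def I_def)
  qed
  also have "\<dots> \<le> real (card gens) / (real (card (carrier G1)) ^ k * real (card A) ^ k)"
    using main by (intro divide_right_mono) auto
  also have "\<dots> = gen_prob G k" by (simp add: gen_prob_def gens_def I_def order power_mult_distrib)
  finally show ?thesis .
qed

end

section \<open>The lower bound for the generation probability\<close>

text \<open>Factor groups have sets as elements, so an induction through quotients would change the
  type at every step; a copy on the natural numbers keeps it fixed.\<close>

lemma (in group) exists_nat_quotient:
  assumes fin: "finite (carrier G)" and N: "N \<lhd> G"
  shows "\<exists>(Q::nat monoid) \<phi>. group_hom G Q \<phi> \<and> \<phi> ` carrier G = carrier Q \<and> kernel G Q \<phi> = N"
proof -
  interpret N: normal N G by fact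
  have "finite ((\<lambda>x. N #> x) ` carrier G)" using fin by simp
  then obtain enc :: "'a set \<Rightarrow> nat" where enc: "inj_on enc ((\<lambda>x. N #> x) ` carrier G)"
    using finite_imp_inj_to_nat_seg by metis
  define f where "f x = enc (N #> x)" for x
  have "f a = f b \<longleftrightarrow> a \<otimes> inv b \<in> N" if ab: "a \<in> carrier G" "b \<in> carrier G" for a b
  proof -
    have "f a = f b \<longleftrightarrow> N #> a = N #> b" unfolding f_def using enc ab by (auto dest: inj_onD)
    also have "\<dots> \<longleftrightarrow> a \<in> N #> b"
      using repr_independence[OF _ ab(2) N.subgroup_axioms] rcos_self[OF ab(1) N.subgroup_axioms] by metis
    also have "\<dots> \<longleftrightarrow> a \<otimes> inv b \<in> N" by (rule N.rcos_module[OF is_group ab(2,1)])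
    finally show ?thesis .
  qed
  hence w: "weak_group_morphism f N G" by (rule weak_group_morphismsI[OF N])
  show ?thesis
    using weak_group_morphism_group_hom[OF w] weak_group_morphism_ker[OF w] image_group_carrier[of f G] by metis
qed

lemma (in group) sylow_subgroupI:
  assumes P: "subgroup P G" "card P = q ^ s" and q: "Factorial_Ring.prime q"
    and ord: "order G = card P * w" "\<not> q dvd w"
  shows "sylow_subgroup G q P"
proof -
  have "multiplicity q (order G) = s"
  proof (rule multiplicity_eqI)
    show "q ^ s dvd order G" using ord P(2) by simp
    show "\<not> q ^ Suc s dvd order G"
      using ord P(2) prime_gt_0_nat[OF q] by (simp add: mult.commute[of q])
  qed
  thus ?thesis using P by (simp add: sylow_subgroup_def)
qed

section \<open>Passing the hypotheses to a quotient\<close>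

locale finite_epi = group_hom G Q \<phi> for G (structure) and Q (structure) and \<phi> +
  assumes finG: "finite (carrier G)" and onto: "\<phi> ` carrier G = carrier Q"
begin

lemma finQ: "finite (carrier Q)" using finG onto by (metis finite_imageI)

lemma card_image:
  assumes S: "subgroup S G"
  shows "card S = card (\<phi> ` S) * card (S \<inter> kernel G Q \<phi>)"
proof (rule card_eq_fibres[of _ _ \<phi>])
  interpret S: subgroup S G by fact
  show "finite S" using finG S.subset finite_subset by blast
  thus "finite (\<phi> ` S)" by simp
  fix y assume "y \<in> \<phi> ` S"
  then obtain x0 where x0: "x0 \<in> S" "\<phi> x0 = y" by blast
  have x0c: "x0 \<in> carrier G" using x0(1) by (rule S.mem_carrier)
  have "bij_betw (\<lambda>a. a \<otimes> x0) (S \<inter> kernel G Q \<phi>) {x \<in> S. \<phi> x = y}"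
  proof (rule bij_betw_byWitness[where f'="\<lambda>x. x \<otimes> inv x0"])
    show "\<forall>a\<in>S \<inter> kernel G Q \<phi>. a \<otimes> x0 \<otimes> inv x0 = a"
      using x0c by (auto simp: kernel_def G.m_assoc)
    show "\<forall>x\<in>{x \<in> S. \<phi> x = y}. x \<otimes> inv x0 \<otimes> x0 = x"
      using x0c S.mem_carrier by (auto simp: G.m_assoc)
    show "(\<lambda>a. a \<otimes> x0) ` (S \<inter> kernel G Q \<phi>) \<subseteq> {x \<in> S. \<phi> x = y}"
      using x0 x0c by (auto simp: kernel_def)
    show "(\<lambda>x. x \<otimes> inv x0) ` {x \<in> S. \<phi> x = y} \<subseteq> S \<inter> kernel G Q \<phi>"
      using x0 x0c S.mem_carrier by (auto simp: kernel_def)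
  qed
  thus "card {x \<in> S. \<phi> x = y} = card (S \<inter> kernel G Q \<phi>)" by (simp add: bij_betw_same_card)
qed simp

lemma order_eq: "order G = order Q * card (kernel G Q \<phi>)"
proof -
  have "carrier G \<inter> kernel G Q \<phi> = kernel G Q \<phi>" by (auto simp: kernel_def)
  thus ?thesis using card_image[OF G.subgroup_self] onto by (simp add: order_def)
qed

lemma sylow_image:
  assumes q: "Factorial_Ring.prime q" and P: "sylow_subgroup G q P"
  shows "sylow_subgroup Q q (\<phi> ` P)"
proof -
  have sP: "subgroup P G" and cP: "card P = q ^ multiplicity q (order G)"
    using P by (auto simp: sylow_subgroup_def)
  let ?K = "kernel G Q \<phi>"
  have sI: "subgroup (\<phi> ` P) Q" by (rule subgroup_img_is_subgroup[OF sP])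
  have sK: "subgroup ?K G" by (rule subgroup_kernel)
  have sPK: "subgroup (P \<inter> ?K) G" by (rule G.subgroups_Inter_pair[OF sP sK])
  have c1: "card P = card (\<phi> ` P) * card (P \<inter> ?K)" by (rule card_image[OF sP])
  obtain t where t: "card ?K = card (P \<inter> ?K) * t"
    using G.card_subgroup_dvd[OF sPK sK] by (auto simp: dvd_def)
  obtain w where w: "order Q = card (\<phi> ` P) * w"
    using H.lagrange[OF sI] by (metis mult.commute)
  have "order G = card P * (w * t)" using order_eq t w c1 by (simp add: algebra_simps)
  from G.sylow_index_not_dvd[OF finG q P this] have nw: "\<not> q dvd w" by auto
  have "card (\<phi> ` P) dvd q ^ multiplicity q (order G)" using c1 cP by (metis dvd_triv_left)
  then obtain s where "card (\<phi> ` P) = q ^ s" using q divides_primepow_nat by blast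
  thus ?thesis using H.sylow_subgroupI[OF sI _ q w nw] by blast
qed

text \<open>Composition with \<open>\<phi>\<close> is injective on characters of the image, and the
  composites vanish on the kernel.\<close>

lemma card_zp_chars_image:
  assumes P: "subgroup P G"
  shows "card (zp_chars Q q (\<phi> ` P) {}) \<le> card (zp_chars G q P (kernel G Q \<phi>))"
proof (rule card_inj_on_le)
  interpret P: subgroup P G by fact
  let ?F = "\<lambda>\<chi>. \<lambda>x\<in>P. \<chi> (\<phi> x)"
  show "finite (zp_chars G q P (kernel G Q \<phi>))"
    using finG P.subset finite_subset by (blast intro: finite_zp_chars)
  show "inj_on ?F (zp_chars Q q (\<phi> ` P) {})"
  proof (rule inj_onI)
    fix \<chi> \<psi> assume \<chi>: "\<chi> \<in> zp_chars Q q (\<phi> ` P) {}" and \<psi>: "\<psi> \<in> zp_chars Q q (\<phi> ` P) {}" and eq: "?F \<chi> = ?F \<psi>"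
    show "\<chi> = \<psi>"
    proof
      fix y show "\<chi> y = \<psi> y"
      proof (cases "y \<in> \<phi> ` P")
        case True
        then obtain x where "x \<in> P" "y = \<phi> x" by blast
        thus ?thesis using fun_cong[OF eq, of x] by simp
      next
        case False
        thus ?thesis using \<chi> \<psi> by (auto simp: zp_chars_def PiE_iff extensional_def)
      qed
    qed
  qed
  show "?F ` zp_chars Q q (\<phi> ` P) {} \<subseteq> zp_chars G q P (kernel G Q \<phi>)"
  proof (rule image_subsetI)
    fix \<chi> assume "\<chi> \<in> zp_chars Q q (\<phi> ` P) {}"
    hence rng: "\<And>x. x \<in> P \<Longrightarrow> \<chi> (\<phi> x) < q"
      and mult: "\<And>x y. x \<in> P \<Longrightarrow> y \<in> P \<Longrightarrow> \<chi> (\<phi> x \<otimes>\<^bsub>Q\<^esub> \<phi> y) = (\<chi> (\<phi> x) + \<chi> (\<phi> y)) mod q"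
      by (auto simp: zp_chars_def PiE_iff)
    have one: "\<chi> \<one>\<^bsub>Q\<^esub> = 0"
    proof -
      have "\<chi> \<one>\<^bsub>Q\<^esub> = (\<chi> \<one>\<^bsub>Q\<^esub> + \<chi> \<one>\<^bsub>Q\<^esub>) mod q" "\<chi> \<one>\<^bsub>Q\<^esub> < q"
        using mult[of \<one> \<one>] rng[of \<one>] by simp_all
      thus ?thesis by (auto simp: mod_if split: if_splits)
    qed
    show "?F \<chi> \<in> zp_chars G q P (kernel G Q \<phi>)"
      unfolding zp_chars_def
    proof (intro CollectI conjI ballI)
      show "?F \<chi> \<in> P \<rightarrow>\<^sub>E {..<q}" using rng by auto
      show "?F \<chi> (x \<otimes> y) = (?F \<chi> x + ?F \<chi> y) mod q" if "x \<in> P" "y \<in> P" for x y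
        using that mult[OF that] hom_mult P.mem_carrier by simp
      show "?F \<chi> x = 0" if "x \<in> P \<inter> kernel G Q \<phi>" for x using that one by (simp add: kernel_def)
    qed
  qed
qed

lemma comm_group_image: "comm_group G \<Longrightarrow> comm_group Q"
proof -
  assume "comm_group G"
  then interpret cG: comm_group G .
  show ?thesis
  proof (rule H.group_comm_groupI)
    fix x y assume "x \<in> carrier Q" "y \<in> carrier Q"
    then obtain u v where uv: "u \<in> carrier G" "v \<in> carrier G" "x = \<phi> u" "y = \<phi> v" using onto by (metis imageE)
    thus "x \<otimes>\<^bsub>Q\<^esub> y = y \<otimes>\<^bsub>Q\<^esub> x" using cG.m_comm[OF uv(1,2)] hom_mult by metis
  qed
qed

lemma order_abelianization:
  assumes "kernel G Q \<phi> \<subseteq> derived G (carrier G)"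
  shows "order (abelianization Q) = order (abelianization G)"
proof -
  have sG: "subgroup (derived G (carrier G)) G" using G.derived_is_subgroup by blast
  have sQ: "subgroup (derived Q (carrier Q)) Q" using H.derived_is_subgroup by blast
  have 1: "order (abelianization G) * card (derived G (carrier G)) = order G"
    using G.lagrange[OF sG] by (simp add: order_def FactGroup_def)
  have 2: "order (abelianization Q) * card (derived Q (carrier Q)) = order Q"
    using H.lagrange[OF sQ] by (simp add: order_def FactGroup_def)
  have "\<phi> ` derived G (carrier G) = derived Q (carrier Q)" using derived_img[of "carrier G"] onto by simp
  moreover have "derived G (carrier G) \<inter> kernel G Q \<phi> = kernel G Q \<phi>" using assms by blast
  ultimately have 3: "card (derived G (carrier G)) = card (derived Q (carrier Q)) * card (kernel G Q \<phi>)"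
    using card_image[OF sG] by simp
  have pos: "card (derived G (carrier G)) > 0" using subgroup.finite_imp_card_positive[OF sG finG] .
  have "order (abelianization G) * card (derived G (carrier G)) = order (abelianization Q) * card (derived G (carrier G))"
    using 1 2 3 order_eq by (metis mult.assoc)
  thus ?thesis using pos by simp
qed

lemma solvable_image: "solvable G \<Longrightarrow> solvable Q"
  using solvable_imp_solvable_img[of "carrier G"] onto by (simp add: solvable_def)

end

text \<open>For k large enough, the factor at p is the probability that \<open>e p\<close> random
  vectors of length k over the field with p elements are independent modulo a fixed subspace of
  dimension \<open>\<epsilon> p\<close>.\<close>

definition gen_bound :: "nat set \<Rightarrow> (nat \<Rightarrow> nat) \<Rightarrow> (nat \<Rightarrow> nat) \<Rightarrow> nat \<Rightarrow> real" where
  "gen_bound \<pi> \<epsilon> e k = (\<Prod>p\<in>\<pi>. \<Prod>j<e p. 1 - real p ^ (j + \<epsilon> p) / real p ^ k)"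

text \<open>The hypotheses under which \<^const>\<open>gen_bound\<close> is a lower bound; they pass to the quotient by a
  minimal normal subgroup, possibly after lowering \<open>e\<close> at one prime.\<close>

definition gen_data :: "('a, 'b) monoid_scheme \<Rightarrow> nat set \<Rightarrow> (nat \<Rightarrow> nat) \<Rightarrow> (nat \<Rightarrow> nat) \<Rightarrow> nat \<Rightarrow> bool" where
  "gen_data G \<pi> \<epsilon> e k \<longleftrightarrow> finite \<pi> \<and> prime_divs (order G) \<subseteq> \<pi> \<and>
     (\<forall>p\<in>\<pi>. Factorial_Ring.prime p \<and> \<epsilon> p \<le> 1 \<and> e p + \<epsilon> p \<le> k \<and>
        (\<epsilon> p = 0 \<longrightarrow> comm_group G \<or> p dvd order (abelianization G) \<or> coprime (p - 1) (order (abelianization G))) \<and>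
        (\<exists>P. sylow_subgroup G p P \<and> card (zp_chars G p P {}) \<le> p ^ e p))"

lemma gen_bound_factor:
  assumes "Factorial_Ring.prime p" "j + d \<le> k"
  shows "0 \<le> 1 - real p ^ (j + d) / real p ^ k" "1 - real p ^ (j + d) / real p ^ k \<le> 1"
proof -
  have p: "real p \<ge> 1" using prime_ge_1_nat[OF assms(1)] by simp
  have "real p ^ (j + d) \<le> real p ^ k" using p assms(2) by (rule power_increasing[rotated])
  thus "0 \<le> 1 - real p ^ (j + d) / real p ^ k" using p by (simp add: divide_le_eq_1)
  show "1 - real p ^ (j + d) / real p ^ k \<le> 1" using p by simp
qed

lemma gen_bound_nonneg:
  assumes "\<And>p. p \<in> \<pi> \<Longrightarrow> Factorial_Ring.prime p \<and> e p + \<epsilon> p \<le> k"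
  shows "0 \<le> gen_bound \<pi> \<epsilon> e k" "gen_bound \<pi> \<epsilon> e k \<le> 1"
proof -
  have f: "0 \<le> 1 - real p ^ (j + \<epsilon> p) / real p ^ k" "1 - real p ^ (j + \<epsilon> p) / real p ^ k \<le> 1"
    if "p \<in> \<pi>" "j < e p" for p j
    using gen_bound_factor[of p j "\<epsilon> p" k] assms[OF that(1)] that(2) by auto
  show "0 \<le> gen_bound \<pi> \<epsilon> e k" unfolding gen_bound_def
    by (intro prod_nonneg ballI) (use f in auto)
  show "gen_bound \<pi> \<epsilon> e k \<le> 1" unfolding gen_bound_def
    by (intro prod_le_1 conjI prod_nonneg) (use f in auto)
qed

lemma gen_bound_step:
  assumes "finite \<pi>" "p \<in> \<pi>" "e p \<ge> 1"
  shows "gen_bound \<pi> \<epsilon> e k = gen_bound \<pi> \<epsilon> (e(p := e p - 1)) k * (1 - real p ^ (e p - 1 + \<epsilon> p) / real p ^ k)"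
proof -
  obtain m where m: "e p = Suc m" using assms(3) by (cases "e p") auto
  let ?f = "\<lambda>e q. \<Prod>j<e q. 1 - real q ^ (j + \<epsilon> q) / real q ^ k"
  have "gen_bound \<pi> \<epsilon> e k = ?f e p * (\<Prod>q\<in>\<pi> - {p}. ?f e q)"
    unfolding gen_bound_def by (rule prod.remove[OF assms(1,2)])
  moreover have "gen_bound \<pi> \<epsilon> (e(p := e p - 1)) k = ?f (e(p := e p - 1)) p * (\<Prod>q\<in>\<pi> - {p}. ?f (e(p := e p - 1)) q)"
    unfolding gen_bound_def by (rule prod.remove[OF assms(1,2)])
  moreover have "(\<Prod>q\<in>\<pi> - {p}. ?f (e(p := e p - 1)) q) = (\<Prod>q\<in>\<pi> - {p}. ?f e q)" by (rule prod.cong) auto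
  moreover have "?f e p = ?f (e(p := e p - 1)) p * (1 - real p ^ (e p - 1 + \<epsilon> p) / real p ^ k)"
    using m by simp
  ultimately show ?thesis by simp
qed

lemma (in group) derived_trivial_imp_comm:
  assumes "derived G (carrier G) = {\<one>}"
  shows "comm_group G"
proof (rule group_comm_groupI)
  fix x y assume xy: "x \<in> carrier G" "y \<in> carrier G"
  have "x \<otimes> y \<otimes> inv x \<otimes> inv y \<in> derived G (carrier G)"
    unfolding derived_def by (rule generate.incl) (use xy in blast)
  hence "x \<otimes> y \<otimes> inv x \<otimes> inv y = \<one>" using assms by blast
  hence "x \<otimes> y \<otimes> inv (y \<otimes> x) = \<one>" using xy by (simp add: m_assoc inv_mult_group)
  thus "x \<otimes> y = y \<otimes> x" using mult_inv_eq_one[of "x \<otimes> y" "y \<otimes> x"] xy by simp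
qed

text \<open>The induction step is kept apart from the induction because G may have any type while
  the hypothesis speaks of groups on the natural numbers. It serves inside the induction and once
  more for the given group.\<close>

lemma gen_prob_lower_step:
  fixes G :: "('a, 'b) monoid_scheme" (structure)
  assumes G: "group G" "finite (carrier G)" "solvable G" and data: "gen_data G \<pi> \<epsilon> e k"
    and IH: "\<And>(Q::nat monoid) e'. group Q \<Longrightarrow> finite (carrier Q) \<Longrightarrow> solvable Q \<Longrightarrow> order Q < order G
      \<Longrightarrow> gen_data Q \<pi> \<epsilon> e' k \<Longrightarrow> gen_prob Q k \<ge> gen_bound \<pi> \<epsilon> e' k"
  shows "gen_prob G k \<ge> gen_bound \<pi> \<epsilon> e k"
proof -
  interpret group G by fact
  have \<pi>: "finite \<pi>" "prime_divs (order G) \<subseteq> \<pi>" using data by (auto simp: gen_data_def)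
  have d: "Factorial_Ring.prime q" "\<epsilon> q \<le> 1" "e q + \<epsilon> q \<le> k"
    "\<epsilon> q = 0 \<Longrightarrow> comm_group G \<or> q dvd order (abelianization G) \<or> coprime (q - 1) (order (abelianization G))"
    if "q \<in> \<pi>" for q
    using data that by (auto simp: gen_data_def)
  show ?thesis
  proof (cases "carrier G = {\<one>}")
    case True
    have "gen_prob G k = 1"
    proof -
      have "generate G (f ` {..<k}) = {\<one>}" if "f \<in> {..<k} \<rightarrow>\<^sub>E {\<one>}" for f
      proof -
        have "f ` {..<k} \<subseteq> {\<one>}" using that by auto
        hence "generate G (f ` {..<k}) \<subseteq> {\<one>}" by (rule generate_subgroup_incl[OF _ triv_subgroup])
        thus ?thesis using generate.one[of G] by blast
      qed
      hence "{f \<in> {..<k} \<rightarrow>\<^sub>E {\<one>}. generate G (f ` {..<k}) = {\<one>}} = {..<k} \<rightarrow>\<^sub>E {\<one>}" by blast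
      thus ?thesis by (simp add: gen_prob_def True card_PiE)
    qed
    thus ?thesis using gen_bound_nonneg(2)[of \<pi> e \<epsilon> k] d by auto
  next
    case False
    define T where "T = (if comm_group G then carrier G else derived G (carrier G))"
    have T: "T \<lhd> G" using normal_self derived_is_normal[OF normal_self] by (simp add: T_def)
    have "T \<noteq> {\<one>}" using False derived_trivial_imp_comm by (auto simp: T_def)
    then obtain A p n where A: "A \<subseteq> T" "min_normal G A p n"
      using solvable_min_normal[OF G(2,3) T] by blast
    interpret A: min_normal G A p n by (rule A(2))
    have der: "comm_group G \<or> A \<subseteq> derived G (carrier G)" using A(1) by (auto simp: T_def split: if_splits)
    obtain Q :: "nat monoid" and \<phi> where Q: "group_hom G Q \<phi>" "\<phi> ` carrier G = carrier Q" "kernel G Q \<phi> = A"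
      using exists_nat_quotient[OF G(2) A.A_normal] by blast
    interpret Q: group_hom G Q \<phi> by (rule Q(1))
    interpret Q: finite_epi G Q \<phi> by unfold_locales (rule G(2), rule Q(2))
    have ord: "order G = order Q * p ^ n" using Q.order_eq Q(3) A.card_A by simp
    have pn: "p ^ n > 1" using one_less_power[OF prime_gt_1_nat[OF A.p] A.n_pos] .
    have "p dvd order G" using ord A.n_pos by simp
    hence p\<pi>: "p \<in> \<pi>" using \<pi>(2) A.p by (auto simp: prime_divs_def)
    have Qpos: "order Q > 0" using Q.finQ Q.H.order_gt_0_iff_finite by blast
    have lt: "order Q < order G" unfolding ord using Qpos pn by simp
    have divs: "prime_divs (order Q) \<subseteq> \<pi>" using \<pi>(2) ord by (auto simp: prime_divs_def)
    have \<epsilon>Q: "comm_group Q \<or> q dvd order (abelianization Q) \<or> coprime (q - 1) (order (abelianization Q))"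
      if "q \<in> \<pi>" "\<epsilon> q = 0" for q
      using d(4)[OF that] der Q.comm_group_image Q.order_abelianization Q(3) by metis
    have sylQ: "sylow_subgroup Q q (\<phi> ` P)" "card (zp_chars Q q (\<phi> ` P) {}) \<le> card (zp_chars G q P A)"
      if "q \<in> \<pi>" "sylow_subgroup G q P" for q P
      using Q.sylow_image[OF d(1)[OF that(1)] that(2)] Q.card_zp_chars_image[of P q] that(2) Q(3)
      by (auto simp: sylow_subgroup_def)
    have le0: "card (zp_chars G q P A) \<le> card (zp_chars G q P {})" if "sylow_subgroup G q P" for q P
    proof (rule card_mono[OF finite_zp_chars])
      show "finite P" using that G(2) finite_subset subgroup.subset unfolding sylow_subgroup_def by blast
    qed (rule zp_chars_antimono, simp)
    have syl: "\<exists>P. sylow_subgroup G q P \<and> card (zp_chars G q P {}) \<le> q ^ e q" if "q \<in> \<pi>" for q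
      using data that by (auto simp: gen_data_def)
    have base: "\<exists>P. sylow_subgroup Q q P \<and> card (zp_chars Q q P {}) \<le> q ^ e q" if q: "q \<in> \<pi>" for q
    proof -
      obtain P where P: "sylow_subgroup G q P" "card (zp_chars G q P {}) \<le> q ^ e q" using syl[OF q] by blast
      thus ?thesis using sylQ[OF q P(1)] le0[OF P(1)] by (meson le_trans)
    qed
    note step = A.gen_prob_step[OF Q, of k]
    show ?thesis
    \<comment> \<open>Without complements every lift of a generating tuple generates and
      \<open>e\<close> is kept. Otherwise \<open>e\<close> drops by one at p, and the factor with j
      = e p - 1 pays for the complements.\<close>
    proof (cases "A.compl = {}")
      case True
      have "gen_data Q \<pi> \<epsilon> e k" unfolding gen_data_def using \<pi> divs d(1-3) \<epsilon>Q base by blast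
      hence "gen_prob Q k \<ge> gen_bound \<pi> \<epsilon> e k"
        using IH[OF Q.H.is_group Q.finQ Q.solvable_image[OF G(3)] lt] by blast
      thus ?thesis using step True by simp
    next
      case False
      then obtain K where K: "K \<in> A.compl" by blast
      obtain P where P: "sylow_subgroup G p P" "card (zp_chars G p P {}) \<le> p ^ e p" using syl[OF p\<pi>] by blast
      have bd: "e p \<ge> 1" "card (zp_chars G p P A) \<le> p ^ (e p - 1)"
        "card A.compl * p ^ k \<le> (p ^ n) ^ k * p ^ (e p - 1 + \<epsilon> p)"
        by (rule A.card_compl_bound[OF G(3) P K d(3)[OF p\<pi>] d(2)[OF p\<pi>] _ der], erule d(4)[OF p\<pi>])+
      let ?e = "e(p := e p - 1)"
      have syl': "\<exists>P. sylow_subgroup Q q P \<and> card (zp_chars Q q P {}) \<le> q ^ ?e q" if q: "q \<in> \<pi>" for q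
      proof (cases "q = p")
        case True
        thus ?thesis using sylQ[OF p\<pi> P(1)] bd(2) by (auto intro!: exI[of _ "\<phi> ` P"])
      next
        case False
        thus ?thesis using base[OF q] by simp
      qed
      have d3: "?e q + \<epsilon> q \<le> k" if "q \<in> \<pi>" for q using d(3)[OF that] by auto
      have "gen_data Q \<pi> \<epsilon> ?e k" unfolding gen_data_def using \<pi> divs d(1,2) d3 \<epsilon>Q syl' by blast
      hence IH': "gen_prob Q k \<ge> gen_bound \<pi> \<epsilon> ?e k"
        using IH[OF Q.H.is_group Q.finQ Q.solvable_image[OF G(3)] lt] by blast
      define t where "t = e p - 1 + \<epsilon> p"
      have t: "t \<le> k" using d(3)[OF p\<pi>] by (simp add: t_def)
      have p0: "real p > 0" using prime_gt_0_nat[OF A.p] by simp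
      have "real (card A.compl * p ^ k) \<le> real ((p ^ n) ^ k * p ^ t)" using bd(3) unfolding t_def of_nat_le_iff .
      hence "real (card A.compl) * real p ^ k \<le> real (card A) ^ k * real p ^ t" using A.card_A by simp
      moreover have "real (card A) ^ k > 0" using A.card_A p0 by simp
      ultimately have "real (card A.compl) / real (card A) ^ k \<le> real p ^ t / real p ^ k"
        using p0 by (simp add: divide_simps mult.commute)
      moreover have nn: "0 \<le> 1 - real p ^ t / real p ^ k" using gen_bound_factor(1)[OF A.p, of t 0 k] t by simp
      ultimately have 1: "1 - real p ^ t / real p ^ k \<le> 1 - real (card A.compl) / real (card A) ^ k" by simp
      have "gen_bound \<pi> \<epsilon> e k = gen_bound \<pi> \<epsilon> ?e k * (1 - real p ^ t / real p ^ k)"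
        unfolding t_def by (rule gen_bound_step[of \<pi> p e, OF \<pi>(1) p\<pi> bd(1)])
      also have "\<dots> \<le> gen_prob Q k * (1 - real (card A.compl) / real (card A) ^ k)"
      proof (rule mult_mono[OF IH' 1 _ nn])
        show "0 \<le> gen_prob Q k" by (simp add: gen_prob_def)
      qed
      also have "\<dots> \<le> gen_prob G k" by (rule step)
      finally show ?thesis .
    qed
  qed
qed

lemma gen_prob_lower:
  fixes G :: "('a, 'b) monoid_scheme"
  assumes G: "group G" "finite (carrier G)" "solvable G" and data: "gen_data G \<pi> \<epsilon> e k"
  shows "gen_prob G k \<ge> gen_bound \<pi> \<epsilon> e k"
proof -
  have nat: "gen_prob Q k \<ge> gen_bound \<pi> \<epsilon> e' k"
    if "group Q" "finite (carrier Q)" "solvable Q" "gen_data Q \<pi> \<epsilon> e' k" for Q :: "nat monoid" and e'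
    using that
  proof (induction "order Q" arbitrary: Q e' rule: less_induct)
    case less
    show ?case
      by (rule gen_prob_lower_step[OF less.prems]) (rule less.hyps)
  qed
  show ?thesis by (rule gen_prob_lower_step[OF G data]) (rule nat)
qed

section \<open>Independent columns\<close>

locale coord_data =
  fixes \<pi> :: "nat set" and \<epsilon> r u :: "nat \<Rightarrow> nat"
  assumes fin_pi: "finite \<pi>"
    and prime_pi: "p \<in> \<pi> \<Longrightarrow> Factorial_Ring.prime p"
    and eps_le: "p \<in> \<pi> \<Longrightarrow> \<epsilon> p \<le> 1"
    and r_pi: "p \<in> \<pi> \<Longrightarrow> \<epsilon> p = 1 \<Longrightarrow> r p \<in> \<pi> \<and> \<epsilon> (r p) = 0"
begin

text \<open>The multiplicities \<open>e\<close> are a parameter because the count below removes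
  coordinates one at a time.\<close>

definition J :: "(nat \<Rightarrow> nat) \<Rightarrow> (nat \<times> nat) set" where "J e = {(p, s). p \<in> \<pi> \<and> s < e p}"

definition lam :: "nat \<Rightarrow> (nat \<times> nat \<Rightarrow> nat) \<Rightarrow> nat" where
  "lam p x = (if \<epsilon> p = 0 then 1 else u p ^ x (r p, 0))"

definition form :: "(nat \<Rightarrow> nat) \<Rightarrow> nat \<Rightarrow> (nat \<Rightarrow> int) \<Rightarrow> int \<Rightarrow> (nat \<times> nat \<Rightarrow> nat) \<Rightarrow> int" where
  "form e p \<alpha> \<beta> x = (\<Sum>s<e p. \<alpha> s * int (x (p, s))) + \<beta> * (int (lam p x) - 1)"

text \<open>The maps \<open>form e p \<alpha> \<beta>\<close> are crossed homomorphisms, so a generating tuple admits no nontrivial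
  relation between its columns and the column of \<open>\<lambda>\<^sub>p - 1\<close>.\<close>

definition indep :: "nat \<Rightarrow> (nat \<Rightarrow> nat) \<Rightarrow> (nat \<times> nat \<Rightarrow> nat \<Rightarrow> nat) \<Rightarrow> bool" where
  "indep k e M \<longleftrightarrow> (\<forall>p\<in>\<pi>. \<forall>\<alpha> \<beta>. (\<forall>i<k. int p dvd form e p \<alpha> \<beta> (\<lambda>j. M j i))
      \<longrightarrow> (\<forall>s<e p. int p dvd \<alpha> s) \<and> (\<epsilon> p = 1 \<and> e (r p) > 0 \<longrightarrow> int p dvd \<beta>))"

text \<open>A k-tuple of group elements is stored by columns: \<open>M j\<close> lists the j-th
  coordinates of the k elements.\<close>

definition cols :: "nat \<Rightarrow> (nat \<Rightarrow> nat) \<Rightarrow> (nat \<times> nat \<Rightarrow> nat \<Rightarrow> nat) set" where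
  "cols k e = {M \<in> \<Pi>\<^sub>E (p, s)\<in>J e. {..<k} \<rightarrow>\<^sub>E {..<p}. indep k e M}"

lemma indepD:
  assumes "indep k e M" "p \<in> \<pi>" "\<And>i. i < k \<Longrightarrow> int p dvd form e p \<alpha> \<beta> (\<lambda>j. M j i)"
  shows "s < e p \<Longrightarrow> int p dvd \<alpha> s" "\<epsilon> p = 1 \<Longrightarrow> e (r p) > 0 \<Longrightarrow> int p dvd \<beta>"
proof -
  have "(\<forall>s<e p. int p dvd \<alpha> s) \<and> (\<epsilon> p = 1 \<and> e (r p) > 0 \<longrightarrow> int p dvd \<beta>)"
    using assms(1)[unfolded indep_def, rule_format, OF assms(2)] assms(3) by blast
  thus "s < e p \<Longrightarrow> int p dvd \<alpha> s" "\<epsilon> p = 1 \<Longrightarrow> e (r p) > 0 \<Longrightarrow> int p dvd \<beta>" by blast+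
qed

lemma finite_J: "finite (J e)"
proof -
  have "J e = Sigma \<pi> (\<lambda>p. {..<e p})" by (auto simp: J_def)
  thus ?thesis using fin_pi by simp
qed

lemma finite_cols: "finite (cols k e)"
  unfolding cols_def by (rule finite_subset[of _ "\<Pi>\<^sub>E (p, s)\<in>J e. {..<k} \<rightarrow>\<^sub>E {..<p}"])
    (auto intro!: finite_PiE finite_J split: prod.splits)

text \<open>The scalar for a twisted q is read off the coordinate \<open>(r q, 0)\<close>, which
  must outlive the coordinates at q. Hence an untwisted coordinate is removed only when no twisted
  one is left.\<close>

lemma decrement_r_pos:
  assumes p: "p \<in> \<pi>" "e p = Suc t"
    and inv: "\<And>q. q \<in> \<pi> \<Longrightarrow> \<epsilon> q = 1 \<Longrightarrow> e q > 0 \<Longrightarrow> e (r q) > 0"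
    and last: "\<epsilon> p = 0 \<Longrightarrow> (\<forall>q\<in>\<pi>. \<epsilon> q = 1 \<longrightarrow> e q = 0)"
    and q: "q \<in> \<pi>" "\<epsilon> q = 1" "(e(p := t)) q > 0"
  shows "(e(p := t)) (r q) > 0"
proof (cases "\<epsilon> p = 0")
  case True
  hence "e q = 0" using last q by blast
  moreover have "q \<noteq> p" using True q by auto
  ultimately show ?thesis using q by simp
next
  case False
  have "r q \<noteq> p" using r_pi[OF q(1,2)] False by auto
  moreover have "e q > 0" using q p by (auto split: if_splits)
  ultimately show ?thesis using inv[OF q(1,2)] by simp
qed

text \<open>With the other columns given, the column \<open>(p, t)\<close> must avoid the span of
  the t earlier columns at p and, for twisted p, of the column of \<lambda>_p - 1. These vectors are
  independent modulo p, so the span has p^(t + \<epsilon> p) elements.\<close>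

lemma card_cols_step:
  assumes p: "p \<in> \<pi>" "e p = Suc t"
    and inv: "\<And>q. q \<in> \<pi> \<Longrightarrow> \<epsilon> q = 1 \<Longrightarrow> e q > 0 \<Longrightarrow> e (r q) > 0"
    and last: "\<epsilon> p = 0 \<Longrightarrow> (\<forall>q\<in>\<pi>. \<epsilon> q = 1 \<longrightarrow> e q = 0)"
  shows "card (cols k e) \<le> card (cols k (e(p := t))) * (p ^ k - p ^ (t + \<epsilon> p))"
proof (rule card_le_fibres[of _ _ "\<lambda>M. restrict M (J (e(p := t)))"])
  let ?e = "e(p := t)"
  have Je: "J e = insert (p, t) (J ?e)" using p by (auto simp: J_def less_Suc_eq split: if_splits)
  have pr: "Factorial_Ring.prime p" by (rule prime_pi[OF p(1)])
  have inv': "?e (r q) > 0" if "q \<in> \<pi>" "\<epsilon> q = 1" "?e q > 0" for q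
    by (rule decrement_r_pos[OF p _ _ that]) (erule (2) inv, erule last)
  have form_restrict: "form ?e q \<alpha> \<beta> (\<lambda>j. restrict M (J ?e) j i) = form ?e q \<alpha> \<beta> (\<lambda>j. M j i)"
    if "q \<in> \<pi>" "\<epsilon> q = 1 \<Longrightarrow> ?e (r q) > 0" for q \<alpha> \<beta> i and M :: "nat \<times> nat \<Rightarrow> nat \<Rightarrow> nat"
  proof -
    have "lam q (\<lambda>j. restrict M (J ?e) j i) = lam q (\<lambda>j. M j i)"
    proof (cases "\<epsilon> q = 0")
      case False
      hence "\<epsilon> q = 1" using eps_le[OF that(1)] by simp
      hence "(r q, 0) \<in> J ?e" using that r_pi by (simp add: J_def)
      thus ?thesis by (simp add: lam_def)
    qed (simp add: lam_def)
    moreover have "restrict M (J ?e) (q, s) i = M (q, s) i" if "s < ?e q" for s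
      using that \<open>q \<in> \<pi>\<close> by (simp add: J_def)
    ultimately show ?thesis unfolding form_def by simp
  qed
  have form_p: "form e p \<alpha> \<beta> x = form ?e p \<alpha> \<beta> x + \<alpha> t * int (x (p, t))" for \<alpha> \<beta> x
    using p(2) by (simp add: form_def)
  show "finite (cols k e)" "finite (cols k ?e)" by (rule finite_cols)+
  show "(\<lambda>M. restrict M (J ?e)) ` cols k e \<subseteq> cols k ?e"
  proof (rule image_subsetI)
    fix M assume M: "M \<in> cols k e"
    have "restrict M (J ?e) \<in> (\<Pi>\<^sub>E (p, s)\<in>J ?e. {..<k} \<rightarrow>\<^sub>E {..<p})"
      using M Je by (auto simp: cols_def PiE_iff)
    moreover have "indep k ?e (restrict M (J ?e))"
      unfolding indep_def
    proof (intro ballI allI impI)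
      fix q \<alpha> \<beta> assume q: "q \<in> \<pi>"
        and z: "\<forall>i<k. int q dvd form ?e q \<alpha> \<beta> (\<lambda>j. restrict M (J ?e) j i)"
      show "(\<forall>s<?e q. int q dvd \<alpha> s) \<and> (\<epsilon> q = 1 \<and> ?e (r q) > 0 \<longrightarrow> int q dvd \<beta>)"
      proof (cases "\<epsilon> q = 1 \<and> ?e (r q) = 0")
        case True
        hence "?e q = 0" using inv'[OF q] by (cases "?e q = 0") (auto simp del: fun_upd_apply)
        thus ?thesis using True by simp
      next
        case False
        have ok: "?e (r q) > 0" if "\<epsilon> q = 1" using that False by (auto simp del: fun_upd_apply)
        have z': "\<forall>i<k. int q dvd form ?e q \<alpha> \<beta> (\<lambda>j. M j i)" using z form_restrict[OF q ok] by simp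
        \<comment> \<open>A relation between the retained columns is one between all columns, with
          coefficient 0 at the removed one.\<close>
        define \<alpha>' where "\<alpha>' = (if q = p then \<alpha>(t := 0) else \<alpha>)"
        have "form e q \<alpha>' \<beta> x = form ?e q \<alpha> \<beta> x" for x
        proof (cases "q = p")
          case True
          have "form ?e p (\<alpha>(t := 0)) \<beta> x = form ?e p \<alpha> \<beta> x" unfolding form_def by simp
          thus ?thesis using form_p True by (simp add: \<alpha>'_def)
        qed (simp add: form_def \<alpha>'_def)
        hence z'': "int q dvd form e q \<alpha>' \<beta> (\<lambda>j. M j i)" if "i < k" for i using z' that by simp
        have ind: "indep k e M" using M by (simp add: cols_def)
        have *: "(\<forall>s<e q. int q dvd \<alpha>' s) \<and> (\<epsilon> q = 1 \<and> e (r q) > 0 \<longrightarrow> int q dvd \<beta>)"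
          using indepD[OF ind q z''] by blast
        have "int q dvd \<alpha> s" if s: "s < ?e q" for s
        proof -
          have "s < e q" using s p by (auto split: if_splits)
          moreover have "\<alpha>' s = \<alpha> s" using s by (auto simp: \<alpha>'_def)
          ultimately show ?thesis using * by metis
        qed
        moreover have "e (r q) > 0" if "?e (r q) > 0" using that p by (auto split: if_splits)
        ultimately show ?thesis using * by blast
      qed
    qed
    ultimately show "restrict M (J ?e) \<in> cols k ?e" by (simp add: cols_def)
  qed
  fix M' assume M': "M' \<in> cols k ?e"
  \<comment> \<open>Coefficients of the forbidden combinations. For \<open>\<epsilon> p = 0\<close>
    the second component can only be 0, so \<lambda>_p - 1 does not take part.\<close>
  define CC where "CC = ({..<t} \<rightarrow>\<^sub>E {..<p}) \<times> {..<p ^ \<epsilon> p}"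
  define c where "c = (\<lambda>(a::nat \<Rightarrow> nat, b::nat). \<lambda>i\<in>{..<k}.
      nat (form ?e p (\<lambda>s. int (a s)) (int b) (\<lambda>j. M' j i) mod int p))"
  have p0: "int p > 0" using prime_gt_0_nat[OF pr] by simp
  have okp: "?e (r p) > 0" if "\<epsilon> p = 1"
  proof -
    have "r p \<noteq> p" using r_pi[OF p(1) that] that by auto
    thus ?thesis using inv[OF p(1) that] p by simp
  qed
  have cardCC: "card CC = p ^ (t + \<epsilon> p)" by (simp add: CC_def card_PiE card_cartesian_product power_add)
  have inj_c: "inj_on c CC"
  proof (rule inj_onI, clarify)
    fix a b a' b' assume ab: "(a, b) \<in> CC" "(a', b') \<in> CC" and eq: "c (a, b) = c (a', b')"
    have "int p dvd form ?e p (\<lambda>s. int (a s) - int (a' s)) (int b - int b') (\<lambda>j. M' j i)" if i: "i < k" for i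
    proof -
      let ?x = "\<lambda>j. M' j i"
      have "nat (form ?e p (\<lambda>s. int (a s)) (int b) ?x mod int p) = nat (form ?e p (\<lambda>s. int (a' s)) (int b') ?x mod int p)"
        using fun_cong[OF eq, of i] i by (simp add: c_def)
      hence "form ?e p (\<lambda>s. int (a s)) (int b) ?x mod int p = form ?e p (\<lambda>s. int (a' s)) (int b') ?x mod int p"
        using p0 by (simp only: eq_nat_nat_iff pos_mod_sign)
      hence "int p dvd form ?e p (\<lambda>s. int (a s)) (int b) ?x - form ?e p (\<lambda>s. int (a' s)) (int b') ?x"
        by (simp add: mod_eq_dvd_iff)
      also have "form ?e p (\<lambda>s. int (a s)) (int b) ?x - form ?e p (\<lambda>s. int (a' s)) (int b') ?x
          = form ?e p (\<lambda>s. int (a s) - int (a' s)) (int b - int b') ?x"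
        by (simp add: form_def left_diff_distrib sum_subtractf)
      finally show ?thesis .
    qed
    note z = this
    have ind: "indep k ?e M'" using M' by (simp add: cols_def)
    have 1: "int p dvd int (a s) - int (a' s)" if "s < t" for s
      using indepD(1)[OF ind p(1) z, of s] that by simp
    have 2: "int p dvd int b - int b'" if "\<epsilon> p = 1"
      using indepD(2)[OF ind p(1) z that okp[OF that]] .
    have small: "x = y" if "int p dvd int x - int y" "x < p" "y < p" for x y :: nat
      using that by (metis mod_eq_dvd_iff mod_less nat_int_comparison(1) zmod_int)
    have "a s = a' s" for s
    proof (cases "s < t")
      case True
      thus ?thesis using 1 ab by (intro small) (auto simp: CC_def PiE_iff)
    next
      case False
      thus ?thesis using ab by (auto simp: CC_def PiE_iff extensional_def)
    qed
    moreover have "b = b'"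
    proof (cases "\<epsilon> p = 0")
      case False
      hence "\<epsilon> p = 1" using eps_le[OF p(1)] by simp
      thus ?thesis using 2 ab by (intro small) (auto simp: CC_def)
    qed (use ab in \<open>simp add: CC_def\<close>)
    ultimately show "a = a' \<and> b = b'" by blast
  qed
  have c_col: "c ` CC \<subseteq> {..<k} \<rightarrow>\<^sub>E {..<p}" using p0 by (auto simp: c_def nat_less_iff split: if_splits)
  have fincol: "finite ({..<k} \<rightarrow>\<^sub>E {..<p})" by (intro finite_PiE) auto
  have "card {M \<in> cols k e. restrict M (J ?e) = M'} \<le> card (({..<k} \<rightarrow>\<^sub>E {..<p}) - c ` CC)"
  proof (rule card_inj_on_le[of "\<lambda>M. M (p, t)"])
    show "finite (({..<k} \<rightarrow>\<^sub>E {..<p}) - c ` CC)" using fincol by simp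
    show "inj_on (\<lambda>M. M (p, t)) {M \<in> cols k e. restrict M (J ?e) = M'}"
    proof (rule inj_onI)
      fix M N assume M: "M \<in> {M \<in> cols k e. restrict M (J ?e) = M'}" and N: "N \<in> {M \<in> cols k e. restrict M (J ?e) = M'}"
        and eq: "M (p, t) = N (p, t)"
      show "M = N"
      proof
        fix j consider "j = (p, t)" | "j \<in> J ?e" | "j \<notin> J e" using Je by blast
        thus "M j = N j"
        proof cases
          case 2
          have "restrict M (J ?e) j = restrict N (J ?e) j" using M N by simp
          thus ?thesis using 2 by simp
        next
          case 3
          thus ?thesis using M N by (cases j) (auto simp: cols_def PiE_iff extensional_def)
        qed (use eq in simp)
      qed
    qed
    show "(\<lambda>M. M (p, t)) ` {M \<in> cols k e. restrict M (J ?e) = M'} \<subseteq> ({..<k} \<rightarrow>\<^sub>E {..<p}) - c ` CC"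
    proof (rule image_subsetI, rule DiffI)
      fix M assume M: "M \<in> {M \<in> cols k e. restrict M (J ?e) = M'}"
      show "M (p, t) \<in> {..<k} \<rightarrow>\<^sub>E {..<p}" using M Je by (auto simp: cols_def PiE_iff)
      show "M (p, t) \<notin> c ` CC"
      proof
        assume "M (p, t) \<in> c ` CC"
        then obtain a b where ab: "(a, b) \<in> CC" "M (p, t) = c (a, b)" by auto
        \<comment> \<open>Coefficient -1 at the new column turns a forbidden value into a relation;
          independence would then make p divide -1.\<close>
        define \<alpha> where "\<alpha> = (\<lambda>s. if s = t then - 1 else int (a s))"
        have "int p dvd form e p \<alpha> (int b) (\<lambda>j. M j i)" if i: "i < k" for i
        proof -
          have 1: "form ?e p \<alpha> (int b) (\<lambda>j. M j i) = form ?e p (\<lambda>s. int (a s)) (int b) (\<lambda>j. M' j i)"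
          proof -
            have "form ?e p \<alpha> (int b) (\<lambda>j. M j i) = form ?e p (\<lambda>s. int (a s)) (int b) (\<lambda>j. M j i)"
              unfolding form_def \<alpha>_def by simp
            also have "\<dots> = form ?e p (\<lambda>s. int (a s)) (int b) (\<lambda>j. restrict M (J ?e) j i)"
              by (rule form_restrict[OF p(1) okp, symmetric])
            also have "restrict M (J ?e) = M'" using M by blast
            finally show ?thesis .
          qed
          have "int (M (p, t) i) = form ?e p (\<lambda>s. int (a s)) (int b) (\<lambda>j. M' j i) mod int p"
            using ab(2) i p0 by (simp add: c_def)
          hence "form e p \<alpha> (int b) (\<lambda>j. M j i) = form ?e p (\<lambda>s. int (a s)) (int b) (\<lambda>j. M' j i)
              - form ?e p (\<lambda>s. int (a s)) (int b) (\<lambda>j. M' j i) mod int p"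
            using form_p[of \<alpha> "int b" "\<lambda>j. M j i"] 1 by (simp add: \<alpha>_def)
          thus ?thesis by (simp add: minus_mod_eq_mult_div)
        qed
        note z = this
        have "indep k e M" using M by (simp add: cols_def)
        from indepD(1)[OF this p(1) z, of t] have "int p dvd - 1" using p(2) by (simp add: \<alpha>_def)
        thus False using prime_gt_1_nat[OF pr] by simp
      qed
    qed
  qed
  also have "\<dots> = card ({..<k} \<rightarrow>\<^sub>E {..<p}) - card (c ` CC)"
    by (rule card_Diff_subset[OF finite_subset[OF c_col fincol] c_col])
  also have "\<dots> = p ^ k - p ^ (t + \<epsilon> p)" using card_image[OF inj_c] cardCC by (simp add: card_PiE)
  finally show "card {M \<in> cols k e. restrict M (J ?e) = M'} \<le> p ^ k - p ^ (t + \<epsilon> p)" .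
qed

text \<open>A twisted coordinate is removed as long as there is one. Subtraction is truncated: a
  factor with s + \<epsilon> p \<ge> k is 0, which later yields the vanishing of the probability for
  small k.\<close>

lemma card_cols_le:
  assumes inv: "\<And>q. q \<in> \<pi> \<Longrightarrow> \<epsilon> q = 1 \<Longrightarrow> e q > 0 \<Longrightarrow> e (r q) > 0"
  shows "card (cols k e) \<le> (\<Prod>p\<in>\<pi>. \<Prod>s<e p. p ^ k - p ^ (s + \<epsilon> p))"
  using inv
proof (induction "\<Sum>p\<in>\<pi>. e p" arbitrary: e rule: less_induct)
  case less
  show ?case
  proof (cases "\<forall>p\<in>\<pi>. e p = 0")
    case True
    hence "J e = {}" by (auto simp: J_def)
    hence "cols k e \<subseteq> {\<lambda>x. undefined}" by (auto simp: cols_def)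
    hence "card (cols k e) \<le> 1" using card_mono[of "{\<lambda>x. undefined}" "cols k e"] by simp
    thus ?thesis using True by simp
  next
    case False
    obtain p where p: "p \<in> \<pi>" "e p > 0" and last: "\<epsilon> p = 0 \<Longrightarrow> \<forall>q\<in>\<pi>. \<epsilon> q = 1 \<longrightarrow> e q = 0"
    proof (cases "\<exists>q\<in>\<pi>. \<epsilon> q = 1 \<and> e q > 0")
      case True
      then obtain q where "q \<in> \<pi>" "\<epsilon> q = 1" "e q > 0" by blast
      thus ?thesis using that[of q] by simp
    next
      case no: False
      obtain q where "q \<in> \<pi>" "e q > 0" using False by blast
      thus ?thesis using that[of q] no by auto
    qed
    obtain t where t: "e p = Suc t" using p(2) by (cases "e p") auto
    let ?e = "e(p := t)"
    let ?f = "\<lambda>e q. \<Prod>s<e q. q ^ k - q ^ (s + \<epsilon> q)"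
    have sums: "(\<Sum>q\<in>\<pi>. e q) = e p + (\<Sum>q\<in>\<pi> - {p}. e q)" "(\<Sum>q\<in>\<pi>. ?e q) = ?e p + (\<Sum>q\<in>\<pi> - {p}. ?e q)"
      by (rule sum.remove[OF fin_pi p(1)])+
    moreover have "(\<Sum>q\<in>\<pi> - {p}. ?e q) = (\<Sum>q\<in>\<pi> - {p}. e q)" by (rule sum.cong) auto
    ultimately have lt: "(\<Sum>q\<in>\<pi>. ?e q) < (\<Sum>q\<in>\<pi>. e q)" using t by simp
    have inv': "?e (r q) > 0" if "q \<in> \<pi>" "\<epsilon> q = 1" "?e q > 0" for q
      by (rule decrement_r_pos[OF p(1) t _ _ that]) (erule (2) less.prems, erule last)
    have "card (cols k e) \<le> card (cols k ?e) * (p ^ k - p ^ (t + \<epsilon> p))"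
      by (rule card_cols_step[OF p(1) t less.prems last])
    also have "\<dots> \<le> (\<Prod>q\<in>\<pi>. ?f ?e q) * (p ^ k - p ^ (t + \<epsilon> p))"
      using less.hyps[OF lt inv'] by (rule mult_le_mono1)
    also have "(\<Prod>q\<in>\<pi>. ?f ?e q) = ?f ?e p * (\<Prod>q\<in>\<pi> - {p}. ?f ?e q)" by (rule prod.remove[OF fin_pi p(1)])
    also have "(\<Prod>q\<in>\<pi> - {p}. ?f ?e q) = (\<Prod>q\<in>\<pi> - {p}. ?f e q)" by (rule prod.cong) auto
    also have "?f ?e p * (\<Prod>q\<in>\<pi> - {p}. ?f e q) * (p ^ k - p ^ (t + \<epsilon> p)) = ?f e p * (\<Prod>q\<in>\<pi> - {p}. ?f e q)"
      using t by (simp add: mult.commute mult.left_commute)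
    also have "\<dots> = (\<Prod>q\<in>\<pi>. ?f e q)" by (rule prod.remove[OF fin_pi p(1), symmetric])
    finally show ?thesis .
  qed
qed

end

section \<open>A supersolvable group given by coordinates\<close>

lemma (in group) prime_order_cyclic:
  assumes "Factorial_Ring.prime (order G)"
  shows "cyclic_group G"
proof -
  have fin: "finite (carrier G)" using prime_gt_0_nat[OF assms] order_gt_0_iff_finite by simp
  have "carrier G \<noteq> {\<one>}" using assms by (auto simp: order_def)
  then obtain x where x: "x \<in> carrier G" "x \<noteq> \<one>" by blast
  have s: "subgroup (generate G {x}) G" using x by (intro generate_is_subgroup) auto
  have "card (generate G {x}) dvd order G" using lagrange[OF s] by (metis dvd_triv_right)
  moreover have "card (generate G {x}) \<noteq> 1"
  proof
    assume "card (generate G {x}) = 1"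
    then obtain z where z: "generate G {x} = {z}" by (auto simp: card_1_singleton_iff)
    have "x \<in> generate G {x}" "\<one> \<in> generate G {x}" by (auto intro: generate.intros)
    thus False using z x by auto
  qed
  ultimately have "card (generate G {x}) = card (carrier G)"
    using assms unfolding prime_nat_iff order_def by blast
  hence "generate G {x} = carrier G" using card_subset_eq[OF fin subgroup.subset[OF s]] by simp
  moreover have "generate G {x} = range (\<lambda>n::int. x [^] n)" using generate_pow[OF x(1)] by auto
  ultimately show ?thesis using cyclic_group x(1) by blast
qed

text \<open>The coordinates \<open>(p, s)\<close> with \<open>\<epsilon> p = 0\<close> describe the acting abelian group \<open>T\<close>, those with
  \<open>\<epsilon> p = 1\<close> the normal subgroup \<open>V\<close>, on whose \<open>p\<close>-part \<open>x\<close> acts by the scalar \<open>lam p (co x)\<close>.\<close>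

locale coord_group = coord_data \<pi> \<epsilon> r u + group H
  for \<pi> \<epsilon> r u and H :: "nat monoid" (structure) +
  fixes \<delta> :: "nat \<Rightarrow> nat" and co :: "nat \<Rightarrow> nat \<times> nat \<Rightarrow> nat"
  assumes \<delta>_r: "p \<in> \<pi> \<Longrightarrow> \<epsilon> p = 1 \<Longrightarrow> \<delta> (r p) > 0"
    and u_pow: "p \<in> \<pi> \<Longrightarrow> \<epsilon> p = 1 \<Longrightarrow> [u p ^ r p = 1] (mod p)"
    and u_ne: "p \<in> \<pi> \<Longrightarrow> \<epsilon> p = 1 \<Longrightarrow> [u p \<noteq> 1] (mod p)"
    and bij: "bij_betw co (carrier H) (\<Pi>\<^sub>E (p, s)\<in>J \<delta>. {..<p})"
    and co_mult: "x \<in> carrier H \<Longrightarrow> y \<in> carrier H \<Longrightarrow> (p, s) \<in> J \<delta> \<Longrightarrow>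
        co (x \<otimes> y) (p, s) = (co x (p, s) + lam p (co x) * co y (p, s)) mod p"
    and co_one: "j \<in> J \<delta> \<Longrightarrow> co \<one> j = 0"
begin

lemma finH: "finite (carrier H)"
proof -
  have "finite (\<Pi>\<^sub>E (p, s)\<in>J \<delta>. {..<p})"
    by (intro finite_PiE finite_J) (auto split: prod.splits)
  thus ?thesis using bij bij_betw_finite by blast
qed

lemma co_lt: "x \<in> carrier H \<Longrightarrow> (p, s) \<in> J \<delta> \<Longrightarrow> co x (p, s) < p"
  using bij_betwE[OF bij] by (fastforce simp: PiE_iff)

lemma co_eqI:
  assumes "x \<in> carrier H" "y \<in> carrier H" "\<And>j. j \<in> J \<delta> \<Longrightarrow> co x j = co y j"
  shows "x = y"
proof -
  have "co x = co y"
  proof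
    fix j show "co x j = co y j"
    proof (cases "j \<in> J \<delta>")
      case False
      thus ?thesis using bij_betwE[OF bij] assms(1,2) by (cases j) (auto simp: PiE_iff extensional_def)
    qed (use assms in simp)
  qed
  thus ?thesis using bij assms by (auto simp: bij_betw_def dest: inj_onD)
qed

lemma co_ex:
  assumes "\<And>p s. (p, s) \<in> J \<delta> \<Longrightarrow> v (p, s) < p"
  shows "\<exists>x\<in>carrier H. \<forall>j\<in>J \<delta>. co x j = v j"
proof -
  have "restrict v (J \<delta>) \<in> (\<Pi>\<^sub>E (p, s)\<in>J \<delta>. {..<p})" using assms by (auto simp: PiE_iff)
  hence "restrict v (J \<delta>) \<in> co ` carrier H" using bij by (simp add: bij_betw_def)
  then obtain x where x: "x \<in> carrier H" "restrict v (J \<delta>) = co x" by blast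
  have "co x j = v j" if "j \<in> J \<delta>" for j using fun_cong[OF x(2), of j] that by simp
  thus ?thesis using x(1) by blast
qed

lemma r_J: "p \<in> \<pi> \<Longrightarrow> \<epsilon> p = 1 \<Longrightarrow> (r p, 0) \<in> J \<delta>"
  using r_pi \<delta>_r by (simp add: J_def)

lemma eps_cases: "p \<in> \<pi> \<Longrightarrow> \<epsilon> p = 0 \<or> \<epsilon> p = 1" using eps_le[of p] by auto

lemma lam_one: "p \<in> \<pi> \<Longrightarrow> lam p (co \<one>) = 1"
  using eps_cases[of p] r_J[of p] co_one by (auto simp: lam_def)

text \<open>The prime \<open>r p\<close> is untwisted, so the coordinate \<open>(r p, 0)\<close> is
  additive modulo \<open>r p\<close>; \<open>u_pow\<close> allows the exponent to be reduced by this
  modulus.\<close>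

lemma lam_mult:
  assumes p: "p \<in> \<pi>" and x: "x \<in> carrier H" and y: "y \<in> carrier H"
  shows "[lam p (co (x \<otimes> y)) = lam p (co x) * lam p (co y)] (mod p)"
proof (cases "\<epsilon> p = 0")
  case False
  hence e: "\<epsilon> p = 1" using eps_cases[OF p] by simp
  let ?a = "co x (r p, 0)" and ?b = "co y (r p, 0)"
  have "co (x \<otimes> y) (r p, 0) = (?a + ?b) mod r p"
    using co_mult[OF x y r_J[OF p e]] r_pi[OF p e] by (simp add: lam_def)
  moreover have "[u p ^ ((?a + ?b) mod r p) = u p ^ (?a + ?b)] (mod p)"
  proof -
    have "u p ^ (?a + ?b) = (u p ^ r p) ^ ((?a + ?b) div r p) * u p ^ ((?a + ?b) mod r p)"
      by (simp flip: power_mult power_add)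
    moreover have "[(u p ^ r p) ^ ((?a + ?b) div r p) * u p ^ ((?a + ?b) mod r p) = 1 ^ ((?a + ?b) div r p) * u p ^ ((?a + ?b) mod r p)] (mod p)"
      by (intro cong_mult cong_pow u_pow[OF p e] cong_refl)
    ultimately show ?thesis by (simp add: cong_sym)
  qed
  ultimately show ?thesis using e by (simp add: lam_def power_add)
qed (simp add: lam_def)

text \<open>For the linear part this is the multiplication rule of the coordinates. For the rest,
  \<lambda>_p - 1 is a coboundary: \<lambda>(x) \<lambda>(y) - 1 = (\<lambda>(x) - 1) + \<lambda>(x)
  (\<lambda>(y) - 1).\<close>

lemma form_mult:
  assumes p: "p \<in> \<pi>" and x: "x \<in> carrier H" and y: "y \<in> carrier H"
  shows "[form \<delta> p \<alpha> \<beta> (co (x \<otimes> y)) = form \<delta> p \<alpha> \<beta> (co x) + int (lam p (co x)) * form \<delta> p \<alpha> \<beta> (co y)] (mod int p)"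
proof -
  let ?l = "int (lam p (co x))"
  have "[(\<Sum>s<\<delta> p. \<alpha> s * int (co (x \<otimes> y) (p, s))) = (\<Sum>s<\<delta> p. \<alpha> s * (int (co x (p, s)) + ?l * int (co y (p, s))))] (mod int p)"
  proof (intro cong_sum cong_mult cong_refl)
    fix s assume "s \<in> {..<\<delta> p}"
    hence "(p, s) \<in> J \<delta>" using p by (simp add: J_def)
    thus "[int (co (x \<otimes> y) (p, s)) = int (co x (p, s)) + ?l * int (co y (p, s))] (mod int p)"
      using co_mult[OF x y] by (simp add: cong_def zmod_int)
  qed
  moreover have "[int (lam p (co (x \<otimes> y))) = ?l * int (lam p (co y))] (mod int p)"
    using lam_mult[OF p x y] by (metis cong_int_iff of_nat_mult)
  hence "[\<beta> * (int (lam p (co (x \<otimes> y))) - 1) = \<beta> * (?l * int (lam p (co y)) - 1)] (mod int p)"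
    by (intro cong_mult cong_diff cong_refl)
  ultimately have "[form \<delta> p \<alpha> \<beta> (co (x \<otimes> y)) = (\<Sum>s<\<delta> p. \<alpha> s * (int (co x (p, s)) + ?l * int (co y (p, s))))
      + \<beta> * (?l * int (lam p (co y)) - 1)] (mod int p)"
    unfolding form_def by (rule cong_add)
  also have "(\<Sum>s<\<delta> p. \<alpha> s * (int (co x (p, s)) + ?l * int (co y (p, s)))) + \<beta> * (?l * int (lam p (co y)) - 1)
      = form \<delta> p \<alpha> \<beta> (co x) + ?l * form \<delta> p \<alpha> \<beta> (co y)"
    by (simp add: form_def algebra_simps sum.distrib sum_distrib_left)
  finally show ?thesis .
qed

lemma form_kernel_subgroup:
  assumes p: "p \<in> \<pi>"
  shows "subgroup {x \<in> carrier H. int p dvd form \<delta> p \<alpha> \<beta> (co x)} H"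
proof (rule subgroupI)
  let ?D = "\<lambda>x. form \<delta> p \<alpha> \<beta> (co x)"
  have pr: "Factorial_Ring.prime (int p)" using prime_pi[OF p] by simp
  have one: "?D \<one> = 0"
  proof -
    have "co \<one> (p, s) = 0" if "s < \<delta> p" for s using co_one[of "(p, s)"] that p by (simp add: J_def)
    thus ?thesis using lam_one[OF p] by (simp add: form_def)
  qed
  show "{x \<in> carrier H. int p dvd ?D x} \<noteq> {}" using one by (auto intro!: exI[of _ \<one>])
  show "x \<otimes> y \<in> {x \<in> carrier H. int p dvd ?D x}"
    if xy: "x \<in> {x \<in> carrier H. int p dvd ?D x}" "y \<in> {x \<in> carrier H. int p dvd ?D x}" for x y
  proof -
    have "int p dvd ?D x + int (lam p (co x)) * ?D y" using xy by simp
    hence "int p dvd ?D (x \<otimes> y)" using form_mult[OF p, of x y \<alpha> \<beta>] xy cong_dvd_iff by blast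
    thus ?thesis using xy by simp
  qed
  show "inv x \<in> {x \<in> carrier H. int p dvd ?D x}" if x: "x \<in> {x \<in> carrier H. int p dvd ?D x}" for x
  proof -
    have xc: "x \<in> carrier H" using x by simp
    have "[0 = ?D x + int (lam p (co x)) * ?D (inv x)] (mod int p)"
      using form_mult[OF p xc, of "inv x" \<alpha> \<beta>] xc one by simp
    hence "int p dvd ?D x + int (lam p (co x)) * ?D (inv x)" using cong_dvd_iff by (metis dvd_0_right)
    hence "int p dvd int (lam p (co x)) * ?D (inv x)" using x by (simp add: dvd_add_right_iff)
    moreover have "\<not> int p dvd int (lam p (co x))"
    proof
      assume "int p dvd int (lam p (co x))"
      hence "p dvd lam p (co x) * lam p (co (inv x))" by simp
      moreover have "[1 = lam p (co x) * lam p (co (inv x))] (mod p)"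
        using lam_mult[OF p xc, of "inv x"] xc lam_one[OF p] by simp
      ultimately have "p dvd 1" using cong_dvd_iff by blast
      thus False using prime_pi[OF p] not_prime_unit by blast
    qed
    ultimately show ?thesis using xc pr by (simp add: prime_dvd_mult_iff)
  qed
qed auto

lemma unit_ex:
  assumes "(p, s) \<in> J \<delta>" "a < p"
  shows "\<exists>x\<in>carrier H. \<forall>j\<in>J \<delta>. co x j = (if j = (p, s) then a else 0)"
proof (rule co_ex)
  fix q t assume "(q, t) \<in> J \<delta>"
  hence "q > 0" using prime_pi prime_gt_0_nat by (auto simp: J_def)
  thus "(if (q, t) = (p, s) then a else 0) < q" using assms by auto
qed

text \<open>A crossed homomorphism that vanishes on generators vanishes on the whole group. The unit
  vector at \<open>(p, s)\<close> then isolates \<open>\<alpha> s\<close>, and the one at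
  \<open>(r p, 0)\<close> gives \<open>\<beta> * (u p - 1)\<close>, where p does not divide
  \<open>u p - 1\<close>.\<close>

lemma generating_indep:
  assumes f: "f \<in> {..<k} \<rightarrow>\<^sub>E carrier H" and gen: "generate H (f ` {..<k}) = carrier H"
  shows "(\<lambda>j\<in>J \<delta>. \<lambda>i\<in>{..<k}. co (f i) j) \<in> cols k \<delta>"
proof -
  let ?M = "\<lambda>j\<in>J \<delta>. \<lambda>i\<in>{..<k}. co (f i) j"
  have fc: "f i \<in> carrier H" if "i < k" for i using f that by auto
  have "?M \<in> (\<Pi>\<^sub>E (p, s)\<in>J \<delta>. {..<k} \<rightarrow>\<^sub>E {..<p})" using co_lt fc by (auto split: if_splits)
  moreover have "indep k \<delta> ?M"
    unfolding indep_def
  proof (intro ballI allI impI)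
    fix p \<alpha> \<beta> assume p: "p \<in> \<pi>" and z: "\<forall>i<k. int p dvd form \<delta> p \<alpha> \<beta> (\<lambda>j. ?M j i)"
    have pr: "Factorial_Ring.prime p" by (rule prime_pi[OF p])
    let ?D = "\<lambda>x. form \<delta> p \<alpha> \<beta> (co x)"
    have "form \<delta> p \<alpha> \<beta> (\<lambda>j. ?M j i) = ?D (f i)" if i: "i < k" for i
    proof -
      have "(\<Sum>s<\<delta> p. \<alpha> s * int (?M (p, s) i)) = (\<Sum>s<\<delta> p. \<alpha> s * int (co (f i) (p, s)))"
        by (rule sum.cong) (use i p in \<open>auto simp: J_def\<close>)
      moreover have "lam p (\<lambda>j. ?M j i) = lam p (co (f i))"
        using eps_cases[OF p] r_J[OF p] i by (auto simp: lam_def)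
      ultimately show ?thesis by (simp add: form_def)
    qed
    hence "f ` {..<k} \<subseteq> {x \<in> carrier H. int p dvd ?D x}" using z fc by auto
    hence "generate H (f ` {..<k}) \<subseteq> {x \<in> carrier H. int p dvd ?D x}"
      by (rule generate_subgroup_incl[OF _ form_kernel_subgroup[OF p]])
    hence "carrier H \<subseteq> {x \<in> carrier H. int p dvd ?D x}" unfolding gen .
    hence all: "int p dvd ?D x" if "x \<in> carrier H" for x using that by blast
    have "int p dvd \<alpha> s" if s: "s < \<delta> p" for s
    proof -
      have psJ: "(p, s) \<in> J \<delta>" using p s by (simp add: J_def)
      obtain x where x: "x \<in> carrier H" "\<forall>j\<in>J \<delta>. co x j = (if j = (p, s) then 1 else 0)"
        using unit_ex[OF psJ prime_gt_1_nat[OF pr]] by blast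
      have "lam p (co x) = 1"
      proof (cases "\<epsilon> p = 0")
        case False
        hence e: "\<epsilon> p = 1" using eps_cases[OF p] by simp
        have "r p \<noteq> p" using r_pi[OF p e] e by auto
        hence "co x (r p, 0) = 0" using x(2) r_J[OF p e] by simp
        thus ?thesis by (simp add: lam_def)
      qed (simp add: lam_def)
      moreover have "(\<Sum>t<\<delta> p. \<alpha> t * int (co x (p, t))) = (\<Sum>t<\<delta> p. if t = s then \<alpha> s else 0)"
        by (rule sum.cong) (use x p in \<open>auto simp: J_def\<close>)
      ultimately have "?D x = \<alpha> s" using s by (simp add: form_def)
      thus ?thesis using all[OF x(1)] by simp
    qed
    moreover have "int p dvd \<beta>" if e: "\<epsilon> p = 1"
    proof -
      have rp: "r p \<noteq> p" using r_pi[OF p e] e by auto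
      have "Factorial_Ring.prime (r p)" using r_pi[OF p e] prime_pi by blast
      then obtain x where x: "x \<in> carrier H" "\<forall>j\<in>J \<delta>. co x j = (if j = (r p, 0) then 1 else 0)"
        using unit_ex[OF r_J[OF p e], of 1] prime_gt_1_nat by blast
      have "lam p (co x) = u p" using x r_J[OF p e] e by (simp add: lam_def)
      moreover have "(\<Sum>t<\<delta> p. \<alpha> t * int (co x (p, t))) = 0"
        by (rule sum.neutral) (use x p rp in \<open>auto simp: J_def\<close>)
      ultimately have "int p dvd \<beta> * (int (u p) - 1)" using all[OF x(1)] by (simp add: form_def)
      moreover have "\<not> int p dvd int (u p) - 1"
        using u_ne[OF p e] by (metis cong_iff_dvd_diff cong_int_iff of_nat_1)
      moreover have "Factorial_Ring.prime (int p)" using pr by simp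
      ultimately show ?thesis by (simp add: prime_dvd_mult_iff)
    qed
    ultimately show "(\<forall>s<\<delta> p. int p dvd \<alpha> s) \<and> (\<epsilon> p = 1 \<and> \<delta> (r p) > 0 \<longrightarrow> int p dvd \<beta>)" by blast
  qed
  ultimately show ?thesis by (simp add: cols_def)
qed

section \<open>Coordinate subgroups: supersolubility, order and Sylow subgroups of H\<close>

definition W :: "(nat \<times> nat) set \<Rightarrow> nat set" where
  "W L = {x \<in> carrier H. \<forall>j\<in>J \<delta> - L. co x j = 0}"

lemma co_inv_zero:
  assumes x: "x \<in> carrier H" and j: "j \<in> J \<delta>" "co x j = 0"
  shows "co (inv x) j = 0"
proof -
  obtain p s where ps: "j = (p, s)" by (cases j)
  have "co (inv x \<otimes> x) (p, s) = (co (inv x) (p, s) + lam p (co (inv x)) * co x (p, s)) mod p"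
    by (rule co_mult) (use x j ps in auto)
  hence "co (inv x) (p, s) mod p = 0" using x j ps co_one by simp
  thus ?thesis using co_lt[of "inv x" p s] x j ps by simp
qed

lemma W_subgroup: "subgroup (W L) H"
proof (rule subgroupI)
  show "W L \<noteq> {}" using co_one by (auto simp: W_def intro!: exI[of _ \<one>])
  show "inv x \<in> W L" if "x \<in> W L" for x using that co_inv_zero by (auto simp: W_def)
  show "x \<otimes> y \<in> W L" if xy: "x \<in> W L" "y \<in> W L" for x y
  proof -
    have "co (x \<otimes> y) j = 0" if j: "j \<in> J \<delta> - L" for j
    proof -
      obtain p s where ps: "j = (p, s)" by (cases j)
      show ?thesis using co_mult[of x y p s] xy j ps by (auto simp: W_def)
    qed
    thus ?thesis using xy by (auto simp: W_def)
  qed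
qed (auto simp: W_def)

lemma card_W:
  assumes L: "L \<subseteq> J \<delta>"
  shows "card (W L) = (\<Prod>(p, s)\<in>L. p)"
proof -
  have "bij_betw (\<lambda>x. restrict (co x) L) (W L) (\<Pi>\<^sub>E (p, s)\<in>L. {..<p})"
    unfolding bij_betw_def
  proof
    show "inj_on (\<lambda>x. restrict (co x) L) (W L)"
    proof (rule inj_onI)
      fix x y assume xy: "x \<in> W L" "y \<in> W L" and eq: "restrict (co x) L = restrict (co y) L"
      show "x = y"
      proof (rule co_eqI)
        fix j assume j: "j \<in> J \<delta>"
        show "co x j = co y j"
        proof (cases "j \<in> L")
          case True
          thus ?thesis using fun_cong[OF eq, of j] by simp
        next
          case False
          thus ?thesis using xy j by (simp add: W_def)
        qed
      qed (use xy in \<open>auto simp: W_def\<close>)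
    qed
    show "(\<lambda>x. restrict (co x) L) ` W L = (\<Pi>\<^sub>E (p, s)\<in>L. {..<p})"
    proof (intro equalityI subsetI)
      fix v assume "v \<in> (\<lambda>x. restrict (co x) L) ` W L"
      thus "v \<in> (\<Pi>\<^sub>E (p, s)\<in>L. {..<p})" using L co_lt by (auto simp: W_def PiE_iff)
    next
      fix v assume v: "v \<in> (\<Pi>\<^sub>E (p, s)\<in>L. {..<p})"
      have "\<exists>x\<in>carrier H. \<forall>j\<in>J \<delta>. co x j = (if j \<in> L then v j else 0)"
      proof (rule co_ex)
        fix p s assume ps: "(p, s) \<in> J \<delta>"
        hence "p > 0" using prime_pi prime_gt_0_nat by (auto simp: J_def)
        thus "(if (p, s) \<in> L then v (p, s) else 0) < p" using v by (auto simp: PiE_iff)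
      qed
      then obtain x where x: "x \<in> carrier H" "\<And>j. j \<in> J \<delta> \<Longrightarrow> co x j = (if j \<in> L then v j else 0)" by blast
      have "x \<in> W L" using x by (simp add: W_def)
      moreover have "restrict (co x) L = v"
      proof
        fix j show "restrict (co x) L j = v j"
          using x(2)[of j] L v by (cases j; cases "j \<in> L") (auto simp: PiE_iff extensional_def)
      qed
      ultimately show "v \<in> (\<lambda>x. restrict (co x) L) ` W L" by blast
    qed
  qed
  hence "card (W L) = card (\<Pi>\<^sub>E (p, s)\<in>L. {..<p})" by (rule bij_betw_same_card)
  also have "\<dots> = (\<Prod>j\<in>L. card (case j of (p, s) \<Rightarrow> {..<p}))"
    by (rule card_PiE) (use L finite_J finite_subset in blast)
  also have "\<dots> = (\<Prod>(p, s)\<in>L. p)" by (rule prod.cong) auto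
  finally show ?thesis .
qed

lemma W_J: "W (J \<delta>) = carrier H" by (simp add: W_def)

lemma W_mono: "L \<subseteq> L' \<Longrightarrow> W L \<subseteq> W L'" by (auto simp: W_def)

lemma W_empty: "W {} = {\<one>}"
proof -
  have "x = \<one>" if x: "x \<in> W {}" for x
  proof (rule co_eqI)
    show "co x j = co \<one> j" if "j \<in> J \<delta>" for j using x that co_one[OF that] by (simp add: W_def)
  qed (use x in \<open>simp_all add: W_def\<close>)
  moreover have "\<one> \<in> W {}" by (rule subgroup.one_closed[OF W_subgroup])
  ultimately show ?thesis by blast
qed

text \<open>Compare coordinates in \<open>g \<otimes> x = y \<otimes> g\<close> for the conjugate
  \<open>y\<close>: a coordinate of \<open>y\<close> outside \<open>L\<close> vanishes once the
  scalar of \<open>y\<close> there is 1. If \<open>L\<close> contains all twisted coordinates, only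
  untwisted ones lie outside. If \<open>L\<close> has only twisted ones, the acting coordinates of
  \<open>y\<close> vanish first, so all its scalars are 1.\<close>

lemma W_normal:
  assumes L: "(\<forall>(p, s)\<in>L. \<epsilon> p = 1) \<or> (\<forall>(p, s)\<in>J \<delta>. \<epsilon> p = 1 \<longrightarrow> (p, s) \<in> L)"
  shows "W L \<lhd> H"
  unfolding normal_inv_iff
proof (intro conjI ballI)
  show "subgroup (W L) H" by (rule W_subgroup)
  fix g x assume g: "g \<in> carrier H" and x: "x \<in> W L"
  have xc: "x \<in> carrier H" using x by (simp add: W_def)
  define y where "y = g \<otimes> x \<otimes> inv g"
  have yc: "y \<in> carrier H" using g xc by (simp add: y_def)
  have eq: "g \<otimes> x = y \<otimes> g" using g xc by (simp add: y_def m_assoc)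
  have key: "co y (p, s) = 0" if j: "(p, s) \<in> J \<delta>" "(p, s) \<notin> L" and l: "lam p (co y) = 1" for p s
  proof -
    have "co x (p, s) = 0" using x j by (auto simp: W_def)
    hence "co g (p, s) mod p = (co y (p, s) + co g (p, s)) mod p"
      using co_mult[OF g xc j(1)] co_mult[OF yc g j(1)] eq l by simp
    hence "[co y (p, s) + co g (p, s) = 0 + co g (p, s)] (mod p)" by (simp add: cong_def)
    hence "[co y (p, s) = 0] (mod p)" using cong_add_rcancel_nat by blast
    thus ?thesis using co_lt[OF yc j(1)] by (simp add: cong_def)
  qed
  have "co y (p, s) = 0" if j: "(p, s) \<in> J \<delta>" "(p, s) \<notin> L" for p s
  proof (rule key[OF j])
    have p: "p \<in> \<pi>" using j by (simp add: J_def)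
    show "lam p (co y) = 1"
    proof (cases "\<epsilon> p = 0")
      case False
      hence e: "\<epsilon> p = 1" using eps_cases[OF p] by simp
      hence "\<forall>(p, s)\<in>L. \<epsilon> p = 1" using L j by blast
      hence "(r p, 0) \<notin> L" using r_pi[OF p e] by auto
      moreover have "lam (r p) (co y) = 1" using r_pi[OF p e] by (simp add: lam_def)
      ultimately have "co y (r p, 0) = 0" using key[OF r_J[OF p e]] by blast
      thus ?thesis by (simp add: lam_def)
    qed (simp add: lam_def)
  qed
  thus "g \<otimes> x \<otimes> inv g \<in> W L" using yc unfolding y_def[symmetric] by (auto simp: W_def)
qed

text \<open>Adjoin the coordinates one at a time, twisted ones first. Every initial segment then
  satisfies one alternative of \<open>W_normal\<close>, and every step has prime index.\<close>

lemma supersolvable_H: "supersolvable H"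
proof -
  define NN where "NN = {(p, s) \<in> J \<delta>. \<epsilon> p = 1}"
  have "finite NN" by (rule finite_subset[OF _ finite_J[of \<delta>]]) (auto simp: NN_def)
  then obtain as where as: "set as = NN" "distinct as"
    using finite_distinct_list by blast
  obtain bs where bs: "set bs = J \<delta> - NN" "distinct bs"
    using finite_distinct_list[OF finite_Diff[OF finite_J[of \<delta>], of NN]] by blast
  define js where "js = as @ bs"
  have js: "set js = J \<delta>" "distinct js" using as bs by (auto simp: js_def NN_def)
  define N where "N i = W (set (take i js))" for i
  have sub: "set (take i js) \<subseteq> J \<delta>" for i using js set_take_subset by metis
  have N0: "N 0 = {\<one>}" by (simp add: N_def W_empty)
  have nor: "N i \<lhd> H" for i
  proof (cases "i \<le> length as")
    case True
    hence "set (take i js) \<subseteq> NN" using as set_take_subset[of i as] by (simp add: js_def)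
    hence "\<forall>(p, s)\<in>set (take i js). \<epsilon> p = 1" by (auto simp: NN_def)
    thus ?thesis unfolding N_def by (intro W_normal disjI1)
  next
    case False
    hence "NN \<subseteq> set (take i js)" using as by (simp add: js_def)
    hence "\<forall>(p, s)\<in>J \<delta>. \<epsilon> p = 1 \<longrightarrow> (p, s) \<in> set (take i js)" by (auto simp: NN_def)
    thus ?thesis unfolding N_def by (intro W_normal disjI2)
  qed
  have step: "N i \<subseteq> N (Suc i) \<and> cyclic_group ((H\<lparr>carrier := N (Suc i)\<rparr>) Mod (N i))"
    if i: "i < length js" for i
  proof
    obtain p s where ps: "js ! i = (p, s)" by (cases "js ! i")
    have tk: "set (take (Suc i) js) = insert (p, s) (set (take i js))"
      using i ps by (simp add: take_Suc_conv_app_nth)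
    have nin: "(p, s) \<notin> set (take i js)"
    proof
      assume "(p, s) \<in> set (take i js)"
      then obtain m where "m < i" "js ! m = (p, s)" using i by (auto simp: in_set_conv_nth)
      thus False using ps js(2) i nth_eq_iff_index_eq[of js m i] by simp
    qed
    show NS: "N i \<subseteq> N (Suc i)" using tk by (auto simp: N_def W_def)
    have psJ: "(p, s) \<in> J \<delta>" using i ps js(1) nth_mem by metis
    hence pr: "Factorial_Ring.prime p" using prime_pi by (simp add: J_def)
    have card: "card (N (Suc i)) = p * card (N i)"
      unfolding N_def card_W[OF sub] unfolding tk using nin by simp
    have sS: "subgroup (N (Suc i)) H" "subgroup (N i) H" using nor normal_imp_subgroup by blast+
    interpret S: group "H\<lparr>carrier := N (Suc i)\<rparr>" using sS(1) subgroup.subgroup_is_group is_group by blast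
    have nS: "N i \<lhd> H\<lparr>carrier := N (Suc i)\<rparr>"
      by (rule normal_restrict_supergroup[OF sS(1) nor NS])
    interpret Q: group "(H\<lparr>carrier := N (Suc i)\<rparr>) Mod (N i)" by (rule normal.factorgroup_is_group[OF nS])
    have "card (rcosets\<^bsub>H\<lparr>carrier := N (Suc i)\<rparr>\<^esub> N i) * card (N i) = p * card (N i)"
      using S.lagrange[OF normal_imp_subgroup[OF nS]] card by (simp add: order_def)
    moreover have "card (N i) > 0" using subgroup.finite_imp_card_positive[OF sS(2) finH] .
    ultimately have "order ((H\<lparr>carrier := N (Suc i)\<rparr>) Mod (N i)) = p" by (simp add: order_def FactGroup_def)
    thus "cyclic_group ((H\<lparr>carrier := N (Suc i)\<rparr>) Mod (N i))" using Q.prime_order_cyclic pr by simp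
  qed
  have "N (length js) = carrier H" using js W_J by (simp add: N_def)
  thus ?thesis unfolding supersolvable_def using N0 nor step is_group by blast
qed

lemma order_H: "order H = (\<Prod>p\<in>\<pi>. p ^ \<delta> p)"
proof -
  have "J \<delta> = Sigma \<pi> (\<lambda>p. {..<\<delta> p})" by (auto simp: J_def)
  moreover have "order H = (\<Prod>(p, s)\<in>J \<delta>. p)" using card_W[of "J \<delta>"] W_J by (simp add: order_def)
  moreover have "(\<Prod>(p, s)\<in>Sigma \<pi> (\<lambda>p. {..<\<delta> p}). p) = (\<Prod>p\<in>\<pi>. \<Prod>s<\<delta> p. p)"
    by (rule prod.Sigma[symmetric]) (use fin_pi in auto)
  ultimately show ?thesis by simp
qed

lemma prime_divs_H:
  assumes "\<And>p. p \<in> \<pi> \<Longrightarrow> \<delta> p > 0"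
  shows "prime_divs (order H) = \<pi>"
proof (intro equalityI subsetI)
  fix q assume "q \<in> prime_divs (order H)"
  hence q: "Factorial_Ring.prime q" "q dvd (\<Prod>p\<in>\<pi>. p ^ \<delta> p)" by (auto simp: prime_divs_def order_H)
  from q(2) obtain p where p: "p \<in> \<pi>" "q dvd p ^ \<delta> p"
    unfolding prime_dvd_prod_iff[OF fin_pi q(1)] by blast
  hence "q dvd p" using q(1) prime_dvd_power by blast
  thus "q \<in> \<pi>" using q(1) prime_pi[OF p(1)] p(1) primes_dvd_imp_eq by blast
next
  fix p assume p: "p \<in> \<pi>"
  have "p dvd p ^ \<delta> p" using assms[OF p] by simp
  also have "\<dots> dvd order H" unfolding order_H by (rule dvd_prodI[OF fin_pi p])
  finally show "p \<in> prime_divs (order H)" using prime_pi[OF p] by (simp add: prime_divs_def)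
qed

lemma gen_prob_H_le:
  "gen_prob H k \<le> real (\<Prod>p\<in>\<pi>. \<Prod>s<\<delta> p. p ^ k - p ^ (s + \<epsilon> p)) / (\<Prod>p\<in>\<pi>. \<Prod>s<\<delta> p. real p ^ k)"
proof -
  let ?gens = "{f \<in> {..<k} \<rightarrow>\<^sub>E carrier H. generate H (f ` {..<k}) = carrier H}"
  let ?F = "\<lambda>f. \<lambda>j\<in>J \<delta>. \<lambda>i\<in>{..<k}. co (f i) j"
  have "card ?gens \<le> card (cols k \<delta>)"
  proof (rule card_inj_on_le[of ?F, OF _ _ finite_cols])
    show "?F ` ?gens \<subseteq> cols k \<delta>" using generating_indep by blast
    show "inj_on ?F ?gens"
    proof (rule inj_onI)
      fix f g assume f: "f \<in> ?gens" and g: "g \<in> ?gens" and eq: "?F f = ?F g"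
      show "f = g"
      proof
        fix i show "f i = g i"
        proof (cases "i < k")
          case True
          show ?thesis
          proof (rule co_eqI)
            fix j assume "j \<in> J \<delta>"
            thus "co (f i) j = co (g i) j" using fun_cong[OF fun_cong[OF eq, of j], of i] True by simp
          qed (use f g True in auto)
        next
          case False
          thus ?thesis using f g by (auto simp: PiE_iff extensional_def)
        qed
      qed
    qed
  qed
  also have "\<dots> \<le> (\<Prod>p\<in>\<pi>. \<Prod>s<\<delta> p. p ^ k - p ^ (s + \<epsilon> p))"
    by (rule card_cols_le) (use \<delta>_r in blast)
  finally have "real (card ?gens) \<le> real (\<Prod>p\<in>\<pi>. \<Prod>s<\<delta> p. p ^ k - p ^ (s + \<epsilon> p))" by (simp only: of_nat_le_iff)
  moreover have "real (card (carrier H)) ^ k = (\<Prod>p\<in>\<pi>. \<Prod>s<\<delta> p. real p ^ k)"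
  proof -
    have "real (card (carrier H)) = (\<Prod>p\<in>\<pi>. real p ^ \<delta> p)" using order_H by (simp add: order_def)
    thus ?thesis by (simp add: prod_power_distrib power_mult[symmetric] mult.commute)
  qed
  ultimately show ?thesis unfolding gen_prob_def by (simp add: divide_right_mono prod_nonneg)
qed

text \<open>The coordinate \<open>(p, 0)\<close> of an untwisted p is a homomorphism onto Z/p; its
  kernel contains the derived subgroup and has index p.\<close>

lemma p_dvd_abelianization:
  assumes p: "p \<in> \<pi>" "\<epsilon> p = 0" "\<delta> p > 0"
  shows "p dvd order (abelianization H)"
proof -
  have j: "(p, 0) \<in> J \<delta>" using p by (simp add: J_def)
  define K where "K = W (J \<delta> - {(p, 0)})"
  have sK: "subgroup K H" unfolding K_def by (rule W_subgroup)
  have K: "x \<in> K \<longleftrightarrow> x \<in> carrier H \<and> co x (p, 0) = 0" for x using j by (auto simp: K_def W_def)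
  have add: "co (x \<otimes> y) (p, 0) = (co x (p, 0) + co y (p, 0)) mod p" if "x \<in> carrier H" "y \<in> carrier H" for x y
    using co_mult[OF that j] p(2) by (simp add: lam_def)
  have "derived H (carrier H) \<subseteq> K"
    unfolding derived_def
  proof (rule generate_subgroup_incl[OF _ sK], clarify)
    fix x y assume xy: "x \<in> carrier H" "y \<in> carrier H"
    have ix: "(co x (p, 0) + co (inv x) (p, 0)) mod p = 0" if "x \<in> carrier H" for x
      using add[OF that inv_closed[OF that]] that co_one[OF j] by simp
    have "co (x \<otimes> y \<otimes> inv x \<otimes> inv y) (p, 0)
        = (co x (p, 0) + co y (p, 0) + co (inv x) (p, 0) + co (inv y) (p, 0)) mod p"
      using xy add by (simp add: mod_simps)
    also have "\<dots> = ((co x (p, 0) + co (inv x) (p, 0)) mod p + (co y (p, 0) + co (inv y) (p, 0)) mod p) mod p"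
      unfolding mod_add_eq by (simp add: algebra_simps)
    also have "\<dots> = 0" using ix xy by simp
    finally show "x \<otimes> y \<otimes> inv x \<otimes> inv y \<in> K" using xy K by simp
  qed
  moreover have sD: "subgroup (derived H (carrier H)) H" using derived_is_subgroup by blast
  ultimately obtain t where t: "card K = card (derived H (carrier H)) * t"
    using card_subgroup_dvd[OF sD sK] by (auto simp: dvd_def)
  have "order H = p * card K"
  proof -
    have "order H = (\<Prod>(p, s)\<in>J \<delta>. p)" using card_W[of "J \<delta>"] W_J by (simp add: order_def)
    also have "\<dots> = p * (\<Prod>(p, s)\<in>J \<delta> - {(p, 0)}. p)" using prod.remove[OF finite_J j, of "\<lambda>(p, s). p"] by simp
    also have "(\<Prod>(p, s)\<in>J \<delta> - {(p, 0)}. p) = card K" unfolding K_def by (rule card_W[symmetric]) blast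
    finally show ?thesis .
  qed
  moreover have "order (abelianization H) * card (derived H (carrier H)) = order H"
    using lagrange[OF sD] by (simp add: order_def FactGroup_def)
  ultimately have "card (derived H (carrier H)) * order (abelianization H) = card (derived H (carrier H)) * (p * t)"
    using t by (simp add: algebra_simps)
  moreover have "card (derived H (carrier H)) > 0" using subgroup.finite_imp_card_positive[OF sD finH] .
  ultimately show ?thesis by simp
qed

text \<open>The elements supported on the coordinates at p form a Sylow subgroup. The scalar
  \<lambda>_p is 1 on it, since \<open>r p\<close> differs from p, so coordinates simply add and the
  \<open>\<delta> p\<close> unit vectors generate it.\<close>

lemma d_p_H_le:
  assumes p: "p \<in> \<pi>"
  shows "d_p H p \<le> \<delta> p"
proof -
  have pr: "Factorial_Ring.prime p" by (rule prime_pi[OF p])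
  define L where "L t = {(p, s) |s. s < t}" for t :: nat
  have LJ: "L t \<subseteq> J \<delta>" if "t \<le> \<delta> p" for t using that p by (auto simp: L_def J_def)
  define P where "P = W (L (\<delta> p))"
  have cardP: "card P = p ^ \<delta> p"
  proof -
    have "L (\<delta> p) = Pair p ` {..<\<delta> p}" by (auto simp: L_def)
    hence "(\<Prod>(p, s)\<in>L (\<delta> p). p) = (\<Prod>s<\<delta> p. p)" by (simp add: prod.reindex inj_on_def)
    thus ?thesis using card_W[OF LJ] by (simp add: P_def)
  qed
  have sP: "subgroup P H" unfolding P_def by (rule W_subgroup)
  have syl: "sylow_subgroup H p P"
  proof (rule sylow_subgroupI[OF sP cardP pr])
    show "order H = card P * (\<Prod>q\<in>\<pi> - {p}. q ^ \<delta> q)"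
      unfolding order_H cardP by (rule prod.remove[OF fin_pi p])
    show "\<not> p dvd (\<Prod>q\<in>\<pi> - {p}. q ^ \<delta> q)"
    proof
      assume "p dvd (\<Prod>q\<in>\<pi> - {p}. q ^ \<delta> q)"
      then obtain q where q: "q \<in> \<pi>" "q \<noteq> p" "p dvd q ^ \<delta> q"
        using prime_dvd_prod_iff[of "\<pi> - {p}" p] fin_pi pr by auto
      hence "p dvd q" using pr prime_dvd_power by blast
      thus False using q prime_pi[OF q(1)] pr primes_dvd_imp_eq by blast
    qed
  qed
  have "\<forall>s. \<exists>x. s < \<delta> p \<longrightarrow> x \<in> carrier H \<and> (\<forall>j\<in>J \<delta>. co x j = (if j = (p, s) then 1 else 0))"
  proof
    fix s
    have "\<exists>x\<in>carrier H. \<forall>j\<in>J \<delta>. co x j = (if j = (p, s) then 1 else 0)" if "s < \<delta> p"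
      using unit_ex[of p s 1] prime_gt_1_nat[OF pr] p that by (simp add: J_def)
    thus "\<exists>x. s < \<delta> p \<longrightarrow> x \<in> carrier H \<and> (\<forall>j\<in>J \<delta>. co x j = (if j = (p, s) then 1 else 0))" by blast
  qed
  then obtain g where g: "\<And>s. s < \<delta> p \<Longrightarrow> g s \<in> carrier H"
    "\<And>s j. s < \<delta> p \<Longrightarrow> j \<in> J \<delta> \<Longrightarrow> co (g s) j = (if j = (p, s) then 1 else 0)" by metis
  define S where "S = g ` {..<\<delta> p}"
  have lamP: "lam p (co x) = 1" if x: "x \<in> P" for x
  proof (cases "\<epsilon> p = 0")
    case False
    hence e: "\<epsilon> p = 1" using eps_cases[OF p] by simp
    have "r p \<noteq> p" using r_pi[OF p e] e by auto
    hence "(r p, 0) \<notin> L (\<delta> p)" by (auto simp: L_def)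
    hence "co x (r p, 0) = 0" using x r_J[OF p e] by (auto simp: P_def W_def)
    thus ?thesis by (simp add: lam_def)
  qed (simp add: lam_def)
  have gP: "g s \<in> P" if "s < \<delta> p" for s using g[OF that] that by (auto simp: P_def W_def L_def)
  have SP: "S \<subseteq> P" using gP by (auto simp: S_def)
  have sub: "generate H S \<subseteq> P" by (rule generate_subgroup_incl[OF SP sP])
  have shift: "x \<otimes> g s \<in> generate H S" if "x \<in> generate H S" "s < \<delta> p" for x s
    by (rule generate.eng[OF that(1)]) (rule generate.incl, use that(2) in \<open>simp add: S_def\<close>)
  \<comment> \<open>The outer induction admits one coordinate more; the inner one lowers the value
    of that coordinate by splitting off a unit vector.\<close>
  have WL: "W (L t) \<subseteq> generate H S" if t: "t \<le> \<delta> p" for t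
    using t
  proof (induction t)
    case 0
    show ?case using generate.one[of H S] by (simp add: L_def W_empty)
  next
    case (Suc t)
    have td: "t < \<delta> p" using Suc.prems by simp
    have ptJ: "(p, t) \<in> J \<delta>" using p td by (simp add: J_def)
    have "x \<in> generate H S" if x: "x \<in> W (L (Suc t))" "co x (p, t) = a" for x a
      using x
    proof (induction a arbitrary: x)
      case 0
      have "co x j = 0" if j: "j \<in> J \<delta> - L t" for j
      proof (cases "j = (p, t)")
        case False
        hence "j \<in> J \<delta> - L (Suc t)" using j by (auto simp: L_def less_Suc_eq)
        thus ?thesis using 0 by (simp add: W_def)
      qed (use 0 in simp)
      hence "x \<in> W (L t)" using 0 by (simp add: W_def)
      thus ?case using Suc.IH td by auto
    next
      case (Suc a)
      have xc: "x \<in> carrier H" using Suc.prems by (simp add: W_def)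
      have ap: "Suc a < p" using co_lt[OF xc ptJ] Suc.prems by simp
      have "\<exists>y\<in>carrier H. \<forall>j\<in>J \<delta>. co y j = (if j = (p, t) then a else co x j)"
        by (rule co_ex) (use co_lt[OF xc] ap in auto)
      then obtain y where y: "y \<in> carrier H" "\<And>j. j \<in> J \<delta> \<Longrightarrow> co y j = (if j = (p, t) then a else co x j)" by blast
      have yW: "y \<in> W (L (Suc t))" using y Suc.prems ptJ by (auto simp: W_def L_def)
      hence "y \<in> generate H S" using Suc.IH[of y] y ptJ by simp
      hence "y \<otimes> g t \<in> generate H S" by (rule shift[OF _ td])
      moreover have "y \<otimes> g t = x"
      proof (rule co_eqI)
        fix j assume j: "j \<in> J \<delta>"
        obtain q s where qs: "j = (q, s)" by (cases j)
        have "L (Suc t) \<subseteq> L (\<delta> p)" using td by (auto simp: L_def)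
        hence yP: "y \<in> P" using yW W_mono unfolding P_def by blast
        have "co (y \<otimes> g t) (q, s) = (co y (q, s) + lam q (co y) * co (g t) (q, s)) mod q"
          by (rule co_mult[OF y(1) g(1)[OF td]]) (use j qs in simp)
        also have "\<dots> = co x (q, s)"
        proof (cases "(q, s) = (p, t)")
          case True
          thus ?thesis using y(2)[OF ptJ] g(2)[OF td ptJ] lamP[OF yP] ap Suc.prems by simp
        next
          case False
          hence "co y (q, s) = co x (q, s)" "co (g t) (q, s) = 0"
            using y(2)[of "(q, s)"] g(2)[OF td, of "(q, s)"] j qs by auto
          thus ?thesis using co_lt[OF xc, of q s] j qs by simp
        qed
        finally show "co (y \<otimes> g t) j = co x j" using qs by simp
      qed (use y g td xc in auto)
      ultimately show ?case by simp
    qed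
    thus ?case by blast
  qed
  have gen: "generate H S = P" using sub WL[of "\<delta> p"] by (auto simp: P_def)
  have "card S = \<delta> p"
  proof -
    have "inj_on g {..<\<delta> p}"
    proof (rule inj_onI)
      fix s t assume st: "s \<in> {..<\<delta> p}" "t \<in> {..<\<delta> p}" and eq: "g s = g t"
      have "(p, s) \<in> J \<delta>" using st p by (simp add: J_def)
      hence "co (g t) (p, s) = 1" using g(2)[of s "(p, s)"] st eq by simp
      thus "s = t" using g(2)[of t "(p, s)"] st \<open>(p, s) \<in> J \<delta>\<close> by (auto split: if_splits)
    qed
    thus ?thesis by (simp add: S_def card_image)
  qed
  moreover have "finite S" by (simp add: S_def)
  ultimately have "\<exists>P S. sylow_subgroup H p P \<and> S \<subseteq> P \<and> finite S \<and> card S = \<delta> p \<and> generate H S = P"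
    using syl SP gen by blast
  thus ?thesis unfolding d_p_def by (rule Least_le)
qed

end

text \<open>The group lives on coordinate vectors with the twisted addition; the quotient by its
  trivial subgroup copies it to the natural numbers, and \<open>co\<close> is the inverse of that
  copy.\<close>

lemma (in coord_data) exists_coord_group:
  assumes \<delta>_r: "\<And>p. p \<in> \<pi> \<Longrightarrow> \<epsilon> p = 1 \<Longrightarrow> \<delta> (r p) > 0"
    and u_pow: "\<And>p. p \<in> \<pi> \<Longrightarrow> \<epsilon> p = 1 \<Longrightarrow> [u p ^ r p = 1] (mod p)"
    and u_ne: "\<And>p. p \<in> \<pi> \<Longrightarrow> \<epsilon> p = 1 \<Longrightarrow> [u p \<noteq> 1] (mod p)"
  shows "\<exists>(H::nat monoid) co. coord_group \<pi> \<epsilon> r u H \<delta> co"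
proof -
  define V where "V = (\<Pi>\<^sub>E (p, s)\<in>J \<delta>. {..<p})"
  define F :: "(nat \<times> nat \<Rightarrow> nat) monoid" where
    "F = \<lparr>carrier = V, monoid.mult = (\<lambda>x y. \<lambda>(p, s)\<in>J \<delta>. (x (p, s) + lam p x * y (p, s)) mod p),
          one = (\<lambda>j\<in>J \<delta>. 0)\<rparr>"
  have F_simps: "carrier F = V" "\<one>\<^bsub>F\<^esub> = (\<lambda>j\<in>J \<delta>. 0)"
    "x \<otimes>\<^bsub>F\<^esub> y = (\<lambda>(p, s)\<in>J \<delta>. (x (p, s) + lam p x * y (p, s)) mod p)" for x y
    by (simp_all add: F_def)
  have Jpi: "p \<in> \<pi>" "p > 0" if "(p, s) \<in> J \<delta>" for p s
    using that prime_pi prime_gt_0_nat by (auto simp: J_def)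
  have Vlt: "x (p, s) < p" if "x \<in> V" "(p, s) \<in> J \<delta>" for x p s
    using that by (auto simp: V_def PiE_iff)
  have Vext: "x j = undefined" if "x \<in> V" "j \<notin> J \<delta>" for x j
    using that by (cases j) (auto simp: V_def PiE_iff extensional_def)
  have VI: "x \<in> V" if "\<And>p s. (p, s) \<in> J \<delta> \<Longrightarrow> x (p, s) < p" "\<And>j. j \<notin> J \<delta> \<Longrightarrow> x j = undefined" for x
    using that by (auto simp: V_def PiE_iff extensional_def)
  have Veq: "x = y" if "x \<in> V" "y \<in> V" "\<And>p s. (p, s) \<in> J \<delta> \<Longrightarrow> x (p, s) = y (p, s)" for x y
  proof
    fix j show "x j = y j" using that(3) Vext[OF that(1), of j] Vext[OF that(2), of j]
      by (cases j; cases "j \<in> J \<delta>") auto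
  qed
  have mult: "(x \<otimes>\<^bsub>F\<^esub> y) (p, s) = (x (p, s) + lam p x * y (p, s)) mod p" if "(p, s) \<in> J \<delta>" for x y p s
    using that by (simp add: F_simps)
  have closed: "x \<otimes>\<^bsub>F\<^esub> y \<in> V" for x y
    by (rule VI) (use Jpi in \<open>auto simp: F_simps\<close>)
  have oneV: "\<one>\<^bsub>F\<^esub> \<in> V" by (rule VI) (use Jpi in \<open>auto simp: F_simps\<close>)
  have rJ: "(r p, 0) \<in> J \<delta>" if "p \<in> \<pi>" "\<epsilon> p = 1" for p using that r_pi \<delta>_r by (simp add: J_def)
  have eps: "\<epsilon> p = 0 \<or> \<epsilon> p = 1" if "p \<in> \<pi>" for p using eps_le[OF that] by auto
  have lam_one: "lam p \<one>\<^bsub>F\<^esub> = 1" if "p \<in> \<pi>" for p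
    using eps[OF that] rJ[OF that] by (auto simp: lam_def F_simps)
  have lam_mult: "[lam p (x \<otimes>\<^bsub>F\<^esub> y) = lam p x * lam p y] (mod p)" if p: "p \<in> \<pi>" for p x y
  proof (cases "\<epsilon> p = 0")
    case False
    hence e: "\<epsilon> p = 1" using eps[OF p] by simp
    let ?n = "x (r p, 0) + y (r p, 0)"
    have "(x \<otimes>\<^bsub>F\<^esub> y) (r p, 0) = ?n mod r p" using mult[OF rJ[OF p e]] r_pi[OF p e] by (simp add: lam_def)
    moreover have "u p ^ ?n = (u p ^ r p) ^ (?n div r p) * u p ^ (?n mod r p)"
      by (simp flip: power_mult power_add)
    moreover have "[(u p ^ r p) ^ (?n div r p) * u p ^ (?n mod r p) = 1 ^ (?n div r p) * u p ^ (?n mod r p)] (mod p)"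
      by (intro cong_mult cong_pow u_pow[OF p e] cong_refl)
    ultimately show ?thesis using e by (simp add: lam_def power_add cong_sym)
  qed (simp add: lam_def)
  have assoc: "x \<otimes>\<^bsub>F\<^esub> y \<otimes>\<^bsub>F\<^esub> z = x \<otimes>\<^bsub>F\<^esub> (y \<otimes>\<^bsub>F\<^esub> z)" for x y z
  proof (rule Veq[OF closed closed])
    fix p s assume j: "(p, s) \<in> J \<delta>"
    let ?l = "lam p x" and ?m = "lam p y"
    have "[lam p (x \<otimes>\<^bsub>F\<^esub> y) * z (p, s) = ?l * ?m * z (p, s)] (mod p)"
      by (intro cong_mult lam_mult Jpi(1)[OF j] cong_refl)
    hence 1: "[(x (p, s) + ?l * y (p, s)) mod p + lam p (x \<otimes>\<^bsub>F\<^esub> y) * z (p, s)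
        = (x (p, s) + ?l * y (p, s)) + ?l * ?m * z (p, s)] (mod p)"
      by (intro cong_add) (simp_all add: cong_def)
    have 2: "[x (p, s) + ?l * ((y (p, s) + ?m * z (p, s)) mod p) = x (p, s) + ?l * (y (p, s) + ?m * z (p, s))] (mod p)"
      by (intro cong_add cong_mult) (simp_all add: cong_def)
    show "(x \<otimes>\<^bsub>F\<^esub> y \<otimes>\<^bsub>F\<^esub> z) (p, s) = (x \<otimes>\<^bsub>F\<^esub> (y \<otimes>\<^bsub>F\<^esub> z)) (p, s)"
      using 1 2 by (simp add: mult[OF j] cong_def algebra_simps)
  qed
  have left_one: "\<one>\<^bsub>F\<^esub> \<otimes>\<^bsub>F\<^esub> x = x" if "x \<in> V" for x
  proof (rule Veq[OF closed that])
    fix p s assume j: "(p, s) \<in> J \<delta>"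
    show "(\<one>\<^bsub>F\<^esub> \<otimes>\<^bsub>F\<^esub> x) (p, s) = x (p, s)"
      unfolding mult[OF j] lam_one[OF Jpi(1)[OF j]] using j Vlt[OF that j] by (simp add: F_simps)
  qed
  have inv: "\<exists>y\<in>V. y \<otimes>\<^bsub>F\<^esub> x = \<one>\<^bsub>F\<^esub>" if x: "x \<in> V" for x
  proof -
    \<comment> \<open>The inverse of \<open>x\<close> in the semidirect product has p-coordinates
      -\<lambda>_p(x)^(-1) x. Here \<open>l p\<close> is \<lambda>_p(x)^(-1), and subtraction from
      the modulus stands for negation.\<close>
    define l where "l p = (if \<epsilon> p = 0 then 1 else u p ^ ((r p - x (r p, 0)) mod r p))" for p
    define y where "y = (\<lambda>(p, s)\<in>J \<delta>. (l p * (p - x (p, s))) mod p)"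
    have yV: "y \<in> V" by (rule VI) (use Jpi in \<open>auto simp: y_def\<close>)
    have ly: "lam p y = l p" if p: "p \<in> \<pi>" for p
    proof (cases "\<epsilon> p = 0")
      case False
      hence e: "\<epsilon> p = 1" using eps[OF p] by simp
      have "l (r p) = 1" using r_pi[OF p e] by (simp add: l_def)
      thus ?thesis using rJ[OF p e] e by (simp add: lam_def y_def l_def)
    qed (simp add: lam_def l_def)
    have "y \<otimes>\<^bsub>F\<^esub> x = \<one>\<^bsub>F\<^esub>"
    proof (rule Veq[OF closed oneV])
      fix p s assume j: "(p, s) \<in> J \<delta>"
      have "(y \<otimes>\<^bsub>F\<^esub> x) (p, s) = (l p * (p - x (p, s)) mod p + l p * x (p, s)) mod p"
        unfolding mult[OF j] ly[OF Jpi(1)[OF j]] using j by (simp add: y_def)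
      also have "\<dots> = (l p * (p - x (p, s)) + l p * x (p, s)) mod p" by (simp add: mod_simps)
      also have "l p * (p - x (p, s)) + l p * x (p, s) = l p * p"
        using Vlt[OF x j] by (simp flip: distrib_left)
      finally show "(y \<otimes>\<^bsub>F\<^esub> x) (p, s) = \<one>\<^bsub>F\<^esub> (p, s)" using j by (simp add: F_simps)
    qed
    thus ?thesis using yV by blast
  qed
  have grp: "group F"
    by (rule groupI) (use closed oneV assoc left_one inv in \<open>auto simp: F_simps(1)\<close>)
  interpret F: group F by (rule grp)
  have finF: "finite (carrier F)"
    unfolding F_simps(1) V_def by (intro finite_PiE finite_J) (auto split: prod.splits)
  obtain H :: "nat monoid" and \<phi> where H: "group_hom F H \<phi>" "\<phi> ` carrier F = carrier H" "kernel F H \<phi> = {\<one>\<^bsub>F\<^esub>}"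
    using F.exists_nat_quotient[OF finF F.one_is_normal] by blast
  interpret H: group_hom F H \<phi> by (rule H(1))
  have inj: "inj_on \<phi> (carrier F)" using H.trivial_ker_imp_inj[OF H(3)] .
  define co where "co = inv_into (carrier F) \<phi>"
  have co_in: "co x \<in> carrier F" "\<phi> (co x) = x" if "x \<in> carrier H" for x
    using that H(2) inv_into_into[of x \<phi> "carrier F"] f_inv_into_f[of x \<phi> "carrier F"] by (auto simp: co_def)
  have co_phi: "co (\<phi> v) = v" if "v \<in> carrier F" for v using inv_into_f_f[OF inj that] by (simp add: co_def)
  have co_mult: "co (x \<otimes>\<^bsub>H\<^esub> y) = co x \<otimes>\<^bsub>F\<^esub> co y" if "x \<in> carrier H" "y \<in> carrier H" for x y
  proof -
    have c: "co x \<in> carrier F" "co y \<in> carrier F" using co_in that by blast+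
    have "x \<otimes>\<^bsub>H\<^esub> y = \<phi> (co x \<otimes>\<^bsub>F\<^esub> co y)" using c co_in(2) that H.hom_mult by simp
    thus ?thesis using co_phi[OF F.m_closed[OF c]] by (simp only:)
  qed
  have "coord_group \<pi> \<epsilon> r u H \<delta> co"
  proof (intro coord_group.intro coord_group_axioms.intro)
    show "coord_data \<pi> \<epsilon> r" by (rule coord_data_axioms)
    show "Group.group H" by (rule H.H.is_group)
    show "bij_betw co (carrier H) (\<Pi>\<^sub>E (p, s)\<in>J \<delta>. {..<p})"
      unfolding V_def[symmetric] F_simps(1)[symmetric] co_def
      using inj H(2) by (intro bij_betw_inv_into) (simp add: bij_betw_def)
    show "co (x \<otimes>\<^bsub>H\<^esub> y) (p, s) = (co x (p, s) + lam p (co x) * co y (p, s)) mod p"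
      if "x \<in> carrier H" "y \<in> carrier H" "(p, s) \<in> J \<delta>" for x y p s
      using co_mult[OF that(1,2)] mult[OF that(3)] by simp
    have "co \<one>\<^bsub>H\<^esub> = \<one>\<^bsub>F\<^esub>" using co_phi[OF F.one_closed] H.hom_one by simp
    thus "co \<one>\<^bsub>H\<^esub> j = 0" if "j \<in> J \<delta>" for j using that by (simp add: F_simps)
  qed (use \<delta>_r u_pow u_ne in auto)
  thus ?thesis by blast
qed

section \<open>Generator numbers, roots of unity modulo p, and the comparison of G with H\<close>

lemma (in group) card_zp_chars_generated:
  assumes S: "finite S" "S \<subseteq> carrier G" "generate G S = P" and p: "p > 0"
  shows "card (zp_chars G p P {}) \<le> p ^ card S"
proof -
  have sP: "subgroup P G" using generate_is_subgroup[OF S(2)] S(3) by simp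
  interpret P: subgroup P G by fact
  have SP: "S \<subseteq> P" using S(3) generate.incl by fastforce
  have "card (zp_chars G p P {}) \<le> card (S \<rightarrow>\<^sub>E {..<p})"
  proof (rule card_inj_on_le[of "\<lambda>\<chi>. restrict \<chi> S"])
    show "finite (S \<rightarrow>\<^sub>E {..<p})" using S(1) by (intro finite_PiE) auto
    show "(\<lambda>\<chi>. restrict \<chi> S) ` zp_chars G p P {} \<subseteq> S \<rightarrow>\<^sub>E {..<p}"
      using SP by (auto simp: zp_chars_def PiE_iff)
    show "inj_on (\<lambda>\<chi>. restrict \<chi> S) (zp_chars G p P {})"
    proof (rule inj_onI)
      fix \<chi> \<psi> assume \<chi>: "\<chi> \<in> zp_chars G p P {}" and \<psi>: "\<psi> \<in> zp_chars G p P {}"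
        and eq: "restrict \<chi> S = restrict \<psi> S"
      have m: "\<chi> (x \<otimes> y) = (\<chi> x + \<chi> y) mod p" "\<psi> (x \<otimes> y) = (\<psi> x + \<psi> y) mod p"
        if "x \<in> P" "y \<in> P" for x y using \<chi> \<psi> that by (auto simp: zp_chars_def)
      have lt: "\<chi> x < p" "\<psi> x < p" if "x \<in> P" for x using \<chi> \<psi> that by (auto simp: zp_chars_def PiE_iff)
      have "subgroup {x \<in> P. \<chi> x = \<psi> x} G"
      proof (rule subgroupI)
        have "a = 0" if "a = (a + a) mod p" "a < p" for a
          using that by (auto simp: mod_if split: if_splits)
        hence "\<chi> \<one> = 0" "\<psi> \<one> = 0" using m[of \<one> \<one>] lt[of \<one>] by auto
        hence one: "\<chi> \<one> = \<psi> \<one>" by simp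
        thus "{x \<in> P. \<chi> x = \<psi> x} \<noteq> {}" using P.one_closed by blast
        show "{x \<in> P. \<chi> x = \<psi> x} \<subseteq> carrier G" using P.subset by blast
        show "x \<otimes> y \<in> {x \<in> P. \<chi> x = \<psi> x}" if "x \<in> {x \<in> P. \<chi> x = \<psi> x}" "y \<in> {x \<in> P. \<chi> x = \<psi> x}" for x y
          using that m[of x y] by auto
        show "inv x \<in> {x \<in> P. \<chi> x = \<psi> x}" if x: "x \<in> {x \<in> P. \<chi> x = \<psi> x}" for x
        proof -
          have xP: "x \<in> P" "inv x \<in> P" "x \<in> carrier G" "\<chi> x = \<psi> x" using x by auto
          have "(\<chi> x + \<chi> (inv x)) mod p = (\<psi> x + \<psi> (inv x)) mod p"
            using m[OF xP(1,2)] one xP(3) by simp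
          hence "[\<chi> x + \<chi> (inv x) = \<chi> x + \<psi> (inv x)] (mod p)" using xP(4) by (simp add: cong_def)
          hence "[\<chi> (inv x) = \<psi> (inv x)] (mod p)" using cong_add_lcancel_nat by blast
          thus ?thesis using lt[OF xP(2)] xP(2) by (simp add: cong_def)
        qed
      qed
      moreover have "\<chi> s = \<psi> s" if "s \<in> S" for s using fun_cong[OF eq, of s] that by simp
      hence "S \<subseteq> {x \<in> P. \<chi> x = \<psi> x}" using SP by blast
      ultimately have "P \<subseteq> {x \<in> P. \<chi> x = \<psi> x}" using generate_subgroup_incl S(3) by blast
      hence in_P: "\<chi> x = \<psi> x" if "x \<in> P" for x using that by blast
      show "\<chi> = \<psi>"
      proof
        fix x show "\<chi> x = \<psi> x"
          using in_P \<chi> \<psi> by (cases "x \<in> P") (auto simp: zp_chars_def PiE_iff extensional_def)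
      qed
    qed
  qed
  thus ?thesis using S(1) by (simp add: card_PiE)
qed

lemma d_p_attained:
  assumes "group G" "finite (carrier G)" "Factorial_Ring.prime p"
  shows "\<exists>P S. sylow_subgroup G p P \<and> S \<subseteq> P \<and> finite S \<and> card S = d_p G p \<and> generate G S = P"
proof -
  interpret group G by fact
  obtain P where P: "sylow_subgroup G p P" using sylow_subgroup_exists[OF assms] by blast
  hence sP: "subgroup P G" by (simp add: sylow_subgroup_def)
  have "finite P" using subgroup.subset[OF sP] assms(2) finite_subset by blast
  moreover have "generate G P = P"
    using generate_subgroup_incl[OF order_refl sP] generate.incl[of _ P G] by blast
  ultimately have "\<exists>n. \<exists>P S. sylow_subgroup G p P \<and> S \<subseteq> P \<and> finite S \<and> card S = n \<and> generate G S = P"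
    using P by blast
  thus ?thesis unfolding d_p_def by (rule LeastI_ex)
qed

lemma d_p_pos:
  assumes "group G" "finite (carrier G)" "Factorial_Ring.prime p" "p dvd order G"
  shows "d_p G p > 0"
proof (rule ccontr)
  interpret group G by fact
  assume "\<not> d_p G p > 0"
  then obtain P S where P: "sylow_subgroup G p P" "finite S" "card S = 0" "generate G S = P"
    using d_p_attained[OF assms(1-3)] by auto
  hence "P = {\<one>\<^bsub>G\<^esub>}" using generate_empty by auto
  hence "p ^ multiplicity p (order G) = 1" using P(1) by (simp add: sylow_subgroup_def)
  moreover have "order G \<noteq> 0" using assms(2) order_gt_0_iff_finite by simp
  hence "multiplicity p (order G) > 0" using assms(3,4) by (simp add: prime_multiplicity_gt_zero_iff)
  ultimately show False using prime_gt_1_nat[OF assms(3)] by simp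
qed

text \<open>Take the power with exponent (p - 1)/q of a primitive root.\<close>

lemma exists_root_of_unity_mod:
  assumes p: "Factorial_Ring.prime (p::nat)" and q: "Factorial_Ring.prime q" "q dvd p - 1"
  shows "\<exists>u. [u ^ q = 1] (mod p) \<and> [u \<noteq> 1] (mod p)"
proof -
  obtain g where g: "residue_primroot p g" using prime_primitive_root_exists[OF _ p] prime_gt_1_nat[OF p] by blast
  have ordg: "Pocklington.ord p g = p - 1" using g p by (simp add: residue_primroot_def totient_prime)
  obtain m where m: "p - 1 = q * m" using q(2) by (auto simp: dvd_def)
  have "p - 1 > 0" using prime_gt_1_nat[OF p] by simp
  hence m0: "m > 0" using m by (metis gr0I mult_0_right)
  have "[(g ^ m) ^ q = 1] (mod p)"
    using ord[of g p] ordg m by (simp add: power_mult[symmetric] mult.commute)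
  moreover have "[g ^ m \<noteq> 1] (mod p)"
  proof
    assume "[g ^ m = 1] (mod p)"
    hence "p - 1 dvd m" using ord_divides[of g m p] ordg by simp
    hence "p - 1 \<le> m" using m0 by (rule dvd_imp_le)
    hence "q * m \<le> 1 * m" using m by simp
    thus False using m0 prime_gt_1_nat[OF q(1)] by simp
  qed
  ultimately show ?thesis by blast
qed

theorem theorem6:
  fixes G :: "('a, 'b) monoid_scheme"
  assumes "group G" and "finite (carrier G)" and "solvable G"
  shows "\<exists>H :: nat monoid. group H \<and> finite (carrier H) \<and> supersolvable H
     \<and> prime_divs (order H) = prime_divs (order G)
     \<and> (\<forall>k::nat. gen_prob G k \<ge> gen_prob H k)
     \<and> (\<forall>p \<in> prime_divs (order G). d_p G p \<ge> d_p H p)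
     \<and> prime_divs (order (abelianization G)) \<subseteq> prime_divs (order (abelianization H))"
proof -
  interpret group G by fact
  define \<pi> where "\<pi> = prime_divs (order G)"
  define a where "a = order (abelianization G)"
  define \<epsilon> :: "nat \<Rightarrow> nat" where "\<epsilon> p = (if p dvd a \<or> coprime (p - 1) a then 0 else 1)" for p
  define \<delta> where "\<delta> p = d_p G p" for p
  have ord0: "order G > 0" using assms(2) order_gt_0_iff_finite by simp
  have a_dvd: "a dvd order G"
    using lagrange[OF derived_is_subgroup[OF order_refl]] unfolding a_def order_def FactGroup_def
    by (metis dvd_triv_left partial_object.select_convs(1))
  have prime_pi: "Factorial_Ring.prime p" if "p \<in> \<pi>" for p using that by (simp add: \<pi>_def prime_divs_def)
  have fin_pi: "finite \<pi>"
    by (rule finite_subset[of _ "{..order G}"]) (use ord0 in \<open>auto simp: \<pi>_def prime_divs_def intro: dvd_imp_le\<close>)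
  have \<delta>_pos: "\<delta> p > 0" if "p \<in> \<pi>" for p
    using d_p_pos[OF assms(1,2)] that by (simp add: \<pi>_def prime_divs_def \<delta>_def)
  have ex: "\<exists>q v. q \<in> \<pi> \<and> \<epsilon> q = 0 \<and> [v ^ q = 1] (mod p) \<and> [v \<noteq> 1] (mod p)"
    if p: "p \<in> \<pi>" "\<epsilon> p = 1" for p
  proof -
    \<comment> \<open>A common prime divisor q of p - 1 and \<open>a\<close> has two uses: p - 1
      gives a nontrivial q-th root of unity modulo p, and q dividing \<open>a\<close> makes q
      untwisted, so one of its coordinates can act.\<close>
    have "gcd (p - 1) a \<noteq> 1"
    proof
      assume "gcd (p - 1) a = 1"
      hence "\<epsilon> p = 0" unfolding \<epsilon>_def by (simp only: coprime_iff_gcd_eq_1 simp_thms if_True)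
      thus False using p(2) by simp
    qed
    then obtain q where "Factorial_Ring.prime q" "q dvd gcd (p - 1) a" using prime_factor_nat by blast
    hence q: "Factorial_Ring.prime q" "q dvd p - 1" "q dvd a" by auto
    have "q \<in> \<pi>" using q a_dvd by (auto simp: \<pi>_def prime_divs_def)
    moreover have "\<epsilon> q = 0" using q by (simp add: \<epsilon>_def)
    ultimately show ?thesis using exists_root_of_unity_mod[OF prime_pi[OF p(1)] q(1,2)] by blast
  qed
  then obtain r u where ru: "\<And>p. p \<in> \<pi> \<Longrightarrow> \<epsilon> p = 1 \<Longrightarrow> r p \<in> \<pi> \<and> \<epsilon> (r p) = 0
      \<and> [u p ^ r p = 1] (mod p) \<and> [u p \<noteq> 1] (mod p)" by metis
  interpret coord_data \<pi> \<epsilon> r u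
    by unfold_locales (use fin_pi prime_pi ru in \<open>auto simp: \<epsilon>_def\<close>)
  obtain H :: "nat monoid" and co where H: "coord_group \<pi> \<epsilon> r u H \<delta> co"
    using exists_coord_group[of \<delta>] ru \<delta>_pos by blast
  interpret H: coord_group \<pi> \<epsilon> r u H \<delta> co by (rule H)
  have "gen_prob H k \<le> gen_prob G k" for k
  \<comment> \<open>For large k no subtraction is truncated, so the upper bound for H equals the
    lower bound for G. Otherwise the factor with s = \<delta> p - 1 is 0 for some p, and with it the
    probability for H.\<close>
  proof (cases "\<forall>p\<in>\<pi>. \<delta> p + \<epsilon> p \<le> k")
    case True
    have "gen_data G \<pi> \<epsilon> \<delta> k"
      unfolding gen_data_def
    proof (intro conjI ballI impI)
      fix p assume p: "p \<in> \<pi>"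
      show "comm_group G \<or> p dvd order (abelianization G) \<or> coprime (p - 1) (order (abelianization G))" if "\<epsilon> p = 0"
        using that by (auto simp: \<epsilon>_def a_def split: if_splits)
      obtain P S where PS: "sylow_subgroup G p P" "S \<subseteq> P" "finite S" "card S = \<delta> p" "generate G S = P"
        using d_p_attained[OF assms(1,2) prime_pi[OF p]] unfolding \<delta>_def by blast
      have "S \<subseteq> carrier G" using PS(1,2) subgroup.subset unfolding sylow_subgroup_def by blast
      hence "card (zp_chars G p P {}) \<le> p ^ \<delta> p"
        using card_zp_chars_generated[OF PS(3) _ PS(5) prime_gt_0_nat[OF prime_pi[OF p]]] PS(4) by simp
      thus "\<exists>P. sylow_subgroup G p P \<and> card (zp_chars G p P {}) \<le> p ^ \<delta> p" using PS(1) by blast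
    qed (use fin_pi prime_pi True in \<open>auto simp: \<pi>_def \<epsilon>_def\<close>)
    hence "gen_bound \<pi> \<epsilon> \<delta> k \<le> gen_prob G k" by (rule gen_prob_lower[OF assms])
    moreover have "gen_bound \<pi> \<epsilon> \<delta> k
        = real (\<Prod>p\<in>\<pi>. \<Prod>s<\<delta> p. p ^ k - p ^ (s + \<epsilon> p)) / (\<Prod>p\<in>\<pi>. \<Prod>s<\<delta> p. real p ^ k)"
    proof -
      have "1 - real p ^ (s + \<epsilon> p) / real p ^ k = real (p ^ k - p ^ (s + \<epsilon> p)) / real p ^ k"
        if p: "p \<in> \<pi>" "s < \<delta> p" for p s
      proof -
        have p0: "p > 0" using prime_gt_0_nat[OF prime_pi[OF p(1)]] .
        have "s + \<epsilon> p \<le> k" using True p by fastforce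
        hence "p ^ (s + \<epsilon> p) \<le> p ^ k" using p0 by (intro power_increasing) auto
        hence "real (p ^ k - p ^ (s + \<epsilon> p)) = real p ^ k - real p ^ (s + \<epsilon> p)" by (simp add: of_nat_diff)
        thus ?thesis using p0 by (simp add: diff_divide_distrib)
      qed
      hence "gen_bound \<pi> \<epsilon> \<delta> k = (\<Prod>p\<in>\<pi>. \<Prod>s<\<delta> p. real (p ^ k - p ^ (s + \<epsilon> p)) / real p ^ k)"
        unfolding gen_bound_def by (intro prod.cong refl) auto
      thus ?thesis by (simp add: prod_dividef)
    qed
    ultimately show ?thesis using H.gen_prob_H_le[of k] by linarith
  next
    case False
    then obtain p where p: "p \<in> \<pi>" "k < \<delta> p + \<epsilon> p" by (auto simp: not_le)
    have s: "\<delta> p - 1 < \<delta> p" using \<delta>_pos[OF p(1)] by simp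
    have "k \<le> \<delta> p - 1 + \<epsilon> p" using p by linarith
    hence "p ^ k \<le> p ^ (\<delta> p - 1 + \<epsilon> p)" using prime_gt_0_nat[OF prime_pi[OF p(1)]] by (intro power_increasing) auto
    hence "\<exists>s\<in>{..<\<delta> p}. p ^ k - p ^ (s + \<epsilon> p) = 0" using s by (intro bexI[of _ "\<delta> p - 1"]) auto
    hence "(\<Prod>s<\<delta> p. p ^ k - p ^ (s + \<epsilon> p)) = 0" by (rule prod_zero[rotated]) simp
    hence "(\<Prod>p\<in>\<pi>. \<Prod>s<\<delta> p. p ^ k - p ^ (s + \<epsilon> p)) = 0" using p(1) by (intro prod_zero[OF fin_pi]) blast
    hence "gen_prob H k \<le> 0" using H.gen_prob_H_le[of k] by (simp only: of_nat_0 div_0)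
    moreover have "0 \<le> gen_prob G k" by (simp add: gen_prob_def)
    ultimately show ?thesis by linarith
  qed
  moreover have "prime_divs (order H) = prime_divs (order G)"
    using H.prime_divs_H[OF \<delta>_pos] by (simp add: \<pi>_def)
  moreover have "d_p H p \<le> d_p G p" if "p \<in> prime_divs (order G)" for p
    using H.d_p_H_le[of p] that by (simp add: \<pi>_def \<delta>_def)
  moreover have "prime_divs (order (abelianization G)) \<subseteq> prime_divs (order (abelianization H))"
  proof
    fix p assume "p \<in> prime_divs (order (abelianization G))"
    hence p: "Factorial_Ring.prime p" "p dvd a" by (auto simp: prime_divs_def a_def)
    have pi: "p \<in> \<pi>" using p a_dvd by (auto simp: \<pi>_def prime_divs_def)
    have "\<epsilon> p = 0" using p by (simp add: \<epsilon>_def)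
    hence "p dvd order (abelianization H)" by (rule H.p_dvd_abelianization[OF pi _ \<delta>_pos[OF pi]])
    thus "p \<in> prime_divs (order (abelianization H))" using p by (simp add: prime_divs_def)
  qed
  ultimately show ?thesis using H.is_group H.finH H.supersolvable_H by blast
qed

end
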